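(* Let $k$ be an algebraically closed field of characteristic zero. Let $X\subset\mathbb{P}^4$ be a cubic threefold over $k$ whose singular locus $\mathrm{Sing}(X)$ consists of exactly five nodes, which are in general linear position, and let $G\subseteq\mathrm{Aut}(X)$. Suppose that $G$ does not act transitively on $\mathrm{Sing}(X)$. Then the $G$-action on $X$ is linearizable.
   Context: A node is an ordinary double point. The $G$-action on $X$ is linearizable if $X$ is $G$-equivariantly birational to $\mathbb{P}^3=\mathbb{P}(V)$ with action induced by a linear representation of $G$ on a $4$-dimensional vector space $V$. *)

theory Defs
  imports
    "HOL-Analysis.Analysis"
    "HOL-Library.Poly_Mapping"
    "HOL-Computational_Algebra.Polynomial"
    "HOL-Algebra.Bij"
begin

section \<open>Polynomials in finitely many variables\<close>

text \<open>Finitely supported maps from exponent vectors to coefficients; the ring structure is the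
  convolution product of the library.\<close>

type_synonym ('n, 'k) mpoly = "('n \<Rightarrow>\<^sub>0 nat) \<Rightarrow>\<^sub>0 'k"

definition peval :: "('n::finite, 'k::field) mpoly \<Rightarrow> 'k ^ 'n \<Rightarrow> 'k" where
  "peval F x =
     (\<Sum>m\<in>Poly_Mapping.keys F. Poly_Mapping.lookup F m * (\<Prod>i\<in>UNIV. (x $ i) ^ Poly_Mapping.lookup m i))"

definition homogeneous :: "nat \<Rightarrow> ('n::finite, 'k::field) mpoly \<Rightarrow> bool" where
  "homogeneous d F \<longleftrightarrow> (\<forall>m\<in>Poly_Mapping.keys F. (\<Sum>i\<in>UNIV. Poly_Mapping.lookup m i) = d)"

text \<open>The formal partial derivative. If the exponent of the variable is zero, the truncated
  subtraction of exponents is harmless because the coefficient vanishes.\<close>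

definition partial :: "'n \<Rightarrow> ('n::finite, 'k::field) mpoly \<Rightarrow> ('n, 'k) mpoly" where
  "partial i F =
     (\<Sum>m\<in>Poly_Mapping.keys F.
        Poly_Mapping.single (m - Poly_Mapping.single i 1)
          (of_nat (Poly_Mapping.lookup m i) * Poly_Mapping.lookup F m))"


section \<open>Projective space and its Zariski topology\<close>

text \<open>A point of the projective space of \<open>k\<^sup>n\<close> is a line through the origin, with \<open>0\<close> included.\<close>

definition proj_space :: "('k::field ^ 'n::finite) set set" where
  "proj_space = {vec.span {v} | v. v \<noteq> 0}"

definition hypersurface :: "('n::finite, 'k::field) mpoly \<Rightarrow> ('k ^ 'n) set set" where
  "hypersurface F = {p \<in> proj_space. \<forall>v\<in>p. peval F v = 0}"

text \<open>Complements of hypersurfaces form a basis of the Zariski topology.\<close>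

definition zariski :: "('k::field ^ 'n::finite) set topology" where
  "zariski = topology_generated_by {proj_space - hypersurface F | F d. homogeneous d F}"


section \<open>Regular maps\<close>

text \<open>Maps between (locally closed) subsets of projective spaces that are given, locally in the
  Zariski topology, by tuples of forms of equal degree without common zero. Over an algebraically
  closed field, varieties and their morphisms are determined by what happens on points.\<close>

definition regular_map ::
    "('k::field ^ 'n::finite) set set \<Rightarrow> ('k ^ 'm::finite) set set
       \<Rightarrow> (('k ^ 'n) set \<Rightarrow> ('k ^ 'm) set) \<Rightarrow> bool" where
  "regular_map X Y \<phi> \<longleftrightarrow> \<phi> \<in> X \<rightarrow> Y \<and>
     (\<forall>p\<in>X. \<exists>U d (f :: 'm \<Rightarrow> ('n, 'k) mpoly).
        openin (subtopology zariski X) U \<and> p \<in> U \<and> (\<forall>j. homogeneous d (f j)) \<and>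
        (\<forall>q\<in>U. \<forall>v\<in>q - {0}.
           (\<chi> j. peval (f j) v) \<noteq> 0 \<and> \<phi> q = vec.span {\<chi> j. peval (f j) v}))"

definition biregular_map ::
    "('k::field ^ 'n::finite) set set \<Rightarrow> ('k ^ 'm::finite) set set
       \<Rightarrow> (('k ^ 'n) set \<Rightarrow> ('k ^ 'm) set) \<Rightarrow> bool" where
  "biregular_map X Y \<phi> \<longleftrightarrow>
     bij_betw \<phi> X Y \<and> regular_map X Y \<phi> \<and> regular_map Y X (inv_into X \<phi>)"

text \<open>Automorphisms of the variety \<open>X\<close>, not assumed to be induced by linear maps of the ambient
  space. They are elements of the library's group \<^term>\<open>BijGroup X\<close>.\<close>

definition Aut :: "('k::field ^ 'n::finite) set set \<Rightarrow> (('k ^ 'n) set \<Rightarrow> ('k ^ 'n) set) set" where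
  "Aut X = {\<phi> \<in> Bij X. biregular_map X X \<phi>}"


section \<open>Singular points and nodes of hypersurfaces\<close>

definition Sing :: "('n::finite, 'k::field) mpoly \<Rightarrow> ('k ^ 'n) set set" where
  "Sing F = {p \<in> hypersurface F. \<forall>i. \<forall>v\<in>p. peval (partial i F) v = 0}"

definition hessian :: "('n::finite, 'k::field) mpoly \<Rightarrow> 'k ^ 'n \<Rightarrow> 'k ^ 'n ^ 'n" where
  "hessian F v = (\<chi> a b. peval (partial a (partial b F)) v)"

text \<open>An ordinary double point: a singular point at which a local equation has nondegenerate
  Hessian. The local equation in the affine chart \<open>x\<^sub>i = 1\<close> is the dehomogenization of \<open>F\<close>, whose
  Hessian is the restriction of the one of \<open>F\<close> to the coordinate hyperplane \<open>w\<^sub>i = 0\<close>.\<close>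

definition node :: "('n::finite, 'k::field) mpoly \<Rightarrow> ('k ^ 'n) set \<Rightarrow> bool" where
  "node F p \<longleftrightarrow> p \<in> Sing F \<and>
     (\<forall>v\<in>p. \<forall>i. v $ i = 1 \<longrightarrow>
        (\<forall>w. w $ i = 0 \<and>
             (\<forall>u. u $ i = 0 \<longrightarrow> (\<Sum>a\<in>UNIV. \<Sum>b\<in>UNIV. u $ a * hessian F v $ a $ b * w $ b) = 0)
           \<longrightarrow> w = 0))"

text \<open>Any at most \<open>n\<close> of the given points in the projective space of \<open>k\<^sup>n\<close> are linearly
  independent.\<close>

definition general_linear_position :: "('k::field ^ 'n::finite) set set \<Rightarrow> bool" where
  "general_linear_position S \<longleftrightarrow>
     (\<forall>T\<subseteq>S. finite T \<and> card T \<le> CARD('n) \<longrightarrow> vec.dim (\<Union>T) = card T)"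


section \<open>Group actions\<close>

definition acts_transitively_on :: "('a \<Rightarrow> 'a) set \<Rightarrow> 'a set \<Rightarrow> bool" where
  "acts_transitively_on G S \<longleftrightarrow> (\<forall>p\<in>S. \<forall>q\<in>S. \<exists>g\<in>G. g p = q)"

definition GL :: "('k::field ^ 'n::finite ^ 'n) monoid" where
  "GL = \<lparr>carrier = {A. invertible A}, mult = (**), one = mat 1\<rparr>"

definition proj_action :: "'k::field ^ 'n::finite ^ 'n \<Rightarrow> ('k ^ 'n) set \<Rightarrow> ('k ^ 'n) set" where
  "proj_action A p = (*v) A ` p"

text \<open>A birational map is an isomorphism \<open>\<phi>\<close> between dense open subsets. Equivariance is equality
  of rational maps, tested wherever both sides are defined by \<open>\<phi>\<close>; the open set \<open>U\<close> need not be
  invariant.\<close>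

definition equivariantly_birational ::
    "'g set \<Rightarrow> ('k::field ^ 'n::finite) set set \<Rightarrow> ('g \<Rightarrow> ('k ^ 'n) set \<Rightarrow> ('k ^ 'n) set)
       \<Rightarrow> ('k ^ 'm::finite) set set \<Rightarrow> ('g \<Rightarrow> ('k ^ 'm) set \<Rightarrow> ('k ^ 'm) set) \<Rightarrow> bool" where
  "equivariantly_birational G X \<alpha> Y \<beta> \<longleftrightarrow>
     (\<exists>U W \<phi>.
        openin (subtopology zariski X) U \<and> subtopology zariski X closure_of U = X \<and>
        openin (subtopology zariski Y) W \<and> subtopology zariski Y closure_of W = Y \<and>
        biregular_map U W \<phi> \<and>
        (\<forall>g\<in>G. \<forall>p\<in>U. \<alpha> g p \<in> U \<longrightarrow> \<phi> (\<alpha> g p) = \<beta> g (\<phi> p)))"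

text \<open>Linearizability of the tautological action of a subgroup \<open>G\<close> of \<^term>\<open>BijGroup X\<close> on a
  threefold \<open>X\<close>: the vector space \<open>V\<close> is \<open>k\<^sup>4\<close>.\<close>

definition linearizable ::
    "(('k::field ^ 'n::finite) set \<Rightarrow> ('k ^ 'n) set) set \<Rightarrow> ('k ^ 'n) set set \<Rightarrow> bool" where
  "linearizable G X \<longleftrightarrow>
     (\<exists>\<rho> \<in> hom (BijGroup X \<lparr>carrier := G\<rparr>) (GL :: ('k ^ 4 ^ 4) monoid).
        equivariantly_birational G X (\<lambda>g. g) (proj_space :: ('k ^ 4) set set)
          (\<lambda>g. proj_action (\<rho> g)))"

end

theory Submission
  imports Defs "Berlekamp_Zassenhaus.Unique_Factorization_Poly"
begin

text \<open>
  Take the five nodes as coordinate points. The cubic becomes a combination of the ten monomials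
  \<open>x\<^sub>i x\<^sub>j x\<^sub>k\<close> with distinct indices, and since there is no sixth singular point, all ten coefficients
  are nonzero. Singling out one node and rescaling gives the equation \<open>x\<^sub>5 q(x\<^sub>1, \<dots>, x\<^sub>4) + c(x\<^sub>1, \<dots>, x\<^sub>4)\<close>
  with \<open>q\<close> a quadratic form and \<open>c\<close> the third elementary symmetric polynomial; projection from the
  node is birational with inverse \<open>x \<mapsto> (q(x) x, - c(x))\<close>.

  Automorphisms are linear. The curve \<open>q = c = 0\<close> is irreducible, so \<open>q\<close> is prime in the coordinate ring
  of the affine cone. Pulled back to \<open>k\<^sup>4\<close>, the local representations of a morphism can be divided by their
  greatest common divisor, and removing the powers of \<open>q\<close> yields forms without common zero on \<open>X\<close>.
  Applied to an automorphism and its inverse, and restricted to a line in \<open>X\<close>, this shows that the forms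
  have degree one.

  If \<open>G\<close> fixes a node, projection from it is equivariant. Otherwise the orbits on the nodes have lengths
  three and two, and \<open>G\<close> contains an element inducing a 3-cycle. Nondegeneracy of the nodes then allows a
  scaling of the coordinates for which the equation is
  \<open>\<alpha> e\<^sub>3 + (x\<^sub>4 + x\<^sub>5) e\<^sub>2 + x\<^sub>4 x\<^sub>5 e\<^sub>1\<close>, with \<open>e\<^sub>i\<close> the elementary symmetric polynomials of
  \<open>x\<^sub>1, x\<^sub>2, x\<^sub>3\<close>, and \<open>G\<close> acts by permutations of the coordinates. The standard Cremona map commutes with
  these and sends \<open>X\<close> to a quadric with a fixed point \<open>(u, u, u, 1, 1)\<close>; projection from this point
  linearizes the action.
\<close>

text \<open>Behind the argument with \<open>q\<close> stands Nagata's criterion: on the cubic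
  \<open>x\<^sub>5 = - c / q\<close>, so inverting \<open>q\<close> turns the coordinate ring of the
  cone into a localization of a polynomial ring in four variables, and \<open>q\<close> is prime.
  The ring is thus factorial, which is why one tuple of forms represents a morphism globally.
  Factoriality itself is never stated; denominators appear as powers of \<open>q\<close> that are
  removed one by one. Polynomials are treated as functions, which loses nothing over an infinite
  field.

  Two obstacles shape the second half. The action has to come from a linear representation, not just
  a projective one: in both cases \<open>G\<close> fixes a line spanned by some
  \<open>\<eta>\<close>, and lifts that fix the vector \<open>\<eta>\<close> itself are unique,
  hence multiplicative, and act on the quotient by \<open>\<eta>\<close>. And a 3-cycle might
  multiply coefficients of the cubic by a primitive cube root of unity; then the Hessian at a node
  would degenerate. The number \<open>u\<close> in the fixed point is a root of
  \<open>3 u^2 + 6 u + \<alpha>\<close>, the value of the quadric at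
  \<open>(u, u, u, 1, 1)\<close>.\<close>

no_notation Matrix.vec_index (infixl "$" 100)
hide_type (open) Matrix.vec Matrix.mat
hide_const (open) Matrix.vec Matrix.mat Determinant.det Matrix.row Matrix.transpose_mat

section \<open>Forms and polynomial functions\<close>

text \<open>The degree is an integer, and forms of negative degree vanish, so that no case distinctions are
  needed when forms are divided.\<close>

inductive form :: "int \<Rightarrow> ('k::field ^ 'n::finite \<Rightarrow> 'k) \<Rightarrow> bool" where
  form_zero: "form d (\<lambda>_. 0)"
| form_const: "form 0 (\<lambda>_. c)"
| form_coord: "form d f \<Longrightarrow> form (d + 1) (\<lambda>x. x $ i * f x)"
| form_add: "form d f \<Longrightarrow> form d g \<Longrightarrow> form d (\<lambda>x. f x + g x)"

inductive polyfun :: "('k::field ^ 'n::finite \<Rightarrow> 'k) \<Rightarrow> bool" where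
  polyfun_const: "polyfun (\<lambda>_. c)"
| polyfun_coord: "polyfun f \<Longrightarrow> polyfun (\<lambda>x. x $ i * f x)"
| polyfun_add: "polyfun f \<Longrightarrow> polyfun g \<Longrightarrow> polyfun (\<lambda>x. f x + g x)"

lemma form_neg: "form d f \<Longrightarrow> d < 0 \<Longrightarrow> f x = 0"
  by (induction rule: form.induct) auto

lemma form_cong: "form d f \<Longrightarrow> (\<And>x. f x = g x) \<Longrightarrow> d = e \<Longrightarrow> form e g"
  by (metis ext)

lemma polyfun_cong: "polyfun f \<Longrightarrow> (\<And>x. f x = g x) \<Longrightarrow> polyfun g"
  by (metis ext)

lemma form_cmult: "form d f \<Longrightarrow> form d (\<lambda>x. c * f x)"
proof (induction rule: form.induct)
  case (form_zero d) show ?case using form.form_zero[of d] by simp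
next
  case (form_const a) show ?case by (rule form.form_const)
next
  case (form_coord d f i) show ?case
    by (rule form_cong[OF form.form_coord[OF form_coord.IH]]) auto
next
  case (form_add d f g) show ?case
    by (rule form_cong[OF form.form_add[OF form_add.IH]]) (auto simp: algebra_simps)
qed

lemma form_mult: "form d f \<Longrightarrow> form e g \<Longrightarrow> form (d + e) (\<lambda>x. f x * g x)"
proof (induction rule: form.induct)
  case (form_zero d) show ?case using form.form_zero[of "d + e"] by simp
next
  case (form_const a) then show ?case using form_cmult[of e g a] by simp
next
  case (form_coord d f i)
  from form_coord have "form (d + e) (\<lambda>x. f x * g x)" by blast
  from form.form_coord[OF this] show ?case by (rule form_cong) (auto simp: algebra_simps)
next
  case (form_add d f h)
  then have "form (d + e) (\<lambda>x. f x * g x)" "form (d + e) (\<lambda>x. h x * g x)" by blast+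
  from form.form_add[OF this] show ?case by (rule form_cong) (auto simp: algebra_simps)
qed

lemma form_uminus: "form d f \<Longrightarrow> form d (\<lambda>x. - f x)"
  using form_cmult[of d f "-1"] by simp

lemma form_diff: "form d f \<Longrightarrow> form d g \<Longrightarrow> form d (\<lambda>x. f x - g x)"
  using form_add[of d f "\<lambda>x. - g x"] form_uminus[of d g] by simp

lemma form_sum: "(\<And>a. a \<in> A \<Longrightarrow> form d (f a)) \<Longrightarrow> form d (\<lambda>x. \<Sum>a\<in>A. f a x)"
proof (induction A rule: infinite_finite_induct)
  case (insert a A)
  then show ?case by (simp add: form_add)
qed (simp_all add: form_zero)

lemma form_power: "form d f \<Longrightarrow> form (int n * d) (\<lambda>x. f x ^ n)"
proof (induction n)
  case 0 show ?case using form_const[of 1] by simp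
next
  case (Suc n)
  then have "form (d + int n * d) (\<lambda>x. f x * f x ^ n)" by (intro form_mult) auto
  then show ?case by (rule form_cong) (auto simp: algebra_simps)
qed

lemma form_prod: "finite A \<Longrightarrow> (\<And>a. a \<in> A \<Longrightarrow> form (d a) (f a)) \<Longrightarrow>
  form (\<Sum>a\<in>A. d a) (\<lambda>x. \<Prod>a\<in>A. f a x)"
proof (induction A rule: finite_induct)
  case empty show ?case using form_const[of 1] by simp
next
  case (insert a A)
  then show ?case by (simp add: form_mult)
qed

lemma form_proj: "form 1 (\<lambda>x. x $ i)"
  using form_coord[OF form_const[of 1], of i] by simp

lemma form_linear: "form 1 (\<lambda>x. (A *v x) $ i)"
  unfolding matrix_vector_mult_def by (simp, intro form_sum form_cmult form_proj)

lemma form_comp: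
  assumes "form d f" and g: "\<And>i. form e (\<lambda>x. g x $ i)"
  shows "form (d * e) (\<lambda>x. f (g x))"
  using assms(1)
proof (induction rule: form.induct)
  case (form_zero d) show ?case by (rule form.form_zero)
next
  case (form_const a) show ?case using form.form_const[of a] by simp
next
  case (form_coord d f i)
  from form_mult[OF g form_coord.IH, of i] show ?case by (rule form_cong) (auto simp: algebra_simps)
next
  case (form_add d f g)
  from form.form_add[OF form_add.IH] show ?case .
qed

lemma form_comp1:
  assumes "form d f" and g: "\<And>i. form 1 (\<lambda>x. g x $ i)"
  shows "form d (\<lambda>x. f (g x))"
  using form_comp[OF assms] by simp

text \<open>For negative \<open>d\<close> both sides vanish, so the truncation in
  \<open>nat d\<close> is harmless.\<close>

lemma form_scale: "form d f \<Longrightarrow> f (c *s x) = c ^ nat d * f x"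
proof (induction rule: form.induct)
  case (form_coord d f i)
  show ?case
  proof (cases "d < 0")
    case True then show ?thesis using form_neg[OF form_coord.hyps] by simp
  next
    case False
    then have "nat (d + 1) = Suc (nat d)" by simp
    then show ?thesis using form_coord.IH by simp
  qed
qed (auto simp: algebra_simps)

lemma form_at_0: "form d f \<Longrightarrow> d > 0 \<Longrightarrow> f 0 = 0"
  using form_scale[of d f 0 0] by (auto simp: power_0_left)

lemma form_0_const: "form d f \<Longrightarrow> d = 0 \<Longrightarrow> \<exists>c. \<forall>x. f x = c"
proof (induction rule: form.induct)
  case (form_coord d f i)
  then show ?case using form_neg[OF form_coord.hyps] by auto
next
  case (form_add d f g)
  then obtain a b where "\<forall>x. f x = a" "\<forall>x. g x = b" by blast
  then show ?case by auto
qed auto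

lemma form_1_linear: "form d f \<Longrightarrow> d = 1 \<Longrightarrow> \<exists>a. \<forall>x. f x = (\<Sum>i\<in>UNIV. a $ i * x $ i)"
proof (induction rule: form.induct)
  case (form_zero d) show ?case by (rule exI[of _ 0]) simp
next
  case (form_coord d f i)
  then obtain c where c: "\<forall>x. f x = c" using form_0_const by force
  have "x $ i * c = (\<Sum>j\<in>UNIV. axis i c $ j * x $ j)" for x
    by (simp add: axis_def if_distrib if_distribR cong: if_cong)
  then show ?case using c by auto
next
  case (form_add d f g)
  then obtain a b where "\<forall>x. f x = (\<Sum>i\<in>UNIV. a $ i * x $ i)" "\<forall>x. g x = (\<Sum>i\<in>UNIV. b $ i * x $ i)" by blast
  then show ?case by (intro exI[of _ "a + b"]) (simp add: algebra_simps sum.distrib)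
qed auto

text \<open>Restriction to a coordinate hyperplane, encoded as a map of the space to itself:
  restricted forms keep their type and can be compared with the original ones.\<close>

definition zero_at :: "'n \<Rightarrow> 'k::zero ^ 'n \<Rightarrow> 'k ^ 'n" where
  "zero_at i x = (\<chi> j. if j = i then 0 else x $ j)"

lemma zero_at_nth [simp]: "zero_at i x $ j = (if j = i then 0 else x $ j)"
  by (simp add: zero_at_def)

lemma form_comp_zero_at: "form d f \<Longrightarrow> form d (\<lambda>x. f (zero_at i x))"
proof (rule form_comp1)
  fix j show "form 1 (\<lambda>x. zero_at i x $ j)"
    by (cases "j = i") (auto simp: form_zero form_proj)
qed

text \<open>Division with remainder by a coordinate. The degree inductions below rest on it: the
  remainder depends on fewer variables, and the quotient has smaller degree.\<close>

lemma form_expand: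
  "form d f \<Longrightarrow> \<exists>g. form (d - 1) g \<and> (\<forall>x. f x = f (zero_at i x) + x $ i * g x)"
proof (induction rule: form.induct)
  case (form_zero d)
  show ?case by (rule exI[of _ "\<lambda>_. 0"]) (simp add: form.form_zero)
next
  case (form_const a)
  show ?case by (rule exI[of _ "\<lambda>_. 0"]) (simp add: form.form_zero)
next
  case (form_coord d f j)
  show ?case
  proof (cases "j = i")
    case True
    then show ?thesis using form_coord.hyps by (intro exI[of _ f]) auto
  next
    case False
    from form_coord obtain g where g: "form (d - 1) g" "\<And>x. f x = f (zero_at i x) + x $ i * g x" by blast
    have "form (d + 1 - 1) (\<lambda>x. x $ j * g x)"
      by (rule form_cong[OF form.form_coord[OF g(1), of j]]) auto
    moreover have "x $ j * f x = zero_at i x $ j * f (zero_at i x) + x $ i * (x $ j * g x)" for x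
      using False by (subst g(2)) (simp add: algebra_simps)
    ultimately show ?thesis by (intro exI[of _ "\<lambda>x. x $ j * g x"] conjI allI)
  qed
next
  case (form_add d f g)
  then obtain f' g' where f': "form (d - 1) f'" "\<And>x. f x = f (zero_at i x) + x $ i * f' x"
    and g': "form (d - 1) g'" "\<And>x. g x = g (zero_at i x) + x $ i * g' x" by blast
  have "f x + g x = f (zero_at i x) + g (zero_at i x) + x $ i * (f' x + g' x)" for x
    by (subst f'(2), subst g'(2)) (simp add: algebra_simps)
  with form.form_add[OF f'(1) g'(1)] show ?case
    by (intro exI[of _ "\<lambda>x. f' x + g' x"] conjI allI)
qed

section \<open>Inhomogeneous polynomial functions and their homogeneous components\<close>

lemma polyfun_cmult: "polyfun f \<Longrightarrow> polyfun (\<lambda>x. c * f x)"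
proof (induction rule: polyfun.induct)
  case (polyfun_const a) show ?case by (rule polyfun.polyfun_const)
next
  case (polyfun_coord f i) show ?case
    by (rule polyfun_cong[OF polyfun.polyfun_coord[OF polyfun_coord.IH, of i]]) auto
next
  case (polyfun_add f g) show ?case
    by (rule polyfun_cong[OF polyfun.polyfun_add[OF polyfun_add.IH]]) (auto simp: algebra_simps)
qed

lemma polyfun_mult: "polyfun f \<Longrightarrow> polyfun g \<Longrightarrow> polyfun (\<lambda>x. f x * g x)"
proof (induction rule: polyfun.induct)
  case (polyfun_const a) then show ?case by (simp add: polyfun_cmult)
next
  case (polyfun_coord f i)
  then have "polyfun (\<lambda>x. f x * g x)" by blast
  from polyfun.polyfun_coord[OF this] show ?case by (rule polyfun_cong) (auto simp: algebra_simps)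
next
  case (polyfun_add f h)
  then have "polyfun (\<lambda>x. f x * g x)" "polyfun (\<lambda>x. h x * g x)" by blast+
  from polyfun.polyfun_add[OF this] show ?case by (rule polyfun_cong) (auto simp: algebra_simps)
qed

lemma form_imp_polyfun: "form d f \<Longrightarrow> polyfun f"
  by (induction rule: form.induct) (auto intro: polyfun.intros)

lemma polyfun_proj: "polyfun (\<lambda>x. x $ i)"
  using form_imp_polyfun[OF form_proj] .

lemma polyfun_diff: "polyfun f \<Longrightarrow> polyfun g \<Longrightarrow> polyfun (\<lambda>x. f x - g x)"
  using polyfun_add[of f "\<lambda>x. (-1) * g x"] polyfun_cmult[of g "-1"] by simp

lemma polyfun_power: "polyfun f \<Longrightarrow> polyfun (\<lambda>x. f x ^ n)"
  by (induction n) (auto intro: polyfun_const polyfun_mult)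

lemma polyfun_comp:
  assumes "polyfun f" and g: "\<And>i. polyfun (\<lambda>x. g x $ i)"
  shows "polyfun (\<lambda>x. f (g x))"
  using assms(1) by (induction rule: polyfun.induct) (auto intro: polyfun.intros polyfun_mult g)

lemma polyfun_line: "polyfun f \<Longrightarrow> \<exists>p. \<forall>t. f (x + t *s y) = poly p t"
proof (induction rule: polyfun.induct)
  case (polyfun_const c) show ?case by (rule exI[of _ "[:c:]"]) simp
next
  case (polyfun_coord f i)
  then obtain p where "\<forall>t. f (x + t *s y) = poly p t" by blast
  then show ?case by (intro exI[of _ "[:x $ i, y $ i:] * p"]) (simp add: algebra_simps)
next
  case (polyfun_add f g)
  then obtain p q where "\<forall>t. f (x + t *s y) = poly p t" "\<forall>t. g (x + t *s y) = poly q t" by blast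
  then show ?case by (intro exI[of _ "p + q"]) simp
qed

text \<open>Points where \<open>f\<close> and \<open>g\<close> do not vanish are joined by a line.
  On it both become nonzero univariate polynomials, and a product that vanishes everywhere on an
  infinite field is zero.\<close>

lemma polyfun_mult_eq_0:
  fixes f g :: "'k::{field,ring_char_0} ^ 'n::finite \<Rightarrow> 'k"
  assumes "polyfun f" "polyfun g" and fg: "\<And>x. f x * g x = 0"
  shows "(\<forall>x. f x = 0) \<or> (\<forall>x. g x = 0)"
proof (rule ccontr)
  assume "\<not> ?thesis"
  then obtain x y where x: "f x \<noteq> 0" and y: "g y \<noteq> 0" by blast
  obtain p q where p: "\<And>t. f (x + t *s (y - x)) = poly p t"
    and q: "\<And>t. g (x + t *s (y - x)) = poly q t"
    using polyfun_line[OF assms(1)] polyfun_line[OF assms(2)] by metis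
  have "poly (p * q) t = 0" for t using fg p q by (metis poly_mult)
  then have "p * q = 0" using poly_all_0_iff_0 by blast
  moreover have "p \<noteq> 0" using p[of 0] x by auto
  moreover have "q \<noteq> 0" using q[of 1] y by auto
  ultimately show False by simp
qed

lemma polyfun_prod_eq_0:
  fixes f :: "'a \<Rightarrow> 'k::{field,ring_char_0} ^ 'n::finite \<Rightarrow> 'k"
  assumes "finite A" "\<And>a. a \<in> A \<Longrightarrow> polyfun (f a)" "\<And>a. a \<in> A \<Longrightarrow> \<exists>x. f a x \<noteq> 0"
  shows "\<exists>x. \<forall>a\<in>A. f a x \<noteq> 0"
proof -
  have "polyfun (\<lambda>x. \<Prod>a\<in>A. f a x) \<and> (\<exists>x. (\<Prod>a\<in>A. f a x) \<noteq> 0)"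
    using assms
  proof (induction A rule: finite_induct)
    case empty then show ?case by (simp add: polyfun_const)
  next
    case (insert a A)
    then have 1: "polyfun (\<lambda>x. \<Prod>a\<in>A. f a x)" "\<exists>x. (\<Prod>a\<in>A. f a x) \<noteq> 0"
       "polyfun (f a)" "\<exists>x. f a x \<noteq> 0" by auto
    have "polyfun (\<lambda>x. f a x * (\<Prod>a\<in>A. f a x))" using 1 by (intro polyfun_mult)
    moreover have "\<exists>x. f a x * (\<Prod>a\<in>A. f a x) \<noteq> 0"
      using polyfun_mult_eq_0[OF 1(3,1)] 1 by blast
    ultimately show ?case using insert.hyps by simp
  qed
  then show ?thesis using assms(1) by auto
qed

lemma polyfun_components:
  "polyfun f \<Longrightarrow> \<exists>N c. (\<forall>i. form (int i) (c i)) \<and> (\<forall>i>N. \<forall>x. c i x = 0) \<and> (\<forall>x. f x = (\<Sum>i\<le>(N::nat). c i x))"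
proof (induction rule: polyfun.induct)
  case (polyfun_const a)
  show ?case
    by (rule exI[of _ 0], rule exI[of _ "\<lambda>i x. if i = 0 then a else 0"]) (auto intro: form.intros)
next
  case (polyfun_coord f j)
  then obtain N c where c: "\<forall>i. form (int i) (c i)" "\<forall>i>N. \<forall>x. c i x = 0" "\<forall>x. f x = (\<Sum>i\<le>N. c i x)" by blast
  define c' where "c' i = (case i of 0 \<Rightarrow> \<lambda>_. 0 | Suc i \<Rightarrow> \<lambda>x. x $ j * c i x)" for i
  have "form (int i) (c' i)" for i
    using form_coord[of "int (i-1)" "c (i - 1)" j] c(1)
    by (cases i) (auto simp: c'_def form_zero add.commute)
  moreover have "x $ j * f x = (\<Sum>i\<le>Suc N. c' i x)" for x
    by (simp only: sum.atMost_Suc_shift) (simp add: c(3) c'_def sum_distrib_left)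
  moreover have "\<forall>i>Suc N. \<forall>x. c' i x = 0" using c(2) by (auto simp: c'_def split: nat.split)
  ultimately show ?case by blast
next
  case (polyfun_add f g)
  then obtain N c M d where c: "\<forall>i. form (int i) (c i)" "\<forall>i>N. \<forall>x. c i x = 0" "\<forall>x. f x = (\<Sum>i\<le>N. c i x)"
    and d: "\<forall>i. form (int i) (d i)" "\<forall>i>M. \<forall>x. d i x = 0" "\<forall>x. g x = (\<Sum>i\<le>M. d i x)" by blast
  have "(\<Sum>i\<le>N. c i x) = (\<Sum>i\<le>max N M. c i x)" "(\<Sum>i\<le>M. d i x) = (\<Sum>i\<le>max N M. d i x)" for x
    by (rule sum.mono_neutral_left; use c(2) d(2) in auto)+
  then have "f x + g x = (\<Sum>i\<le>max N M. c i x + d i x)" for x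
    using c(3) d(3) by (simp add: sum.distrib)
  moreover have "\<forall>i. form (int i) (\<lambda>x. c i x + d i x)" using c(1) d(1) by (auto intro: form.form_add)
  ultimately show ?case using c(2) d(2)
    by (intro exI[of _ "max N M"] exI[of _ "\<lambda>i x. c i x + d i x"]) auto
qed

text \<open>Restricted to a line through the origin, both factors divide a monomial, hence are
  monomials themselves.\<close>

lemma form_factor:
  fixes f g :: "'k::{field,ring_char_0} ^ 'n::finite \<Rightarrow> 'k"
  assumes "polyfun f" "polyfun g" and h: "form (int n) h" and fg: "\<And>x. f x * g x = h x"
    and x0: "h x0 \<noteq> 0"
  shows "\<exists>e. form (int e) f"
proof -
  obtain N c where c: "\<And>i. form (int i) (c i)" "\<And>i x. i > N \<Longrightarrow> c i x = 0" "\<And>x. f x = (\<Sum>i\<le>N. c i x)"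
    using polyfun_components[OF assms(1)] by blast
  obtain M d where d: "\<And>i. form (int i) (d i)" "\<And>x. g x = (\<Sum>i\<le>(M::nat). d i x)"
    using polyfun_components[OF assms(2)] by blast
  define I where "I = {i. \<exists>x. c i x \<noteq> 0}"
  have IN: "i \<le> N" if "i \<in> I" for i
    using that c(2) not_le unfolding I_def by blast
  then have fin: "finite I" by (intro finite_subset[of I "{..N}"]) auto
  have "I \<noteq> {}" using x0 fg[of x0] c(3)[of x0] unfolding I_def
    by (metis (mono_tags, lifting) empty_Collect_eq mult_zero_left sum.neutral)
  define m where "m = Max I"
  have mI: "m \<in> I" and mmax: "\<And>i. i \<in> I \<Longrightarrow> i \<le> m" using fin \<open>I \<noteq> {}\<close> by (auto simp: m_def)
  have zero: "c i x = 0" if "i \<noteq> m" for i x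
  proof -
    \<comment> \<open>The argument works where \<open>c m x\<close> and \<open>h x\<close> are
      nonzero. Multiplying by them gives an identity valid at all points, from which they are
      cancelled afterwards.\<close>
    have "c i x * (c m x * h x) = 0" for x
    proof (cases "c m x * h x = 0")
      case False
      define p where "p = (\<Sum>i\<le>N. monom (c i x) i)"
      define q where "q = (\<Sum>i\<le>M. monom (d i x) i)"
      have sc: "c i (t *s x) = t ^ i * c i x" "d i (t *s x) = t ^ i * d i x" for i t
        using form_scale[OF c(1)[of i]] form_scale[OF d(1)[of i]] by auto
      have "poly (p * q) t = poly (monom (h x) n) t" for t
      proof -
        have "poly p t = f (t *s x)" "poly q t = g (t *s x)"
          by (simp_all add: p_def q_def c(3) d(2) poly_sum poly_monom sc mult.commute)
        then show ?thesis using fg[of "t *s x"] form_scale[OF h, of t x] by (simp add: poly_monom mult.commute)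
      qed
      then have pq: "p * q = monom (h x) n" using poly_eqI poly_eq_poly_eq_iff by blast
      have hx: "h x \<noteq> 0" using False by simp
      then have ne: "p * q \<noteq> 0" using pq by simp
      have "monom (h x) n = [:h x:] * [:0, 1:] ^ n" by (simp add: monom_altdef)
      then have "Polynomial.order 0 (p * q) = n" unfolding pq using hx order_mult[of "[:h x:]" "[:0,1:]^n" 0]
        order_power_n_n[of 0 n] order_0I[of "[:h x:]" 0] by auto
      then have o: "Polynomial.order 0 p + Polynomial.order 0 q = n" using order_mult[OF ne] by simp
      have "degree p + degree q = n" using ne degree_mult_eq[of p q] degree_monom_eq[OF hx, of n] unfolding pq[symmetric] by auto
      then have od: "Polynomial.order 0 p = degree p" using o order_degree[of p 0] order_degree[of q 0] ne by auto
      have cf: "coeff p j = c j x" for j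
        by (auto simp: p_def coeff_sum c(2))
      have "m \<le> degree p" using cf[of m] False by (intro le_degree) auto
      moreover have "degree p \<le> m" by (rule degree_le) (use cf mmax I_def in fastforce)
      ultimately have dm: "degree p = m" by simp
      have "[:0, 1:] ^ m dvd p" using order_1[of 0 p] od dm by simp
      then have "coeff p i = 0"
      proof (cases "i < m")
        case True
        from \<open>[:0, 1:] ^ m dvd p\<close> obtain r where "p = monom 1 m * r" by (auto simp: monom_altdef)
        then show ?thesis using True by (simp add: coeff_monom_mult)
      next
        case False
        then show ?thesis using that dm by (intro coeff_eq_0) auto
      qed
      then show ?thesis using cf by simp
    qed simp
    then have "(\<forall>x. c i x = 0) \<or> (\<forall>x. c m x * h x = 0)"
      by (intro polyfun_mult_eq_0 polyfun_mult) (use c(1) h form_imp_polyfun in auto)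
    moreover have "\<not> (\<forall>x. c m x * h x = 0)"
      using polyfun_mult_eq_0[of "c m" h] c(1) h form_imp_polyfun mI x0 unfolding I_def by blast
    ultimately show ?thesis by blast
  qed
  have "m \<le> N" using mI IN by blast
  then have "f x = c m x" for x using c(3)[of x] zero
    by (simp add: sum.remove[of "{..N}" m] sum.neutral)
  then have "f = c m" by blast
  then show ?thesis using c(1) by blast
qed

lemma form_degree_unique:
  fixes f :: "'k::{field,ring_char_0} ^ 'n::finite \<Rightarrow> 'k"
  assumes f: "form d f" "form e f" and x: "f x \<noteq> 0"
  shows "d = e"
proof -
  have de: "d \<ge> 0" "e \<ge> 0" using form_neg f x by (meson not_less)+
  have "poly (monom (f x) (nat d)) t = poly (monom (f x) (nat e)) t" for t
    using form_scale[OF f(1), of t x] form_scale[OF f(2), of t x] by (auto simp: poly_monom)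
  then have "monom (f x) (nat d) = monom (f x) (nat e)" using poly_eq_poly_eq_iff by blast
  then have "nat d = nat e" using x by (metis degree_monom_eq)
  then show ?thesis using de by simp
qed

section \<open>Polynomials and unique factorization\<close>

definition monom_at :: "('n::finite \<Rightarrow>\<^sub>0 nat) \<Rightarrow> 'k::field ^ 'n \<Rightarrow> 'k" where
  "monom_at m x = (\<Prod>i\<in>UNIV. (x $ i) ^ Poly_Mapping.lookup m i)"

lemma peval_superset:
  "finite A \<Longrightarrow> Poly_Mapping.keys F \<subseteq> A \<Longrightarrow> peval F x = (\<Sum>m\<in>A. Poly_Mapping.lookup F m * monom_at m x)"
  unfolding peval_def monom_at_def[symmetric]
  by (rule sum.mono_neutral_left) (auto simp: in_keys_iff)

lemma peval_add: "peval (F + G) x = peval F x + peval G x"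
proof -
  let ?A = "Poly_Mapping.keys F \<union> Poly_Mapping.keys G"
  have "peval F x = (\<Sum>m\<in>?A. Poly_Mapping.lookup F m * monom_at m x)"
    "peval G x = (\<Sum>m\<in>?A. Poly_Mapping.lookup G m * monom_at m x)"
    "peval (F + G) x = (\<Sum>m\<in>?A. Poly_Mapping.lookup (F + G) m * monom_at m x)"
    by (rule peval_superset; auto simp: Poly_Mapping.keys_add)+
  then show ?thesis by (simp add: lookup_add sum.distrib algebra_simps)
qed

lemma peval_zero: "peval 0 x = 0"
  by (simp add: peval_def)

lemma peval_single: "peval (Poly_Mapping.single m c) x = c * monom_at m x"
  by (subst peval_superset[of "{m}"]) (auto simp: keys_single split: if_splits)

lemma peval_sum: "peval (\<Sum>a\<in>A. F a) x = (\<Sum>a\<in>A. peval (F a) x)"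
  by (induction A rule: infinite_finite_induct) (auto simp: peval_zero peval_add)

lemma homogeneous_zero: "homogeneous d 0"
  by (simp add: homogeneous_def)

lemma homogeneous_add: "homogeneous d F \<Longrightarrow> homogeneous d G \<Longrightarrow> homogeneous d (F + G)"
  unfolding homogeneous_def by (auto dest!: subsetD[OF Poly_Mapping.keys_add])

lemma homogeneous_sum: "(\<And>a. a \<in> A \<Longrightarrow> homogeneous d (F a)) \<Longrightarrow> homogeneous d (\<Sum>a\<in>A. F a)"
  by (induction A rule: infinite_finite_induct) (auto simp: homogeneous_zero homogeneous_add)

lemma homogeneous_single:
  "(\<Sum>i\<in>UNIV. Poly_Mapping.lookup m i) = d \<Longrightarrow> homogeneous d (Poly_Mapping.single m c)"
  by (auto simp: homogeneous_def keys_single split: if_splits)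

lemma form_peval:
  assumes "homogeneous d F" shows "form (int d) (peval F)"
proof -
  have "form (int d) (monom_at m)" if "m \<in> Poly_Mapping.keys F" for m
  proof -
    have "form (\<Sum>i\<in>UNIV. int (Poly_Mapping.lookup m i) * 1) (\<lambda>x. \<Prod>i\<in>UNIV. (x $ i) ^ Poly_Mapping.lookup m i)"
      by (intro form_prod form_power form_proj) auto
    moreover have "(\<Sum>i\<in>UNIV. int (Poly_Mapping.lookup m i) * 1) = int d"
      using assms that unfolding homogeneous_def by (metis (no_types, lifting) int_sum mult.right_neutral sum.cong)
    ultimately show ?thesis unfolding monom_at_def by simp
  qed
  then have "form (int d) (\<lambda>x. \<Sum>m\<in>Poly_Mapping.keys F. Poly_Mapping.lookup F m * monom_at m x)"
    by (intro form_sum form_cmult)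
  then show ?thesis by (rule form_cong) (auto simp: peval_def monom_at_def)
qed

text \<open>The way back to \<open>mpoly\<close>: regular maps and the Zariski topology are defined
  with \<open>mpoly\<close>, while the constructions are made with functions.\<close>

lemma form_imp_peval:
  "form d f \<Longrightarrow> d \<ge> 0 \<Longrightarrow> \<exists>F. homogeneous (nat d) F \<and> peval F = f"
proof (induction rule: form.induct)
  case (form_zero d) then show ?case using homogeneous_zero peval_zero by (metis ext)
next
  case (form_const c)
  have "homogeneous 0 (Poly_Mapping.single 0 c :: ('b, 'a) mpoly)"
    "peval (Poly_Mapping.single 0 c) = (\<lambda>x :: 'a ^ 'b. c)"
    by (auto simp: homogeneous_single peval_single monom_at_def fun_eq_iff)
  then show ?case by auto
next
  case (form_coord d f i)
  show ?case
  proof (cases "d < 0")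
    case True
    then have "(\<lambda>x. x $ i * f x) = (\<lambda>x. 0)" using form_neg[OF form_coord.hyps] by auto
    then show ?thesis using homogeneous_zero peval_zero by (metis ext)
  next
    case False
    then obtain F where F: "homogeneous (nat d) F" "peval F = f" using form_coord.IH by auto
    let ?e = "Poly_Mapping.single i 1 :: 'b \<Rightarrow>\<^sub>0 nat"
    define G where "G = (\<Sum>m\<in>Poly_Mapping.keys F. Poly_Mapping.single (m + ?e) (Poly_Mapping.lookup F m))"
    have "homogeneous (nat (d + 1)) G" unfolding G_def
    proof (intro homogeneous_sum homogeneous_single)
      fix m assume "m \<in> Poly_Mapping.keys F"
      then have "(\<Sum>i\<in>UNIV. Poly_Mapping.lookup m i) = nat d" using F(1) by (simp add: homogeneous_def)
      then show "(\<Sum>j\<in>UNIV. Poly_Mapping.lookup (m + ?e) j) = nat (d + 1)"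
        using False by (simp add: lookup_add sum.distrib lookup_single when_def nat_add_distrib)
    qed
    moreover have "peval G x = x $ i * f x" for x
    proof -
      have *: "monom_at (m + ?e) x = x $ i * monom_at m x" for m
      proof -
        have "(\<Prod>j\<in>UNIV. (x $ j) ^ Poly_Mapping.lookup ?e j) = (\<Prod>j\<in>UNIV. if j = i then x $ i else 1)"
          by (rule prod.cong) (auto simp: lookup_single when_def)
        then have "(\<Prod>j\<in>UNIV. (x $ j) ^ Poly_Mapping.lookup ?e j) = x $ i" by simp
        then show ?thesis by (simp add: monom_at_def lookup_add power_add prod.distrib)
      qed
      have "peval G x = (\<Sum>m\<in>Poly_Mapping.keys F. Poly_Mapping.lookup F m * (x $ i * monom_at m x))"
        unfolding G_def peval_sum peval_single * ..
      also have "\<dots> = x $ i * peval F x"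
        by (simp add: peval_def monom_at_def[symmetric] sum_distrib_left algebra_simps)
      finally show ?thesis using F(2) by simp
    qed
    ultimately show ?thesis by (metis ext)
  qed
next
  case (form_add d f g)
  then show ?case by (metis (mono_tags, lifting) ext homogeneous_add peval_add)
qed

lemma peval_partial:
  "peval (partial i F) v = (\<Sum>m\<in>Poly_Mapping.keys F. Poly_Mapping.lookup F m *
     (of_nat (Poly_Mapping.lookup m i) * (v $ i) ^ (Poly_Mapping.lookup m i - 1) *
      (\<Prod>j\<in>UNIV - {i}. (v $ j) ^ Poly_Mapping.lookup m j)))"
proof -
  have "monom_at (m - Poly_Mapping.single i 1) v =
     (v $ i) ^ (Poly_Mapping.lookup m i - 1) * (\<Prod>j\<in>UNIV - {i}. (v $ j) ^ Poly_Mapping.lookup m j)" for m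
    unfolding monom_at_def
    by (subst prod.remove[of UNIV i]) (auto simp: lookup_minus lookup_single when_def intro!: prod.cong)
  then show ?thesis unfolding partial_def peval_sum peval_single by (simp add: algebra_simps)
qed

text \<open>The linear coefficient along a line is the directional derivative. Formal partial
  derivatives can therefore be read off by expanding a trilinear form, without handling
  monomials.\<close>

lemma peval_line:
  "\<exists>p. (\<forall>t. peval F (v + t *s w) = poly p t) \<and> coeff p 1 = (\<Sum>i\<in>UNIV. w $ i * peval (partial i F) v)"
proof -
  define l where "l m i = [:v $ i, w $ i:] ^ Poly_Mapping.lookup m i" for m i
  define p where "p = (\<Sum>m\<in>Poly_Mapping.keys F. smult (Poly_Mapping.lookup F m) (\<Prod>i\<in>UNIV. l m i))"
  have "peval F (v + t *s w) = poly p t" for t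
    unfolding p_def peval_def by (simp add: poly_sum poly_prod l_def algebra_simps)
  moreover have "coeff p 1 = (\<Sum>i\<in>UNIV. w $ i * peval (partial i F) v)"
  proof -
    have pd: "poly (pderiv (l m i)) 0 = of_nat (Poly_Mapping.lookup m i) * (v $ i) ^ (Poly_Mapping.lookup m i - 1) * w $ i" for m i
      by (simp add: l_def pderiv_power pderiv_pCons)
    have pl: "poly (l m i) 0 = (v $ i) ^ Poly_Mapping.lookup m i" for m i by (simp add: l_def)
    have "coeff p 1 = poly (pderiv p) 0" by (simp add: poly_0_coeff_0 coeff_pderiv)
    also have "\<dots> = (\<Sum>m\<in>Poly_Mapping.keys F. Poly_Mapping.lookup F m *
        (\<Sum>i\<in>UNIV. (\<Prod>j\<in>UNIV - {i}. (v $ j) ^ Poly_Mapping.lookup m j) *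
        (of_nat (Poly_Mapping.lookup m i) * (v $ i) ^ (Poly_Mapping.lookup m i - 1) * w $ i)))"
      by (simp add: p_def pderiv_sum pderiv_smult pderiv_prod poly_sum poly_prod pd pl)
    also have "\<dots> = (\<Sum>i\<in>UNIV. w $ i * peval (partial i F) v)"
      unfolding peval_partial sum_distrib_left by (subst sum.swap) (simp add: algebra_simps)
    finally show ?thesis .
  qed
  ultimately show ?thesis by blast
qed

section \<open>Greatest common divisors in unique factorization domains\<close>

lemma ufd_prime:
  fixes p :: "'a::ufd"
  assumes p: "irreducible p" and dvd: "p dvd a * b" shows "p dvd a \<or> p dvd b"
proof (cases "a = 0 \<or> b = 0 \<or> a dvd 1 \<or> b dvd 1")
  case True
  then show ?thesis using dvd by (metis dvd_0_right dvd_mult_unit_iff dvd_mult_unit_iff')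
next
  case False
  then obtain A B where AB: "mset_factors A a" "mset_factors B b" using mset_factors_exist by metis
  from irreducible_dvd_imp_factor[OF dvd p mset_factors_mult[OF this]]
  obtain g where g: "g \<in># A + B" "p ddvd g" by blast
  then show ?thesis using AB mset_factors_imp_dvd by (meson dvd_trans union_iff)
qed

lemma ufd_factors:
  fixes x :: "'a::ufd"
  assumes "x \<noteq> 0"
  shows "\<exists>A u. u dvd 1 \<and> (\<forall>p\<in>#A. irreducible p) \<and> x = u * prod_mset A"
proof (cases "x dvd 1")
  case True then show ?thesis by (intro exI[of _ "{#}"] exI[of _ x]) auto
next
  case False
  from mset_factors_exist[OF assms False] obtain A where "mset_factors A x" by blast
  then show ?thesis by (intro exI[of _ A] exI[of _ 1]) (auto simp: mset_factors_def)
qed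

text \<open>Every prime factor of \<open>d\<close> fails to divide some \<open>\<gamma> j\<close>,
  so it divides \<open>h\<close>; the primes of \<open>d\<close> are split off from \<open>h\<close>
  one at a time.\<close>

lemma ufd_dvd_of_primitive:
  fixes \<gamma> :: "'b \<Rightarrow> 'a::ufd"
  assumes prim: "\<And>p. irreducible p \<Longrightarrow> \<exists>j. \<not> p dvd \<gamma> j"
    and "d \<noteq> 0" and dvd: "\<And>j. d dvd h * \<gamma> j"
  shows "d dvd h"
proof -
  obtain A u where A: "u dvd 1" "\<forall>p\<in>#A. irreducible p" "d = u * prod_mset A"
    using ufd_factors[OF \<open>d \<noteq> 0\<close>] by blast
  have main: "prod_mset A dvd h" if "\<forall>p\<in>#A. irreducible p" "\<forall>j. prod_mset A dvd h * \<gamma> j" for A h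
    using that
  proof (induction A arbitrary: h)
    case empty then show ?case by simp
  next
    case (add p A)
    have p: "irreducible p" using add.prems(1) by simp
    obtain j where j: "\<not> p dvd \<gamma> j" using prim[OF p] by blast
    have "p * prod_mset A dvd h * \<gamma> j" using add.prems(2) unfolding prod_mset.add_mset by blast
    then have "p dvd h * \<gamma> j" by (rule dvd_mult_left)
    from ufd_prime[OF p this] j have "p dvd h" by blast
    then obtain h' where h': "h = p * h'" unfolding dvd_def by blast
    have "p \<noteq> 0" using p by (simp add: irreducible_def)
    have "prod_mset A dvd h' * \<gamma> i" for i
    proof -
      have "p * prod_mset A dvd p * (h' * \<gamma> i)"
        using add.prems(2) unfolding h' by (simp only: prod_mset.add_mset mult.assoc)
      then show ?thesis using \<open>p \<noteq> 0\<close> by (simp add: dvd_def mult.assoc)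
    qed
    then have "prod_mset A dvd h'" using add.IH add.prems(1) by (metis union_iff add_mset_add_single)
    then show ?case unfolding h' prod_mset.add_mset by (rule mult_dvd_mono[OF dvd_refl])
  qed
  have "\<forall>j. prod_mset A dvd h * \<gamma> j" using dvd unfolding A(3) by (blast intro: dvd_mult_right)
  from main[OF A(2) this] show ?thesis unfolding A(3) using mult_unit_dvd_iff'[OF A(1)] by blast
qed

text \<open>Division by the greatest common divisor. The induction counts the prime factors of the
  single nonzero member \<open>g j0\<close>, so the family may be infinite.\<close>

lemma ufd_primitive_part:
  fixes g :: "'b \<Rightarrow> 'a::ufd"
  assumes "g j0 \<noteq> 0"
  shows "\<exists>D \<gamma>. (\<forall>j. g j = D * \<gamma> j) \<and> (\<forall>p. irreducible p \<longrightarrow> (\<exists>j. \<not> p dvd \<gamma> j))"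
proof -
  obtain A u where "u dvd 1" "\<forall>p\<in>#A. irreducible p" "g j0 = u * prod_mset A"
    using ufd_factors[OF assms] by blast
  then show ?thesis
  proof (induction "size A" arbitrary: A u g)
    case 0
    then have "g j0 dvd 1" by simp
    then have "\<not> p dvd g j0" if "irreducible p" for p using that by (meson dvd_trans irreducible_not_unit)
    then show ?case by (intro exI[of _ 1] exI[of _ g]) auto
  next
    case (Suc n)
    show ?case
    proof (cases "\<exists>p. irreducible p \<and> (\<forall>j. p dvd g j)")
      case False
      then show ?thesis by (intro exI[of _ 1] exI[of _ g]) auto
    next
      case True
      then obtain p where p: "irreducible p" "\<And>j. p dvd g j" by blast
      then obtain g' where g': "\<And>j. g j = p * g' j" unfolding dvd_def by metis
      have p0: "p \<noteq> 0" "\<not> p dvd 1" using p by auto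
      have "p dvd prod_mset A" using p(2)[of j0] Suc.prems by (simp add: dvd_mult_unit_iff')
      moreover have "\<exists>f\<in>#A. p dvd f" if "p dvd prod_mset A" for A
        using that by (induction A) (use p0 ufd_prime[OF p(1)] in auto)
      ultimately obtain f where f: "f \<in># A" "p dvd f" by blast
      then obtain w where w: "f = p * w" unfolding dvd_def by blast
      have "w dvd 1" using Suc.prems(2) f(1) p0 w irreducibleD by blast
      obtain B where B: "A = add_mset f B" using f(1) by (metis insert_DiffM)
      have "p * g' j0 = p * (u * w * prod_mset B)"
        using Suc.prems(3) g' B w by (simp add: algebra_simps)
      then have "g' j0 = u * w * prod_mset B" using p0 by simp
      moreover have "u * w dvd 1" using \<open>w dvd 1\<close> Suc.prems(1) by (metis mult_dvd_mono mult_1)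
      ultimately obtain D \<gamma> where D: "\<forall>j. g' j = D * \<gamma> j" "\<forall>p. irreducible p \<longrightarrow> (\<exists>j. \<not> p dvd \<gamma> j)"
        using Suc.hyps(1)[of B "u * w" g'] Suc.hyps(2) Suc.prems(2) B by auto
      then show ?thesis by (intro exI[of _ "p * D"] exI[of _ \<gamma>]) (auto simp: g' mult.assoc)
    qed
  qed
qed

text \<open>Iterated univariate polynomials are used because unique factorization passes from a ring
  to \<open>poly\<close> over it. The outermost variable is \<open>x $ 4\<close>, the innermost is
  \<open>x $ 1\<close>.\<close>

definition nested_eval :: "'k::field poly poly poly poly \<Rightarrow> 'k ^ 4 \<Rightarrow> 'k" where
  "nested_eval p x = poly (poly (poly (poly p [:[:[:x $ 4:]:]:]) [:[:x $ 3:]:]) [:x $ 2:]) (x $ 1)"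

lemma nested_eval_mult: "nested_eval (p * q) x = nested_eval p x * nested_eval q x"
  by (simp add: nested_eval_def)

lemma nested_eval_diff: "nested_eval (p - q) x = nested_eval p x - nested_eval q x"
  by (simp add: nested_eval_def)

lemma polyfun_nested_eval: "polyfun (nested_eval p)"
proof -
  have 1: "polyfun (\<lambda>x :: 'a ^ 4. poly p (x $ 1))" for p
    by (induction p) (auto intro: polyfun_const polyfun_add polyfun_coord)
  have 2: "polyfun (\<lambda>x :: 'a ^ 4. poly (poly p [:x $ 2:]) (x $ 1))" for p
    by (induction p) (auto intro: polyfun_const polyfun_add polyfun_coord 1)
  have 3: "polyfun (\<lambda>x :: 'a ^ 4. poly (poly (poly p [:[:x $ 3:]:]) [:x $ 2:]) (x $ 1))" for p
    by (induction p) (auto intro: polyfun_const polyfun_add polyfun_coord 2)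
  have "polyfun (\<lambda>x :: 'a ^ 4. poly (poly (poly (poly p [:[:[:x $ 4:]:]:]) [:[:x $ 3:]:]) [:x $ 2:]) (x $ 1))" for p
    by (induction p) (auto intro: polyfun_const polyfun_add polyfun_coord 3)
  then show ?thesis by (rule polyfun_cong) (simp add: nested_eval_def)
qed

lemma polyfun_imp_nested_eval: "polyfun f \<Longrightarrow> \<exists>p. f = nested_eval p"
proof (induction rule: polyfun.induct)
  case (polyfun_const c)
  show ?case by (rule exI[of _ "[:[:[:[:c:]:]:]:]"]) (simp add: nested_eval_def)
next
  case (polyfun_coord f i)
  then obtain p where p: "f = nested_eval p" by blast
  consider "i = 1" | "i = 2" | "i = 3" | "i = 4" using exhaust_4 by blast
  then have "\<exists>q. \<forall>x :: 'a ^ 4. nested_eval q x = x $ i"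
  proof cases
    case 1 then show ?thesis by (intro exI[of _ "[:[:[:[:0,1:]:]:]:]"]) (simp add: nested_eval_def)
  next
    case 2 then show ?thesis by (intro exI[of _ "[:[:[:0,1:]:]:]"]) (simp add: nested_eval_def)
  next
    case 3 then show ?thesis by (intro exI[of _ "[:[:0,1:]:]"]) (simp add: nested_eval_def)
  next
    case 4 then show ?thesis by (intro exI[of _ "[:0,1:]"]) (simp add: nested_eval_def)
  qed
  then obtain q where "\<And>x :: 'a ^ 4. nested_eval q x = x $ i" by blast
  then show ?case using p by (intro exI[of _ "q * p"]) (auto simp: nested_eval_mult)
next
  case (polyfun_add f g)
  then obtain p q where "f = nested_eval p" "g = nested_eval q" by blast
  then show ?case by (intro exI[of _ "p + q"]) (auto simp: nested_eval_def)
qed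

text \<open>\<open>\<phi>\<close> embeds the constants at the respective level of nesting;
  infinitely many zeros kill a polynomial over a domain.\<close>

lemma poly_zero_of_infinite:
  fixes p :: "'a::idom poly" and \<phi> :: "'k::{field,ring_char_0} \<Rightarrow> 'a"
  assumes "inj \<phi>" "\<And>c. poly p (\<phi> c) = 0"
  shows "p = 0"
proof (rule ccontr)
  assume "p \<noteq> 0"
  then have "finite {x. poly p x = 0}" by (rule poly_roots_finite)
  then have "finite (range \<phi>)" by (rule finite_subset[rotated]) (use assms in auto)
  then show False using assms(1) infinite_UNIV_char_0 finite_imageD by blast
qed

lemma nested_eval_eq_0:
  fixes p :: "'k::{field,ring_char_0} poly poly poly poly"
  assumes "\<And>x. nested_eval p x = 0"
  shows "p = 0"
proof -
  have *: "poly (poly (poly (poly p [:[:[:d:]:]:]) [:[:c:]:]) [:b:]) a = 0" for a b c d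
    using assms[of "\<chi> i. if i = 1 then a else if i = 2 then b else if i = 3 then c else d"]
    by (simp add: nested_eval_def)
  have 1: "poly (poly (poly p [:[:[:d:]:]:]) [:[:c:]:]) [:b:] = 0" for b c d
    by (rule poly_zero_of_infinite[of "\<lambda>x. x"]) (use * in \<open>auto simp: inj_def\<close>)
  have 2: "poly (poly p [:[:[:d:]:]:]) [:[:c:]:] = 0" for c d
    by (rule poly_zero_of_infinite[of "\<lambda>x. [:x:]"]) (use 1 in \<open>auto simp: inj_def\<close>)
  have 3: "poly p [:[:[:d:]:]:] = 0" for d
    by (rule poly_zero_of_infinite[of "\<lambda>x. [:[:x:]:]"]) (use 2 in \<open>auto simp: inj_def\<close>)
  show ?thesis
    by (rule poly_zero_of_infinite[of "\<lambda>x. [:[:[:x:]:]:]"]) (use 3 in \<open>auto simp: inj_def\<close>)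
qed

text \<open>The last clause is the universal property of a primitive tuple: a proportional tuple is
  a polynomial multiple of it. In this form the nested polynomials do not appear again.\<close>

lemma polyfun_primitive_part:
  fixes g :: "'b \<Rightarrow> 'k::{field,ring_char_0} ^ 4 \<Rightarrow> 'k"
  assumes g: "\<And>j. polyfun (g j)" and g0: "g j0 x0 \<noteq> 0"
  shows "\<exists>D \<gamma>. polyfun D \<and> (\<forall>j. polyfun (\<gamma> j)) \<and> (\<forall>j x. g j x = D x * \<gamma> j x) \<and>
    (\<forall>h. (\<forall>j. polyfun (h j)) \<longrightarrow> (\<forall>i j x. h i x * \<gamma> j x = h j x * \<gamma> i x) \<longrightarrow>
       (\<exists>E. polyfun E \<and> (\<forall>j x. h j x = E x * \<gamma> j x)))"
proof -
  have "\<forall>j. \<exists>p. g j = nested_eval p" using polyfun_imp_nested_eval[OF g] by blast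
  then obtain G where G: "\<And>j. g j = nested_eval (G j)" by metis
  have "G j0 \<noteq> 0" using g0 G by (auto simp: nested_eval_def)
  from ufd_primitive_part[of G, OF this] obtain D \<gamma> where D: "\<And>j. G j = D * \<gamma> j"
    and prim: "\<And>p. irreducible p \<Longrightarrow> \<exists>j. \<not> p dvd \<gamma> j" by blast
  have \<gamma>0: "\<gamma> j0 \<noteq> 0" using \<open>G j0 \<noteq> 0\<close> D by auto
  have "\<exists>E. polyfun E \<and> (\<forall>j x. h j x = E x * nested_eval (\<gamma> j) x)"
    if h: "\<forall>j. polyfun (h j)" "\<forall>i j x. h i x * nested_eval (\<gamma> j) x = h j x * nested_eval (\<gamma> i) x" for h
  proof -
    have "\<forall>j. \<exists>p. h j = nested_eval p" using polyfun_imp_nested_eval h(1) by blast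
    then obtain H where H: "\<And>j. h j = nested_eval (H j)" by metis
    have eq: "H i * \<gamma> j = H j * \<gamma> i" for i j
    proof -
      have "nested_eval (H i * \<gamma> j - H j * \<gamma> i) x = 0" for x
        using h(2)[rule_format, of i x j] by (simp add: H nested_eval_diff nested_eval_mult)
      then have "H i * \<gamma> j - H j * \<gamma> i = 0" by (rule nested_eval_eq_0)
      then show ?thesis by simp
    qed
    have "\<gamma> j0 dvd H j0 * \<gamma> j" for j unfolding eq[of j0 j] by simp
    from ufd_dvd_of_primitive[OF prim \<gamma>0 this] obtain E where E: "H j0 = \<gamma> j0 * E" unfolding dvd_def by blast
    have "H j = E * \<gamma> j" for j
    proof -
      have "H j * \<gamma> j0 = (E * \<gamma> j) * \<gamma> j0" using eq[of j j0] E by (simp add: algebra_simps)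
      then show ?thesis using \<gamma>0 by simp
    qed
    then show ?thesis by (intro exI[of _ "nested_eval E"]) (auto simp: H polyfun_nested_eval nested_eval_mult)
  qed
  then show ?thesis
    by (intro exI[of _ "nested_eval D"] exI[of _ "\<lambda>j. nested_eval (\<gamma> j)"])
       (auto simp: polyfun_nested_eval G D nested_eval_mult)
qed

section \<open>Coordinates\<close>

lemma exhaust_5:
  fixes x :: 5
  shows "x = 1 \<or> x = 2 \<or> x = 3 \<or> x = 4 \<or> x = 5"
proof (induct x)
  case (of_int z)
  then have "z = 0 \<or> z = 1 \<or> z = 2 \<or> z = 3 \<or> z = 4" by auto
  then show ?case by auto
qed

lemma forall_5: "(\<forall>i::5. P i) \<longleftrightarrow> P 1 \<and> P 2 \<and> P 3 \<and> P 4 \<and> P 5"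
  by (metis exhaust_5)

lemma UNIV_5: "UNIV = {1, 2, 3, 4, 5::5}"
  using exhaust_5 by auto

lemma distinct_5: "(1::5) \<noteq> 2" "(1::5) \<noteq> 3" "(1::5) \<noteq> 4" "(1::5) \<noteq> 5" "(2::5) \<noteq> 3" "(2::5) \<noteq> 4"
  "(2::5) \<noteq> 5" "(3::5) \<noteq> 4" "(3::5) \<noteq> 5" "(4::5) \<noteq> 5"
  by simp_all

lemma sum_5: "sum f (UNIV::5 set) = f 1 + f 2 + f 3 + f 4 + f 5"
  unfolding UNIV_5 by (simp add: ac_simps)

lemma vec_eq_4: "x = (y :: 'a ^ 4) \<longleftrightarrow> x $ 1 = y $ 1 \<and> x $ 2 = y $ 2 \<and> x $ 3 = y $ 3 \<and> x $ 4 = y $ 4"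
  by (simp add: Finite_Cartesian_Product.vec_eq_iff forall_4)

lemma vec_eq_5: "x = (y :: 'a ^ 5) \<longleftrightarrow>
    x $ 1 = y $ 1 \<and> x $ 2 = y $ 2 \<and> x $ 3 = y $ 3 \<and> x $ 4 = y $ 4 \<and> x $ 5 = y $ 5"
  by (simp add: Finite_Cartesian_Product.vec_eq_iff forall_5)

definition mk4 :: "'a \<Rightarrow> 'a \<Rightarrow> 'a \<Rightarrow> 'a \<Rightarrow> 'a ^ 4" where
  "mk4 a b c d = (\<chi> i. if i = 1 then a else if i = 2 then b else if i = 3 then c else d)"

definition mk5 :: "'a \<Rightarrow> 'a \<Rightarrow> 'a \<Rightarrow> 'a \<Rightarrow> 'a \<Rightarrow> 'a ^ 5" where
  "mk5 a b c d e = (\<chi> i. if i = 1 then a else if i = 2 then b else if i = 3 then c else if i = 4 then d else e)"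

lemma mk4_nth [simp]: "mk4 a b c d $ 1 = a" "mk4 a b c d $ 2 = b" "mk4 a b c d $ 3 = c" "mk4 a b c d $ 4 = d"
  by (simp_all add: mk4_def)

lemma mk5_nth [simp]: "mk5 a b c d e $ 1 = a" "mk5 a b c d e $ 2 = b" "mk5 a b c d e $ 3 = c"
   "mk5 a b c d e $ 4 = d" "mk5 a b c d e $ 5 = e"
  by (simp_all add: mk5_def)

lemma form_mk4:
  assumes "form d f1" "form d f2" "form d f3" "form d f4"
  shows "form d (\<lambda>x. mk4 (f1 x) (f2 x) (f3 x) (f4 x) $ i)"
  using exhaust_4[of i] assms by (elim disjE) simp_all

lemma form_mk5:
  assumes "form d f1" "form d f2" "form d f3" "form d f4" "form d f5"
  shows "form d (\<lambda>x. mk5 (f1 x) (f2 x) (f3 x) (f4 x) (f5 x) $ i)"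
  using exhaust_5[of i] assms by (elim disjE) simp_all

text \<open>Projection from the coordinate point \<open>axis 5 1\<close>, which will be the node
  that is singled out.\<close>

definition pr4 :: "'a ^ 5 \<Rightarrow> 'a ^ 4" where
  "pr4 x = mk4 (x $ 1) (x $ 2) (x $ 3) (x $ 4)"

definition vec5 :: "'a ^ 4 \<Rightarrow> 'a \<Rightarrow> 'a ^ 5" where
  "vec5 x s = mk5 (x $ 1) (x $ 2) (x $ 3) (x $ 4) s"

lemma pr4_vec5 [simp]: "pr4 (vec5 x s) = x" by (simp add: pr4_def vec5_def vec_eq_4)
lemma vec5_nth [simp]: "vec5 x s $ 1 = x $ 1" "vec5 x s $ 2 = x $ 2" "vec5 x s $ 3 = x $ 3"
  "vec5 x s $ 4 = x $ 4" "vec5 x s $ 5 = s" by (simp_all add: vec5_def)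
lemma pr4_nth [simp]: "pr4 x $ 1 = x $ 1" "pr4 x $ 2 = x $ 2" "pr4 x $ 3 = x $ 3" "pr4 x $ 4 = x $ 4"
  by (simp_all add: pr4_def)
lemma zero_at_5: "zero_at 5 x = vec5 (pr4 x) 0"
  by (simp add: vec_eq_5)

lemma form_pr4: "form 1 (\<lambda>x. pr4 x $ i)"
  unfolding pr4_def by (intro form_mk4 form_proj)

lemma form_vec5: "(\<And>i. form d (\<lambda>x. f x $ i)) \<Longrightarrow> form d g \<Longrightarrow> form d (\<lambda>x. vec5 (f x) (g x) $ i)"
  unfolding vec5_def by (intro form_mk5) auto

lemma form_comp_pr4: "form d f \<Longrightarrow> form d (\<lambda>x. f (pr4 x))"
  by (erule form_comp1) (rule form_pr4)

lemma polyfun_cancel: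
  fixes f g h :: "'k::{field,ring_char_0} ^ 'n::finite \<Rightarrow> 'k"
  assumes "polyfun h" "polyfun f" "polyfun g" "\<And>x. h x * f x = h x * g x" "h x0 \<noteq> 0"
  shows "f x = g x"
proof -
  have "(\<forall>x. h x = 0) \<or> (\<forall>x. f x - g x = 0)"
    by (rule polyfun_mult_eq_0) (use assms in \<open>auto intro: polyfun_diff simp: algebra_simps\<close>)
  then show ?thesis using assms(5) by auto
qed

lemma form_dvd_proj:
  fixes f :: "'k::field ^ 'n::finite \<Rightarrow> 'k"
  assumes "form d f" "\<And>x. f (zero_at i x) = 0"
  shows "\<exists>g. form (d - 1) g \<and> (\<forall>x. f x = x $ i * g x)"
  using form_expand[OF assms(1), of i] assms(2) by auto

text \<open>On the hyperplane \<open>x\<^sub>i = 0\<close> the two forms become a ternary quadric not divisible by any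
  coordinate and the product of the three remaining coordinates.\<close>

lemma syzygy_step:
  fixes q c A B :: "'k::{field,ring_char_0} ^ 'n::finite \<Rightarrow> 'k"
  assumes q: "form 2 q" "\<And>x. q (zero_at i x) = \<alpha> * x $ j * x $ k + \<beta> * x $ j * x $ l + \<gamma> * x $ k * x $ l"
    and c: "form 3 c" "\<And>x. c (zero_at i x) = x $ j * x $ k * x $ l"
    and d: "distinct [i, j, k, l]" and nz: "\<alpha> \<noteq> 0" "\<beta> \<noteq> 0" "\<gamma> \<noteq> 0"
    and A: "form n A" and B: "form (n - 1) B"
    and eq: "\<And>x. q (zero_at i x) * A (zero_at i x) = c (zero_at i x) * B (zero_at i x)"
  shows "\<exists>A' A'' B''. form (n - 3) A' \<and> form (n - 1) A'' \<and> form (n - 2) B'' \<and>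
    (\<forall>x. A x = c x * A' x + x $ i * A'' x) \<and> (\<forall>x. B x = q x * A' x + x $ i * B'' x)"
proof -
  note pf = form_imp_polyfun
  define A0 where "A0 x = A (zero_at i x)" for x
  have A0: "form n A0" unfolding A0_def by (rule form_comp_zero_at[OF A])
  have q': "q (zero_at i x) = \<alpha> * x $ j * x $ k + \<beta> * x $ j * x $ l + \<gamma> * x $ k * x $ l" for x by (rule q(2))
  have swap: "zero_at i (zero_at m x) = zero_at m (zero_at i x)" for m and x :: "'k ^ 'n"
    by (simp add: Finite_Cartesian_Product.vec_eq_iff)
  have key: "(\<alpha> * x $ j * x $ k + \<beta> * x $ j * x $ l + \<gamma> * x $ k * x $ l) * A0 x =
     x $ j * x $ k * x $ l * B (zero_at i x)" for x
    using eq[of x] unfolding q' c(2) A0_def by simp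
  \<comment> \<open>If one of the three remaining coordinates is zero as well, the right side of
    \<open>key\<close> vanishes while the quadric reduces to a single monomial with coefficient
    \<open>\<delta>\<close>, so \<open>A0\<close> must vanish.\<close>
  have vanish: "A0 (zero_at m x) = 0" if m: "(m, r, s, \<delta>) \<in> {(j, k, l, \<gamma>), (k, j, l, \<beta>), (l, j, k, \<alpha>)}" for m r s \<delta> x
  proof -
    have pA: "polyfun (\<lambda>x. A0 (zero_at m x))" by (rule pf[OF form_comp_zero_at[OF A0]])
    have "polyfun (\<lambda>x. \<delta> * (x $ r * x $ s))" by (intro polyfun_cmult polyfun_mult polyfun_proj)
    moreover note pA
    moreover have "\<delta> * (x $ r * x $ s) * A0 (zero_at m x) = 0" for x
      using key[of "zero_at m x"] d m by auto
    ultimately have "(\<forall>x :: 'k ^ 'n. \<delta> * (x $ r * x $ s) = 0) \<or> (\<forall>x. A0 (zero_at m x) = 0)"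
      by (rule polyfun_mult_eq_0)
    moreover have "\<delta> * (((\<chi> _. 1) :: 'k ^ 'n) $ r * ((\<chi> _. 1) :: 'k ^ 'n) $ s) \<noteq> 0" using m nz by auto
    ultimately show ?thesis by blast
  qed
  obtain A1 where A1: "form (n - 1) A1" "\<And>x. A0 x = x $ j * A1 x"
    using form_dvd_proj[OF A0, of j] vanish[of j k l \<gamma>] by auto
  have "A1 (zero_at k x) = 0" for x
    by (rule polyfun_cancel[of "\<lambda>x. x $ j" "\<lambda>x. A1 (zero_at k x)" "\<lambda>x. 0" "\<chi> _. 1"])
       (use A1(2)[of "zero_at k _"] vanish[of k j l \<beta>] d in
        \<open>auto intro: polyfun_proj polyfun_const pf[OF form_comp_zero_at[OF A1(1)]]\<close>)
  then obtain A2 where A2: "form (n - 2) A2" "\<And>x. A1 x = x $ k * A2 x"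
    using form_dvd_proj[OF A1(1), of k] by auto
  have "A2 (zero_at l x) = 0" for x
    by (rule polyfun_cancel[of "\<lambda>x. x $ j * x $ k" "\<lambda>x. A2 (zero_at l x)" "\<lambda>x. 0" "\<chi> _. 1"])
       (use A1(2)[of "zero_at l _"] A2(2)[of "zero_at l _"] vanish[of l j k \<alpha>] d in
        \<open>auto intro: polyfun_proj polyfun_mult polyfun_const pf[OF form_comp_zero_at[OF A2(1)]]\<close>)
  then obtain A' where A': "form (n - 3) A'" "\<And>x. A2 x = x $ l * A' x"
    using form_dvd_proj[OF A2(1), of l] by auto
  have A0': "A0 x = x $ j * x $ k * x $ l * A' x" for x by (simp add: A1(2) A2(2) A'(2))
  have B0: "B (zero_at i x) = (\<alpha> * x $ j * x $ k + \<beta> * x $ j * x $ l + \<gamma> * x $ k * x $ l) * A' x" for x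
    by (rule polyfun_cancel[of "\<lambda>x. x $ j * x $ k * x $ l" "\<lambda>x. B (zero_at i x)"
       "\<lambda>x. (\<alpha> * x $ j * x $ k + \<beta> * x $ j * x $ l + \<gamma> * x $ k * x $ l) * A' x" "\<chi> _. 1"])
      (use key A0' in \<open>auto intro!: polyfun_mult polyfun_proj polyfun_add polyfun_const
          pf[OF form_comp_zero_at[OF B]] pf[OF A'(1)] simp: algebra_simps\<close>)
  have zz: "zero_at i (zero_at i x) = zero_at i x" for x :: "'k ^ 'n" by (simp add: Finite_Cartesian_Product.vec_eq_iff)
  have cA: "form n (\<lambda>x. c x * A' x)" using form_mult[OF c(1) A'(1)] by simp
  have qA: "form (n - 1) (\<lambda>x. q x * A' x)" using form_mult[OF q(1) A'(1)] by simp
  \<comment> \<open>On the hyperplane \<open>A\<close> and \<open>B\<close> are now \<open>c\<close>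
    and \<open>q\<close> times \<open>A'\<close>; the differences vanish there and are divisible by
    \<open>x $ i\<close>.\<close>
  have v1: "A (zero_at i x) - c (zero_at i x) * A' (zero_at i x) = 0" for x
    using A0'[of "zero_at i x"] c(2)[of "zero_at i x"] by (simp add: A0_def zz)
  obtain A'' where A'': "form (n - 1) A''" "\<And>x. A x - c x * A' x = x $ i * A'' x"
    using form_dvd_proj[OF form_diff[OF A cA], of i] v1 by blast
  have v2: "B (zero_at i x) - q (zero_at i x) * A' (zero_at i x) = 0" for x
    using B0[of "zero_at i x"] q(2)[of "zero_at i x"] by (simp add: zz)
  obtain B'' where B'': "form (n - 1 - 1) B''" "\<And>x. B x - q x * A' x = x $ i * B'' x"
    using form_dvd_proj[OF form_diff[OF B qA], of i] v2 by blast
  have "form (n - 2) B''" using B''(1) by (simp add: algebra_simps)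
  then show ?thesis using A' A'' B''(2)
    by (intro exI[of _ A'] exI[of _ A''] exI[of _ B'']) (auto simp: algebra_simps)
qed

section \<open>Cubics with a node at a coordinate point\<close>

locale nodal_cubic =
  fixes b12 b13 b14 b23 b24 b34 :: "'k::{alg_closed_field,field_char_0}"
  assumes nonzero: "b12 \<noteq> 0" "b13 \<noteq> 0" "b14 \<noteq> 0" "b23 \<noteq> 0" "b24 \<noteq> 0" "b34 \<noteq> 0"
begin

definition q :: "'k ^ 4 \<Rightarrow> 'k" where
  "q x = b12 * x $ 1 * x $ 2 + b13 * x $ 1 * x $ 3 + b14 * x $ 1 * x $ 4
     + b23 * x $ 2 * x $ 3 + b24 * x $ 2 * x $ 4 + b34 * x $ 3 * x $ 4"

definition c :: "'k ^ 4 \<Rightarrow> 'k" where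
  "c x = x $ 2 * x $ 3 * x $ 4 + x $ 1 * x $ 3 * x $ 4 + x $ 1 * x $ 2 * x $ 4 + x $ 1 * x $ 2 * x $ 3"

definition P :: "'k ^ 5 \<Rightarrow> 'k" where
  "P x = x $ 5 * q (pr4 x) + c (pr4 x)"

definition param :: "'k ^ 4 \<Rightarrow> 'k ^ 5" where
  "param x = vec5 (q x *s x) (- c x)"

lemma form_q: "form 2 q"
proof -
  have "form (1 + 1) q" unfolding q_def by (intro form_add form_mult[of 1 _ 1] form_cmult form_proj)
  then show ?thesis by simp
qed

lemma form_c: "form 3 c"
proof -
  have "form (1 + 1 + 1) c" unfolding c_def by (intro form_add form_mult form_proj)
  then show ?thesis by simp
qed

lemma form_P: "form 3 P"
proof -
  have "form (1 + 2) (\<lambda>x. x $ 5 * q (pr4 x))"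
    by (intro form_mult form_proj form_comp_pr4 form_q)
  then show ?thesis unfolding P_def using form_comp_pr4[OF form_c] by (auto intro: form_add)
qed

lemma form_param: "form 3 (\<lambda>x. param x $ i)"
  unfolding param_def
proof (rule form_vec5)
  fix i
  have "form (2 + 1) (\<lambda>x. q x * x $ i)" by (intro form_mult form_q form_proj)
  then show "form 3 (\<lambda>x. (q x *s x) $ i)" by simp
qed (intro form_uminus form_c)

lemma q_scale: "q (t *s x) = t ^ 2 * q x"
  using form_scale[OF form_q] by simp

lemma c_scale: "c (t *s x) = t ^ 3 * c x"
  using form_scale[OF form_c] by simp

lemma P_param: "P (param x) = 0"
  by (simp add: P_def param_def q_scale c_scale power2_eq_square power3_eq_cube)

lemma param_pr4: "P x = 0 \<Longrightarrow> param (pr4 x) = q (pr4 x) *s x"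
  by (simp add: P_def param_def vec_eq_5 add_eq_0_iff mult.commute)

text \<open>Restricted to a coordinate hyperplane, \<open>q\<close> and \<open>c\<close> have no
  common factor, so a relation between them there is a multiple of the trivial one
  \<open>(c, q)\<close>; what remains is divisible by the coordinate.\<close>

lemma syzygy:
  fixes A B :: "'k ^ 4 \<Rightarrow> 'k"
  assumes A: "form n A" and B: "form (n - 1) B"
    and eq: "\<And>x. q (zero_at i x) * A (zero_at i x) = c (zero_at i x) * B (zero_at i x)"
  shows "\<exists>A' A'' B''. form (n - 3) A' \<and> form (n - 1) A'' \<and> form (n - 2) B'' \<and>
    (\<forall>x. A x = c x * A' x + x $ i * A'' x) \<and> (\<forall>x. B x = q x * A' x + x $ i * B'' x)"
proof -
  note step = syzygy_step[OF form_q _ form_c _ _ _ _ _ A B]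
  consider "i = 1" | "i = 2" | "i = 3" | "i = 4" using exhaust_4 by blast
  then show ?thesis
  proof cases
    case 1
    show ?thesis unfolding 1
      by (rule step[of 1 b23 2 3 b24 4 b34])
         (use eq nonzero in \<open>auto simp: q_def c_def 1\<close>)
  next
    case 2
    show ?thesis unfolding 2
      by (rule step[of 2 b13 1 3 b14 4 b34])
         (use eq nonzero in \<open>auto simp: q_def c_def 2\<close>)
  next
    case 3
    show ?thesis unfolding 3
      by (rule step[of 3 b12 1 2 b14 4 b24])
         (use eq nonzero in \<open>auto simp: q_def c_def 3\<close>)
  next
    case 4
    show ?thesis unfolding 4
      by (rule step[of 4 b12 1 2 b13 3 b23])
         (use eq nonzero in \<open>auto simp: q_def c_def 4\<close>)
  qed
qed

lemma c_nonzero: "c (mk4 1 1 1 1) \<noteq> 0" and q_nonzero: "\<exists>x. q x \<noteq> 0"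
proof -
  show "c (mk4 1 1 1 1) \<noteq> 0" by (simp add: c_def)
  have "q (mk4 1 1 0 0) \<noteq> 0" using nonzero by (simp add: q_def)
  then show "\<exists>x. q x \<noteq> 0" by blast
qed

text \<open>Coprimality of \<open>q\<close> and \<open>c\<close>, by induction on the degree:
  subtracting the trivial relation found on \<open>x $ 1 = 0\<close> leaves a relation divisible by
  \<open>x $ 1\<close>.\<close>

lemma c_dvd:
  assumes "form n h" "form (n - 1) k" "\<And>x. q x * h x = c x * k x"
  shows "\<exists>g. form (n - 3) g \<and> (\<forall>x. h x = c x * g x)"
proof -
  \<comment> \<open>The bound \<open>n < int m\<close> turns the degree into an induction variable;
    for \<open>m = 0\<close> the degree is negative and the form vanishes. Later degree inductions
    have the same shape.\<close>
  have "\<exists>g. form (n - 3) g \<and> (\<forall>x. h x = c x * g x)"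
    if "n < int m" "form n h" "form (n - 1) k" "\<And>x. q x * h x = c x * k x" for m h k n
    using that
  proof (induction m arbitrary: n h k)
    case 0
    then have "h x = 0" for x using form_neg by auto
    then show ?case by (intro exI[of _ "\<lambda>_. 0"]) (simp add: form_zero)
  next
    case (Suc m)
    from syzygy[OF Suc.prems(2,3), of 1] Suc.prems(4)
    obtain A' A'' B'' where A': "form (n - 3) A'" "form (n - 1) A''" "form (n - 2) B''"
      "\<And>x. h x = c x * A' x + x $ 1 * A'' x" "\<And>x. k x = q x * A' x + x $ 1 * B'' x" by auto
    have "q x * A'' x = c x * B'' x" for x
    proof (rule polyfun_cancel[of "\<lambda>x. x $ 1" _ _ "mk4 1 1 1 1"])
      show "x $ 1 * (q x * A'' x) = x $ 1 * (c x * B'' x)" for x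
        using Suc.prems(4)[of x] unfolding A'(4,5) by (simp add: algebra_simps)
    qed (auto intro!: polyfun_proj polyfun_mult form_imp_polyfun[OF form_q] form_imp_polyfun[OF form_c]
        form_imp_polyfun[OF A'(2)] form_imp_polyfun[OF A'(3)])
    moreover have "form (n - 1 - 1) B''" using A'(3) by (simp add: algebra_simps)
    ultimately obtain g where g: "form (n - 1 - 3) g" "\<And>x. A'' x = c x * g x"
      using Suc.IH[of "n - 1" A'' B''] Suc.prems(1) A'(2) by auto
    have "form (n - 1 - 3 + 1) (\<lambda>x. x $ 1 * g x)" using form_coord[OF g(1)] .
    then have "form (n - 3) (\<lambda>x. A' x + x $ 1 * g x)" using A'(1) by (intro form_add) (simp_all add: algebra_simps)
    moreover have "h x = c x * (A' x + x $ 1 * g x)" for x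
      unfolding A'(4) g(2) by (simp add: algebra_simps)
    ultimately show ?case by blast
  qed
  from this[of n "nat (n + 1)" h k] assms show ?thesis by auto
qed

lemma c_dvd_power:
  assumes "form n h" "form (n + 2 * int m - 3) k" "\<And>x. q x ^ m * h x = c x * k x"
  shows "\<exists>g. form (n - 3) g \<and> (\<forall>x. h x = c x * g x)"
  using assms(2,3)
proof (induction m arbitrary: k)
  case 0
  then show ?case by (intro exI[of _ k]) auto
next
  case (Suc m)
  have "form (int m * 2 + n) (\<lambda>x. q x ^ m * h x)" by (intro form_mult form_power form_q assms(1))
  then have 1: "form (n + 2 * int m) (\<lambda>x. q x ^ m * h x)" by (simp add: algebra_simps)
  have 2: "form (n + 2 * int m - 1) k" using Suc.prems(1) by (simp add: algebra_simps)
  from c_dvd[OF 1 2] Suc.prems(2) obtain g where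
    "form (n + 2 * int m - 3) g" "\<And>x. q x ^ m * h x = c x * g x" by (auto simp: mult.assoc)
  from Suc.IH[OF this] show ?case .
qed

text \<open>The kernel of the pullback along \<open>param\<close> is generated by \<open>P\<close>;
  this replaces a Nullstellensatz. The part \<open>a0\<close> of \<open>a\<close> without the fifth
  coordinate turns out to be divisible by \<open>c\<close>, and modulo \<open>x $ 5\<close> the form
  \<open>c\<close> agrees with \<open>P\<close>, so a multiple of \<open>P\<close> can be subtracted
  and \<open>x $ 5\<close> cancelled.\<close>

lemma vanish_param_dvd:
  assumes "form n a" "\<And>x. a (param x) = 0"
  shows "\<exists>g. form (n - 3) g \<and> (\<forall>x. a x = P x * g x)"
proof -
  have "\<exists>g. form (n - 3) g \<and> (\<forall>x. a x = P x * g x)"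
    if "n < int m" "form n a" "\<And>x. a (param x) = 0" for m a n
    using that
  proof (induction m arbitrary: n a)
    case 0
    then have "a x = 0" for x using form_neg by auto
    then show ?case by (intro exI[of _ "\<lambda>_. 0"]) (simp add: form_zero)
  next
    case (Suc m)
    show ?case
    proof (cases "n < 0")
      case True
      then have "a x = 0" for x using form_neg[OF Suc.prems(2)] by auto
      then show ?thesis by (intro exI[of _ "\<lambda>_. 0"]) (simp add: form_zero)
    next
      case False
      obtain a' where a': "form (n - 1) a'" "\<And>x. a x = a (zero_at 5 x) + x $ 5 * a' x"
        using form_expand[OF Suc.prems(2)] by blast
      define a0 where "a0 x = a (vec5 x 0)" for x
      have a0: "form n a0" unfolding a0_def
        by (rule form_comp1[OF Suc.prems(2)]) (intro form_vec5 form_proj form_zero)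
      have ax: "a x = a0 (pr4 x) + x $ 5 * a' x" for x
        using a'(2)[of x] by (simp add: a0_def zero_at_5)
      \<comment> \<open>Along \<open>param\<close> the first four coordinates are
        \<open>q x *s x\<close> and the fifth is \<open>- c x\<close>.\<close>
      have "q x ^ nat n * a0 x = c x * a' (param x)" for x
        using Suc.prems(3)[of x] unfolding ax[of "param x"] by (simp add: param_def form_scale[OF a0])
      moreover have "form ((n - 1) * 3) (\<lambda>x. a' (param x))" by (rule form_comp[OF a'(1) form_param])
      then have "form (n + 2 * int (nat n) - 3) (\<lambda>x. a' (param x))" using False by (simp add: algebra_simps)
      ultimately obtain g0 where g0: "form (n - 3) g0" "\<And>x. a0 x = c x * g0 x"
        using c_dvd_power[OF a0] by blast
      define a2 where "a2 x = a' x - g0 (pr4 x) * q (pr4 x)" for x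
      have "form (n - 3 + 2) (\<lambda>x. g0 (pr4 x) * q (pr4 x))"
        by (intro form_mult form_comp_pr4 g0(1) form_q)
      then have a2: "form (n - 1) a2" unfolding a2_def using a'(1) by (intro form_diff) auto
      have a_eq: "a x = P x * g0 (pr4 x) + x $ 5 * a2 x" for x
        unfolding ax g0(2) a2_def P_def by (simp add: algebra_simps)
      have "a2 (param x) = 0" for x
      proof (rule polyfun_cancel[of c "\<lambda>x. a2 (param x)" "\<lambda>_. 0" "mk4 1 1 1 1"])
        show "c x * a2 (param x) = c x * 0" for x
          using Suc.prems(3)[of x] a_eq[of "param x"] by (simp add: P_param) (simp add: param_def)
      qed (use c_nonzero in \<open>auto intro!: form_imp_polyfun[OF form_c] polyfun_const
         form_imp_polyfun[OF form_comp[OF a2 form_param]]\<close>)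
      then obtain g1 where g1: "form (n - 1 - 3) g1" "\<And>x. a2 x = P x * g1 x"
        using Suc.IH[of "n - 1" a2] Suc.prems(1) a2 by auto
      have "form (n - 1 - 3 + 1) (\<lambda>x. x $ 5 * g1 x)" using form_coord[OF g1(1)] .
      then have "form (n - 3) (\<lambda>x. g0 (pr4 x) + x $ 5 * g1 x)"
        using form_comp_pr4[OF g0(1)] by (intro form_add) (simp_all add: algebra_simps)
      moreover have "a x = P x * (g0 (pr4 x) + x $ 5 * g1 x)" for x
        unfolding a_eq g1(2) by (simp add: algebra_simps)
      ultimately show ?thesis by blast
    qed
  qed
  from this[of n "nat (n + 1)" a] assms show ?thesis by auto
qed

lemma vanish_param:
  assumes "form n a" "\<And>x. a (param x) = 0" "P x = 0"
  shows "a x = 0"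
  using vanish_param_dvd[OF assms(1,2)] assms(3) by auto

text \<open>The pullback along \<open>param\<close> lands in polynomial functions on an affine
  space, which have no zero divisors, and it detects vanishing on the cubic.\<close>

lemma irreducible_P:
  assumes a: "form n a" and f: "form m f" and af: "\<And>x. P x = 0 \<Longrightarrow> a x * f x = 0"
  shows "(\<forall>x. P x = 0 \<longrightarrow> a x = 0) \<or> (\<forall>x. P x = 0 \<longrightarrow> f x = 0)"
proof -
  have "(\<forall>x. a (param x) = 0) \<or> (\<forall>x. f (param x) = 0)"
    using af[OF P_param]
    by (intro polyfun_mult_eq_0 form_imp_polyfun[OF form_comp[OF a form_param]]
       form_imp_polyfun[OF form_comp[OF f form_param]])
  then show ?thesis using vanish_param[OF a] vanish_param[OF f] by blast
qed

text \<open>Membership in the homogeneous ideal \<open>(q, c)\<close> of the exceptional curve, with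
  degrees recorded so that induction on them remains possible.\<close>

definition in_ideal :: "int \<Rightarrow> ('k ^ 4 \<Rightarrow> 'k) \<Rightarrow> bool" where
  "in_ideal n f \<longleftrightarrow> (\<exists>A B. form (n - 2) A \<and> form (n - 3) B \<and> (\<forall>x. f x = q x * A x + c x * B x))"

text \<open>Coordinates are nonzerodivisors modulo \<open>(q, c)\<close>: on the hyperplane the
  representation \<open>q A + c B\<close> is a relation, hence a multiple of the trivial one, which
  can be subtracted from the pair \<open>A\<close>, \<open>B\<close>.\<close>

lemma in_ideal_coord:
  assumes f: "form n f" and I: "in_ideal (n + 1) (\<lambda>x. x $ i * f x)"
  shows "in_ideal n f"
proof -
  obtain A B where A: "form (n - 1) A" and B: "form (n - 2) B"
    and eq: "\<And>x. x $ i * f x = q x * A x + c x * B x"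
    using I unfolding in_ideal_def by auto
  have "form (n - 1 - 1) (\<lambda>x. - B x)" using form_uminus[OF B] by (simp add: algebra_simps)
  moreover have "q (zero_at i x) * A (zero_at i x) = c (zero_at i x) * - B (zero_at i x)" for x
    using eq[of "zero_at i x"] by (simp add: add_eq_0_iff2)
  ultimately obtain A' A'' B'' where A': "form (n - 1 - 3) A'" "form (n - 1 - 1) A''" "form (n - 1 - 2) B''"
    "\<And>x. A x = c x * A' x + x $ i * A'' x" "\<And>x. - B x = q x * A' x + x $ i * B'' x"
    using syzygy[OF A, of "\<lambda>x. - B x"] by blast
  have B_eq: "B x = - (q x * A' x + x $ i * B'' x)" for x using A'(5)[of x] by (metis minus_minus)
  have A2: "form (n - 2) A''" and B2: "form (n - 3) (\<lambda>x. - B'' x)"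
    using A'(2) form_uminus[OF A'(3)] by (simp_all add: algebra_simps)
  have "f x = q x * A'' x + c x * - B'' x" for x
  proof (rule polyfun_cancel[of "\<lambda>x. x $ i" f "\<lambda>x. q x * A'' x + c x * - B'' x" "\<chi> _. 1"])
    show "x $ i * f x = x $ i * (q x * A'' x + c x * - B'' x)" for x
      unfolding eq A'(4) B_eq by (simp add: algebra_simps)
  qed (use form_imp_polyfun[OF A2] form_imp_polyfun[OF A'(3)] form_imp_polyfun[OF f] form_imp_polyfun[OF form_c]
      form_imp_polyfun[OF form_q] in \<open>auto intro!: polyfun_proj polyfun_add polyfun_diff polyfun_mult\<close>)
  then show ?thesis unfolding in_ideal_def using A2 B2 by blast
qed

lemma in_ideal_coord_power:
  "form n f \<Longrightarrow> in_ideal (n + int m) (\<lambda>x. (x $ i) ^ m * f x) \<Longrightarrow> in_ideal n f"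
proof (induction m)
  case (Suc m)
  have "form (int m * 1 + n) (\<lambda>x. (x $ i) ^ m * f x)" by (intro form_mult form_power form_proj Suc.prems)
  then have "form (n + int m) (\<lambda>x. (x $ i) ^ m * f x)" by (simp add: algebra_simps)
  moreover have "in_ideal (n + int m + 1) (\<lambda>x. x $ i * ((x $ i) ^ m * f x))"
    using Suc.prems(2) by (simp add: algebra_simps)
  ultimately have "in_ideal (n + int m) (\<lambda>x. (x $ i) ^ m * f x)" by (rule in_ideal_coord)
  then show ?case using Suc by blast
qed simp

definition crem :: "'k ^ 4 \<Rightarrow> 'k ^ 4" where
  "crem x = mk4 (x $ 2 * x $ 3 * x $ 4) (x $ 1 * x $ 3 * x $ 4) (x $ 1 * x $ 2 * x $ 4) (x $ 1 * x $ 2 * x $ 3)"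

lemma form_crem: "form 3 (\<lambda>x. crem x $ i)"
proof -
  have "form (1 + 1 + 1) (\<lambda>x. crem x $ i)"
    unfolding crem_def by (intro form_mk4 form_mult form_proj)
  then show ?thesis by simp
qed

lemma crem_crem: "crem (crem x) = (x $ 1 * x $ 2 * x $ 3 * x $ 4)\<^sup>2 *s x"
  by (simp add: crem_def vec_eq_4 power2_eq_square)

end

section \<open>The exceptional curve\<close>

definition mk3 :: "'a \<Rightarrow> 'a \<Rightarrow> 'a \<Rightarrow> 'a ^ 3" where
  "mk3 a b c = (\<chi> i. if i = 1 then a else if i = 2 then b else c)"

lemma mk3_nth [simp]: "mk3 a b c $ 1 = a" "mk3 a b c $ 2 = b" "mk3 a b c $ 3 = c"
  by (simp_all add: mk3_def)

lemma vec_eq_3: "x = (y :: 'a ^ 3) \<longleftrightarrow> x $ 1 = y $ 1 \<and> x $ 2 = y $ 2 \<and> x $ 3 = y $ 3"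
  by (simp add: Finite_Cartesian_Product.vec_eq_iff forall_3)

lemma sqrt_exists: "\<exists>s. s ^ 2 = (x :: 'k::alg_closed_field)"
  using nth_root_exists[of 2 x] by auto

text \<open>The equation of the conic is monic of degree two in \<open>p $ 1\<close>, so division
  leaves a remainder that is linear in this coordinate.\<close>

lemma conic_normal_form:
  fixes f :: "'k::field ^ 3 \<Rightarrow> 'k"
  assumes "form n f"
  shows "\<exists>A \<alpha> \<beta>. form (n - 2) A \<and> form (n - 1) \<alpha> \<and> form n \<beta> \<and>
    (\<forall>p. f p = ((p $ 1)\<^sup>2 - p $ 2 * p $ 3) * A p + p $ 1 * \<alpha> (zero_at 1 p) + \<beta> (zero_at 1 p))"
proof -
  have "\<exists>A \<alpha> \<beta>. form (n - 2) A \<and> form (n - 1) \<alpha> \<and> form n \<beta> \<and>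
    (\<forall>p. f p = ((p $ 1)\<^sup>2 - p $ 2 * p $ 3) * A p + p $ 1 * \<alpha> (zero_at 1 p) + \<beta> (zero_at 1 p))"
    if "n < int m" "form n f" for m n and f :: "'k ^ 3 \<Rightarrow> 'k"
    using that
  proof (induction m arbitrary: n f)
    case 0
    then have "f p = 0" for p using form_neg by auto
    then show ?case by (intro exI[of _ "\<lambda>_. 0"]) (simp add: form_zero)
  next
    case (Suc m)
    obtain g where g: "form (n - 1) g" "\<And>p. f p = f (zero_at 1 p) + p $ 1 * g p"
      using form_expand[OF Suc.prems(2)] by blast
    obtain A \<alpha> \<beta> where A: "form (n - 1 - 2) A" "form (n - 1 - 1) \<alpha>" "form (n - 1) \<beta>"
      "\<And>p. g p = ((p $ 1)\<^sup>2 - p $ 2 * p $ 3) * A p + p $ 1 * \<alpha> (zero_at 1 p) + \<beta> (zero_at 1 p)"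
      using Suc.IH[OF _ g(1)] Suc.prems(1) by auto
    have "form (n - 1 - 2 + 1) (\<lambda>p. p $ 1 * A p)" using form_coord[OF A(1)] .
    then have 1: "form (n - 2) (\<lambda>p. p $ 1 * A p + \<alpha> (zero_at 1 p))"
      using form_comp_zero_at[OF A(2), of 1] by (intro form_add) (simp_all add: algebra_simps)
    have "form (1 + 1 + (n - 1 - 1)) (\<lambda>p. p $ 2 * p $ 3 * \<alpha> p)" by (intro form_mult form_proj A(2))
    then have 2: "form n (\<lambda>p. p $ 2 * p $ 3 * \<alpha> p + f p)"
      using Suc.prems(2) by (intro form_add) simp_all
    have zz: "zero_at 1 (zero_at 1 p) = zero_at 1 p" for p :: "'k ^ 3"
      by (simp add: Finite_Cartesian_Product.vec_eq_iff)
    have "f p = ((p $ 1)\<^sup>2 - p $ 2 * p $ 3) * (p $ 1 * A p + \<alpha> (zero_at 1 p)) + p $ 1 * \<beta> (zero_at 1 p)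
       + (zero_at 1 p $ 2 * zero_at 1 p $ 3 * \<alpha> (zero_at 1 p) + f (zero_at 1 p))" for p
      by (subst g(2), subst A(4)) (simp add: algebra_simps power2_eq_square)
    then show ?case using 1 2 A(3)
      by (intro exI[of _ "\<lambda>p. p $ 1 * A p + \<alpha> (zero_at 1 p)"] exI[of _ \<beta>]
          exI[of _ "\<lambda>p. p $ 2 * p $ 3 * \<alpha> p + f p"] conjI allI)
  qed
  from this[of n "nat (n + 1)" f] assms show ?thesis by auto
qed

text \<open>On the parametrized conic the remainder is \<open>s t \<alpha> + \<beta>\<close>, where
  \<open>\<alpha>\<close> and \<open>\<beta>\<close> depend on the squares of \<open>s\<close> and
  \<open>t\<close> only. A sign change of \<open>s\<close> separates them, and since square roots
  exist, both vanish identically.\<close>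

lemma conic_dvd:
  fixes f :: "'k::{alg_closed_field,field_char_0} ^ 3 \<Rightarrow> 'k"
  assumes f: "form n f" and vanish: "\<And>s t. f (mk3 (s * t) (s\<^sup>2) (t\<^sup>2)) = 0"
  shows "\<exists>A. form (n - 2) A \<and> (\<forall>p. f p = ((p $ 1)\<^sup>2 - p $ 2 * p $ 3) * A p)"
proof -
  obtain A \<alpha> \<beta> where A: "form (n - 2) A" "form (n - 1) \<alpha>" "form n \<beta>"
    "\<And>p. f p = ((p $ 1)\<^sup>2 - p $ 2 * p $ 3) * A p + p $ 1 * \<alpha> (zero_at 1 p) + \<beta> (zero_at 1 p)"
    using conic_normal_form[OF f] by blast
  have z: "zero_at 1 (mk3 a b c) = mk3 0 b c" for a b c :: 'k by (simp add: vec_eq_3)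
  have eq: "s * t * \<alpha> (mk3 0 (s\<^sup>2) (t\<^sup>2)) + \<beta> (mk3 0 (s\<^sup>2) (t\<^sup>2)) = 0" for s t
    using vanish[of s t] unfolding A(4) z by (simp add: power_mult_distrib)
  have neg: "- (s * t * \<alpha> (mk3 0 (s\<^sup>2) (t\<^sup>2))) + \<beta> (mk3 0 (s\<^sup>2) (t\<^sup>2)) = 0" for s t
    using eq[of "- s" t] by simp
  have b0: "\<beta> (mk3 0 (s\<^sup>2) (t\<^sup>2)) = 0" for s t
  proof -
    have "2 * \<beta> (mk3 0 (s\<^sup>2) (t\<^sup>2)) = 0" using eq[of s t] neg[of s t] by (simp add: add_eq_0_iff)
    then show ?thesis by simp
  qed
  have b: "\<beta> (zero_at 1 p) = 0" for p
  proof -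
    obtain s t where "s\<^sup>2 = p $ 2" "t\<^sup>2 = p $ 3" using sqrt_exists by metis
    then have "zero_at 1 p = mk3 0 (s\<^sup>2) (t\<^sup>2)" by (simp add: vec_eq_3)
    then show ?thesis using b0 by simp
  qed
  have a: "\<alpha> (zero_at 1 p) = 0" for p
  proof (rule polyfun_cancel[of "\<lambda>p. p $ 2 * p $ 3" "\<lambda>p. \<alpha> (zero_at 1 p)" "\<lambda>_. 0" "\<chi> _. 1"])
    show "p $ 2 * p $ 3 * \<alpha> (zero_at 1 p) = p $ 2 * p $ 3 * 0" for p
    proof -
      obtain s t where st: "s\<^sup>2 = p $ 2" "t\<^sup>2 = p $ 3" using sqrt_exists by metis
      then have z: "zero_at 1 p = mk3 0 (s\<^sup>2) (t\<^sup>2)" by (simp add: vec_eq_3)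
      show ?thesis unfolding z using eq[of s t] b0[of s t] st[symmetric] by auto
    qed
  qed (auto intro!: polyfun_mult polyfun_proj polyfun_const form_imp_polyfun[OF form_comp_zero_at[OF A(2)]])
  show ?thesis using A(1,4) a b by auto
qed

text \<open>The Cremona map turns the curve \<open>q = c = 0\<close> into a plane conic, which \<open>L\<close> and \<open>N\<close> identify
  with the standard conic.\<close>

locale factorial_cubic = nodal_cubic b12 b13 b14 b23 b24 b34
  for b12 b13 b14 b23 b24 b34 :: "'k::{alg_closed_field,field_char_0}" +
  fixes L :: "'k ^ 3 \<Rightarrow> 'k ^ 4" and N :: "'k ^ 4 \<Rightarrow> 'k ^ 3" and \<kappa> :: 'k
  assumes form_L: "\<And>i. form 1 (\<lambda>p. L p $ i)" and form_N: "\<And>i. form 1 (\<lambda>y. N y $ i)"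
    and L_sum: "\<And>p. (L p) $ 1 + (L p) $ 2 + (L p) $ 3 + (L p) $ 4 = 0"
    and L_N: "\<And>y. y $ 1 + y $ 2 + y $ 3 + y $ 4 = 0 \<Longrightarrow> L (N y) = y"
    and \<kappa>: "\<kappa> \<noteq> 0"
    and L_conic: "\<And>p y. y = L p \<Longrightarrow> b34 * y $ 1 * y $ 2 + b24 * y $ 1 * y $ 3 + b23 * y $ 1 * y $ 4
      + b14 * y $ 2 * y $ 3 + b13 * y $ 2 * y $ 4 + b12 * y $ 3 * y $ 4 = \<kappa> * ((p $ 1)\<^sup>2 - p $ 2 * p $ 3)"
begin

text \<open>The Cremona transform of \<open>q\<close> without the common monomial factor; each
  coefficient has moved to the complementary pair of variables.\<close>

definition q' :: "'k ^ 4 \<Rightarrow> 'k" where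
  "q' y = b34 * y $ 1 * y $ 2 + b24 * y $ 1 * y $ 3 + b23 * y $ 1 * y $ 4
      + b14 * y $ 2 * y $ 3 + b13 * y $ 2 * y $ 4 + b12 * y $ 3 * y $ 4"

definition curve :: "'k \<Rightarrow> 'k \<Rightarrow> 'k ^ 4" where
  "curve s t = crem (L (mk3 (s * t) (s\<^sup>2) (t\<^sup>2)))"

lemma q_crem: "q (crem y) = y $ 1 * y $ 2 * y $ 3 * y $ 4 * q' y"
  by (simp add: q_def q'_def crem_def algebra_simps)

lemma c_crem: "c (crem y) = (y $ 1 * y $ 2 * y $ 3 * y $ 4)\<^sup>2 * (y $ 1 + y $ 2 + y $ 3 + y $ 4)"
  by (simp add: c_def crem_def algebra_simps power2_eq_square)

lemma crem_sum: "crem y $ 1 + crem y $ 2 + crem y $ 3 + crem y $ 4 = c y"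
  by (simp add: c_def crem_def)

lemma curve_q: "q (curve s t) = 0" and curve_c: "c (curve s t) = 0"
  using L_conic[OF refl] L_sum
  by (simp_all add: curve_def q_crem c_crem q'_def power_mult_distrib)

text \<open>Pulled back by the Cremona map, \<open>f\<close> vanishes on a plane conic, so it lies
  in the ideal generated by \<open>q'\<close> and the sum of the coordinates. A second application
  of the Cremona map returns \<open>f\<close> times a monomial, which cancels because coordinates
  are nonzerodivisors modulo \<open>(q, c)\<close>.\<close>

lemma vanish_curve_in_ideal:
  assumes f: "form n f" and vanish: "\<And>s t. f (curve s t) = 0"
  shows "in_ideal n f"
proof -
  have f1: "form (n * 3) (\<lambda>y. f (crem y))" by (rule form_comp[OF f form_crem])
  have f2: "form (n * 3) (\<lambda>p. f (crem (L p)))" by (rule form_comp1[OF f1]) (rule form_L)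
  from conic_dvd[OF f2] vanish obtain A where A: "form (n * 3 - 2) A"
    "\<And>p. f (crem (L p)) = ((p $ 1)\<^sup>2 - p $ 2 * p $ 3) * A p" unfolding curve_def by blast
  \<comment> \<open>\<open>sh\<close> carries the hyperplane \<open>y $ 4 = 0\<close> to the plane
    of coordinate sum zero, so that division by a coordinate becomes division by the sum.
    \<open>us\<close> is its inverse, \<open>pl\<close> a linear projection onto the plane.\<close>
  define sh where "sh y = mk4 (y $ 1) (y $ 2) (y $ 3) (y $ 4 - y $ 1 - y $ 2 - y $ 3)" for y :: "'k ^ 4"
  have sh: "form 1 (\<lambda>y. sh y $ i)" for i
    unfolding sh_def by (intro form_mk4 form_diff form_proj)
  have "form (n * 3) (\<lambda>y. f (crem (sh y)))" by (rule form_comp1[OF f1 sh])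
  from form_expand[OF this, of 4] obtain g where g: "form (n * 3 - 1) g"
    "\<And>y. f (crem (sh y)) = f (crem (sh (zero_at 4 y))) + y $ 4 * g y" by blast
  define us where "us y = mk4 (y $ 1) (y $ 2) (y $ 3) (y $ 1 + y $ 2 + y $ 3 + y $ 4)" for y :: "'k ^ 4"
  have us: "form 1 (\<lambda>y. us y $ i)" for i
    unfolding us_def by (intro form_mk4 form_add form_proj)
  have sh_us: "sh (us y) = y" for y by (simp add: sh_def us_def vec_eq_4)
  define pl where "pl y = mk4 (y $ 1) (y $ 2) (y $ 3) (- (y $ 1) - y $ 2 - y $ 3)" for y :: "'k ^ 4"
  have pl: "form 1 (\<lambda>y. pl y $ i)" for i
    unfolding pl_def by (intro form_mk4 form_diff form_uminus form_proj)
  have pl_us: "sh (zero_at 4 (us y)) = pl y" for y by (simp add: sh_def us_def pl_def vec_eq_4)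
  have 1: "f (crem y) = f (crem (pl y)) + (y $ 1 + y $ 2 + y $ 3 + y $ 4) * g (us y)" for y
    using g(2)[of "us y"] unfolding sh_us pl_us by (simp add: us_def)
  have 2: "\<kappa> * f (crem (pl y)) = q' (pl y) * A (N (pl y))" for y
  proof -
    have "L (N (pl y)) = pl y" by (rule L_N) (simp add: pl_def)
    then show ?thesis using A(2)[of "N (pl y)"] L_conic[of "pl y" "N (pl y)"] by (simp add: q'_def)
  qed
  have 3: "q' (pl y) = q' y - (y $ 1 + y $ 2 + y $ 3 + y $ 4) * (b23 * y $ 1 + b13 * y $ 2 + b12 * y $ 3)" for y
    by (simp add: q'_def pl_def algebra_simps)
  define pp where "pp x = x $ 1 * x $ 2 * x $ 3 * x $ 4" for x :: "'k ^ 4"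
  have "form (1 + 1 + 1 + 1) pp" unfolding pp_def by (intro form_mult form_proj)
  then have pp: "form 4 pp" by simp
  have qc: "q' (crem x) = pp x * q x" for x by (simp add: q'_def crem_def q_def pp_def algebra_simps)
  define A' where "A' x = inverse \<kappa> * (pp x * A (N (pl (crem x))))" for x
  define B' where "B' x = g (us (crem x)) - inverse \<kappa> *
     ((b23 * crem x $ 1 + b13 * crem x $ 2 + b12 * crem x $ 3) * A (N (pl (crem x))))" for x
  have AN: "form ((n * 3 - 2) * 3) (\<lambda>x. A (N (pl (crem x))))"
  proof (rule form_comp[OF A(1)])
    fix i
    have "form 1 (\<lambda>y. (N (pl y)) $ i)" by (rule form_comp1[OF form_N pl])
    from form_comp[OF this form_crem] show "form 3 (\<lambda>x. (N (pl (crem x))) $ i)" by simp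
  qed
  have "form (4 + (n * 3 - 2) * 3) A'" unfolding A'_def by (intro form_cmult form_mult pp AN)
  then have A': "form (n + 8 * n - 2) A'" by (simp add: algebra_simps)
  have "form (3 + (n * 3 - 2) * 3) (\<lambda>x. (b23 * crem x $ 1 + b13 * crem x $ 2 + b12 * crem x $ 3) * A (N (pl (crem x))))"
    by (intro form_mult AN form_add form_cmult form_crem)
  moreover have "form ((n * 3 - 1) * 3) (\<lambda>x. g (us (crem x)))"
    by (rule form_comp[OF form_comp1[OF g(1) us] form_crem])
  ultimately have B': "form (n + 8 * n - 3) B'" unfolding B'_def
    by (intro form_diff form_cmult) (simp_all add: algebra_simps)
  show ?thesis
  proof (cases "n < 0")
    case True
    then have "f x = 0" for x using form_neg[OF f] by auto
    then show ?thesis unfolding in_ideal_def by (intro exI[of _ "\<lambda>_. 0"]) (simp add: form_zero)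
  next
    case False
    \<comment> \<open>The double Cremona map scales by the square of \<open>pp\<close>, and
      \<open>f\<close> has degree \<open>n\<close>.\<close>
    define m where "m = 2 * nat n"
    have mn: "int m = 2 * n" using False by (simp add: m_def)
    have 4: "pp x ^ m * f x = q x * A' x + c x * B' x" for x
    proof -
      have "pp x ^ m * f x = f (crem (crem x))"
        unfolding crem_crem form_scale[OF f] m_def pp_def by (simp add: power_mult)
      also have "\<dots> = inverse \<kappa> * (\<kappa> * f (crem (pl (crem x)))) + c x * g (us (crem x))"
        unfolding 1[of "crem x"] crem_sum using \<kappa> by simp
      also have "\<dots> = q x * A' x + c x * B' x"
        unfolding 2 3 crem_sum qc A'_def B'_def by (simp add: algebra_simps)
      finally show ?thesis .
    qed
    have "in_ideal (n + int m + int m + int m + int m) (\<lambda>x. (x $ 1) ^ m * ((x $ 2) ^ m * ((x $ 3) ^ m * ((x $ 4) ^ m * f x))))"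
      unfolding in_ideal_def
      using A' B' 4 mn by (intro exI[of _ A'] exI[of _ B']) (simp add: pp_def power_mult_distrib mult.assoc)
    moreover have f4: "form (n + int m) (\<lambda>x. (x $ 4) ^ m * f x)"
      using form_mult[OF form_power[OF form_proj, of m 4] f] by (simp add: algebra_simps)
    moreover have f3: "form (n + int m + int m) (\<lambda>x. (x $ 3) ^ m * ((x $ 4) ^ m * f x))"
      using form_mult[OF form_power[OF form_proj, of m 3] f4] by (simp add: algebra_simps)
    moreover have f2: "form (n + int m + int m + int m) (\<lambda>x. (x $ 2) ^ m * ((x $ 3) ^ m * ((x $ 4) ^ m * f x)))"
      using form_mult[OF form_power[OF form_proj, of m 2] f3] by (simp add: algebra_simps)
    ultimately show ?thesis using f in_ideal_coord_power by blast
  qed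
qed

text \<open>The exceptional curve \<open>q = c = 0\<close> is irreducible, so \<open>q\<close> is a prime element of the
  coordinate ring of the cubic.\<close>

lemma vanish_curve_dvd:
  assumes "form n a" "\<And>s t u. a (vec5 (curve s t) u) = 0"
  shows "\<exists>A B. form (n - 2) A \<and> form (n - 3) B \<and> (\<forall>x. a x = q (pr4 x) * A x + c (pr4 x) * B x)"
proof -
  have "\<exists>A B. form (n - 2) A \<and> form (n - 3) B \<and> (\<forall>x. a x = q (pr4 x) * A x + c (pr4 x) * B x)"
    if "n < int m" "form n a" "\<And>s t u. a (vec5 (curve s t) u) = 0" for m n a
    using that
  proof (induction m arbitrary: n a)
    case 0
    then have "a x = 0" for x using form_neg by auto
    then show ?case by (intro exI[of _ "\<lambda>_. 0"]) (simp add: form_zero)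
  next
    case (Suc m)
    obtain a' where a': "form (n - 1) a'" "\<And>x. a x = a (zero_at 5 x) + x $ 5 * a' x"
      using form_expand[OF Suc.prems(2)] by blast
    define a0 where "a0 x = a (vec5 x 0)" for x
    have a0: "form n a0" unfolding a0_def
      by (rule form_comp1[OF Suc.prems(2)]) (intro form_vec5 form_proj form_zero)
    have ax: "a x = a0 (pr4 x) + x $ 5 * a' x" for x
      using a'(2)[of x] by (simp add: a0_def zero_at_5)
    have "in_ideal n a0" by (rule vanish_curve_in_ideal[OF a0]) (simp add: a0_def Suc.prems(3))
    then obtain A B where A: "form (n - 2) A" "form (n - 3) B" "\<And>x. a0 x = q x * A x + c x * B x"
      unfolding in_ideal_def by blast
    have v: "a' (vec5 (curve s t) u) = 0" for s t u
    proof -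
      obtain p where p: "\<And>r. a' (vec5 (curve s t) 0 + r *s mk5 0 0 0 0 1) = poly p r"
        using polyfun_line[OF form_imp_polyfun[OF a'(1)]] by blast
      have e: "vec5 (curve s t) 0 + r *s mk5 0 0 0 0 1 = vec5 (curve s t) r" for r by (simp add: vec_eq_5)
      have "poly ([:0, 1:] * p) r = 0" for r
        using ax[of "vec5 (curve s t) r"] Suc.prems(3) p[of r] unfolding e by (simp add: a0_def)
      then have "[:0, 1:] * p = 0" using poly_all_0_iff_0 by blast
      then have "p = 0" by simp
      then show ?thesis using p[of u] unfolding e by simp
    qed
    obtain A' B' where A': "form (n - 1 - 2) A'" "form (n - 1 - 3) B'"
      "\<And>x. a' x = q (pr4 x) * A' x + c (pr4 x) * B' x"
      using Suc.IH[OF _ a'(1) v] Suc.prems(1) by auto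
    have "form (n - 1 - 2 + 1) (\<lambda>x. x $ 5 * A' x)" "form (n - 1 - 3 + 1) (\<lambda>x. x $ 5 * B' x)"
      using form_coord[OF A'(1)] form_coord[OF A'(2)] by auto
    then have "form (n - 2) (\<lambda>x. A (pr4 x) + x $ 5 * A' x)" "form (n - 3) (\<lambda>x. B (pr4 x) + x $ 5 * B' x)"
      using form_comp_pr4[OF A(1)] form_comp_pr4[OF A(2)] by (auto intro!: form_add simp: algebra_simps)
    moreover have "a x = q (pr4 x) * (A (pr4 x) + x $ 5 * A' x) + c (pr4 x) * (B (pr4 x) + x $ 5 * B' x)" for x
      unfolding ax A(3) A'(3) by (simp add: algebra_simps)
    ultimately show ?case by blast
  qed
  from this[of n "nat (n + 1)" a] assms show ?thesis by auto
qed

text \<open>On the cone over the exceptional curve, parametrized by \<open>z\<close>, both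
  \<open>P\<close> and \<open>q\<close> vanish, so \<open>a\<close> or \<open>f\<close> vanishes
  there. Vanishing on this cone means lying in \<open>(q, c)\<close>, and on the cubic
  \<open>c\<close> is a multiple of \<open>q\<close>.\<close>

lemma q_prime:
  assumes a: "form n a" and f: "form m f" and af: "\<And>x. P x = 0 \<Longrightarrow> a x * f x = q (pr4 x) * h x"
  shows "(\<exists>a'. form (n - 2) a' \<and> (\<forall>x. P x = 0 \<longrightarrow> a x = q (pr4 x) * a' x)) \<or>
    (\<exists>f'. form (m - 2) f' \<and> (\<forall>x. P x = 0 \<longrightarrow> f x = q (pr4 x) * f' x))"
proof -
  define z where "z p = vec5 (curve (p $ 1) (p $ 2)) (p $ 3)" for p :: "'k ^ 3"
  have pz: "polyfun (\<lambda>p. z p $ i)" for i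
  proof -
    have pm: "polyfun (\<lambda>p :: 'k ^ 3. mk3 (p $ 1 * p $ 2) ((p $ 1)\<^sup>2) ((p $ 2)\<^sup>2) $ j)" for j
      using exhaust_3[of j] by (elim disjE) (auto intro!: polyfun_mult polyfun_power polyfun_proj)
    have pc: "polyfun (\<lambda>p :: 'k ^ 3. curve (p $ 1) (p $ 2) $ j)" for j :: 4
      unfolding curve_def
      by (intro polyfun_comp[OF form_imp_polyfun[OF form_crem]] polyfun_comp[OF form_imp_polyfun[OF form_L]] pm)
    show ?thesis unfolding z_def using exhaust_5[of i] by (elim disjE) (auto intro: pc polyfun_proj)
  qed
  have P0: "P (vec5 (curve s t) u) = 0" for s t u by (simp add: P_def curve_q curve_c)
  have "a (z p) * f (z p) = 0" for p
    using af[OF P0] unfolding z_def by (simp add: curve_q)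
  then have "(\<forall>p. a (z p) = 0) \<or> (\<forall>p. f (z p) = 0)"
    by (intro polyfun_mult_eq_0 polyfun_comp[OF form_imp_polyfun[OF a] pz] polyfun_comp[OF form_imp_polyfun[OF f] pz])
  moreover have "\<exists>g'. form (d - 2) g' \<and> (\<forall>x. P x = 0 \<longrightarrow> g x = q (pr4 x) * g' x)"
    if g: "form d g" "\<forall>p. g (z p) = 0" for d g
  proof -
    have "g (vec5 (curve s t) u) = 0" for s t u using g(2)[rule_format, of "mk3 s t u"] by (simp add: z_def)
    from vanish_curve_dvd[OF g(1) this] obtain A B where A: "form (d - 2) A" "form (d - 3) B"
      "\<And>x. g x = q (pr4 x) * A x + c (pr4 x) * B x" by blast
    have "form (d - 3 + 1) (\<lambda>x. x $ 5 * B x)" using form_coord[OF A(2)] .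
    then have "form (d - 2) (\<lambda>x. A x - x $ 5 * B x)" using A(1) by (intro form_diff) (simp_all add: algebra_simps)
    moreover have "g x = q (pr4 x) * (A x - x $ 5 * B x)" if "P x = 0" for x
    proof -
      have "c (pr4 x) = - (x $ 5 * q (pr4 x))" using that by (simp add: P_def add_eq_0_iff)
      then show ?thesis unfolding A(3) by (simp add: algebra_simps)
    qed
    ultimately show ?thesis by blast
  qed
  ultimately show ?thesis using a f by blast
qed

end

section \<open>Local and global representations of morphisms\<close>

lemma span_singleton: "vec.span {v} = range (\<lambda>c. c *s (v :: 'k::field ^ 'n::finite))"
  by (rule vec.span_singleton)

lemma span_eq_imp_scale:
  fixes u v :: "'k::field ^ 'n::finite"
  assumes "vec.span {u} = vec.span {v}" "u \<noteq> 0"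
  shows "\<exists>c. c \<noteq> 0 \<and> u = c *s v"
proof -
  have "u \<in> vec.span {v}" using assms vec.span_base by blast
  then obtain c where "u = c *s v" unfolding span_singleton by blast
  then show ?thesis using assms(2) by (intro exI[of _ c]) auto
qed

lemma span_scale:
  fixes v :: "'k::field ^ 'n::finite"
  assumes "c \<noteq> 0" shows "vec.span {c *s v} = vec.span {v}"
proof -
  have "v = inverse c *s (c *s v)" using assms by (simp add: vector_smult_assoc)
  then have "v \<in> vec.span {c *s v}" unfolding span_singleton by blast
  moreover have "c *s v \<in> vec.span {v}" unfolding span_singleton by blast
  ultimately show ?thesis by (intro vec.span_eq[THEN iffD2]) auto
qed

text \<open>A binary form of positive degree has a zero: either its restriction to the affine line
  through \<open>axis 1 1\<close> has a root, or this restriction is constant and the zero is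
  \<open>axis 2 1\<close>.\<close>

lemma binary_form_zero_free:
  fixes H :: "'k::{alg_closed_field,field_char_0} ^ 2 \<Rightarrow> 'k"
  assumes H: "form m H" and nz: "\<And>p. p \<noteq> 0 \<Longrightarrow> H p \<noteq> 0"
  shows "m = 0"
proof (rule ccontr)
  assume "m \<noteq> 0"
  have ne: "(axis 1 1 :: 'k ^ 2) \<noteq> 0" "(axis 2 1 :: 'k ^ 2) \<noteq> 0" by (simp_all add: axis_eq_0_iff)
  then have "m > 0" using \<open>m \<noteq> 0\<close> form_neg[OF H, of "axis 1 1"] nz by force
  obtain p where p: "\<And>t. H (axis 1 1 + t *s axis 2 1) = poly p t"
    using polyfun_line[OF form_imp_polyfun[OF H]] by metis
  have e1: "axis 1 1 + t *s axis 2 1 \<noteq> (0 :: 'k ^ 2)" for t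
    by (simp add: Finite_Cartesian_Product.vec_eq_iff forall_2 axis_def)
  have "degree p = 0"
  proof (rule ccontr)
    assume "degree p \<noteq> 0"
    then obtain t where "poly p t = 0" using alg_closed_imp_poly_has_root by blast
    then show False using p[of t] nz[OF e1] by simp
  qed
  then obtain c where c: "p = [:c:]" using degree_eq_zeroE by blast
  obtain r where r: "\<And>t. H (axis 2 1 + t *s axis 1 1) = poly r t"
    using polyfun_line[OF form_imp_polyfun[OF H]] by metis
  have "poly ([:0, 1:] * (r - monom c (nat m))) t = 0" for t
  proof (cases "t = 0")
    case False
    have "axis 2 1 + t *s axis 1 1 = t *s (axis 1 1 + inverse t *s (axis 2 1 :: 'k ^ 2))"
      using False by (simp add: Finite_Cartesian_Product.vec_eq_iff forall_2 axis_def)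
    then have "poly r t = t ^ nat m * H (axis 1 1 + inverse t *s axis 2 1)"
      using r[of t] form_scale[OF H, of t "axis 1 1 + inverse t *s axis 2 1"] by metis
    then have "poly r t = t ^ nat m * c" unfolding p c by simp
    then show ?thesis by (simp add: poly_monom)
  qed simp
  then have "[:0, 1:] * (r - monom c (nat m)) = 0" using poly_all_0_iff_0 by blast
  then have "r = monom c (nat m)" by simp
  then have "poly r 0 = 0" using \<open>m > 0\<close> by (simp add: poly_monom)
  then show False using r[of 0] nz[OF ne(2)] by simp
qed

context nodal_cubic
begin

lemma P_axis: "P (axis i 1) = 0"
  using exhaust_5[of i] by (elim disjE) (auto simp: P_def q_def c_def axis_def)

text \<open>The vertex of the cone is exempt because morphisms constrain nonzero vectors only. The
  factor \<open>x $ 1\<close> restores the vanishing there and is cancelled by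
  irreducibility.\<close>

lemma irreducible_P':
  assumes a: "form n a" and f: "form m f" and af: "\<And>x. P x = 0 \<Longrightarrow> x \<noteq> 0 \<Longrightarrow> a x * f x = 0"
  shows "(\<forall>x. P x = 0 \<longrightarrow> a x = 0) \<or> (\<forall>x. P x = 0 \<longrightarrow> f x = 0)"
proof -
  have "(\<forall>x. P x = 0 \<longrightarrow> x $ 1 * a x = 0) \<or> (\<forall>x. P x = 0 \<longrightarrow> f x = 0)"
    by (rule irreducible_P[OF form_coord[OF a] f]) (use af in force)
  moreover have "(\<forall>x. P x = 0 \<longrightarrow> x $ 1 = 0) \<or> (\<forall>x. P x = 0 \<longrightarrow> a x = 0)"
    if "\<forall>x. P x = 0 \<longrightarrow> x $ 1 * a x = 0"
    by (rule irreducible_P[OF form_proj a]) (use that in auto)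
  moreover have "\<not> (\<forall>x. P x = 0 \<longrightarrow> x $ 1 = 0)"
    using P_axis[of 1] by (auto simp: axis_def intro!: exI[of _ "axis 1 1"])
  ultimately show ?thesis by blast
qed

text \<open>In contrast to \<open>regular_map\<close>, the neighbourhood is the locus where one form
  \<open>H\<close> is nonzero, and \<open>l\<close> is a function of representatives, which makes
  linear changes of coordinates easy.\<close>

definition local_forms :: "('k ^ 5 \<Rightarrow> ('k ^ 5) set) \<Rightarrow> 'k ^ 5 \<Rightarrow> int \<Rightarrow> ('k ^ 5 \<Rightarrow> 'k) \<Rightarrow> int \<Rightarrow> (5 \<Rightarrow> 'k ^ 5 \<Rightarrow> 'k) \<Rightarrow> bool" where
  "local_forms l p e H d h \<longleftrightarrow> form e H \<and> (\<forall>j. form d (h j)) \<and> H p \<noteq> 0 \<and>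
     (\<forall>w. P w = 0 \<longrightarrow> w \<noteq> 0 \<longrightarrow> H w \<noteq> 0 \<longrightarrow> (\<chi> j. h j w) \<noteq> 0 \<and> l w = vec.span {\<chi> j. h j w})"

text \<open>Where \<open>H\<close> and \<open>H'\<close> are both nonzero the two tuples span the
  same line. By irreducibility the relation extends from there to the whole cubic.\<close>

lemma local_forms_cross:
  assumes 1: "local_forms l p e H d h" "P p = 0" and 2: "local_forms l p' e' H' d' h'" "P p' = 0"
    and x: "P x = 0"
  shows "h i x * h' j x = h j x * h' i x"
proof -
  let ?cr = "\<lambda>x. h i x * h' j x - h j x * h' i x"
  have cr: "form (d + d') ?cr"
    using 1(1) 2(1) unfolding local_forms_def by (intro form_diff form_mult) auto
  have H: "form e H" "form e' H'" "H p \<noteq> 0" "H' p' \<noteq> 0" using 1 2 by (auto simp: local_forms_def)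
  have "H x * (H' x * ?cr x) = 0" if x: "P x = 0" "x \<noteq> 0" for x
  proof (cases "H x = 0 \<or> H' x = 0")
    case False
    then have "vec.span {\<chi> j. h j x} = vec.span {\<chi> j. h' j x}" "(\<chi> j. h j x) \<noteq> 0"
      using 1 2 x unfolding local_forms_def by metis+
    from span_eq_imp_scale[OF this] obtain t where "(\<chi> j. h j x) = t *s (\<chi> j. h' j x)" by blast
    then have "h j x = t * h' j x" for j by (simp add: Finite_Cartesian_Product.vec_eq_iff)
    then show ?thesis by simp
  qed auto
  from irreducible_P'[OF H(1) form_mult[OF H(2) cr] this]
  have "\<forall>x. P x = 0 \<longrightarrow> H' x * ?cr x = 0" using H(3) 1(2) by blast
  then have "(\<forall>x. P x = 0 \<longrightarrow> H' x = 0) \<or> (\<forall>x. P x = 0 \<longrightarrow> ?cr x = 0)"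
    by (intro irreducible_P[OF H(2) cr]) auto
  then show ?thesis using H(4) 2(2) x by auto
qed

end

context factorial_cubic
begin

text \<open>The components of a local representation, pulled back along \<^term>\<open>param\<close>, are divided by
  their greatest common divisor and then by the highest possible power of the prime \<open>q\<close>.\<close>

lemma global_forms:
  assumes loc: "\<And>p. P p = 0 \<Longrightarrow> p \<noteq> 0 \<Longrightarrow> \<exists>e H d h. local_forms l p e H d h"
  shows "\<exists>d f. (\<forall>j. form d (f j)) \<and>
    (\<forall>w. P w = 0 \<longrightarrow> w \<noteq> 0 \<longrightarrow> (\<chi> j. f j w) \<noteq> 0 \<and> l w = vec.span {\<chi> j. f j w})"
proof -
  define p0 :: "'k ^ 5" where "p0 = axis 1 1"
  have p0: "P p0 = 0" "p0 \<noteq> 0" by (auto simp: p0_def P_axis axis_eq_0_iff)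
  obtain e0 H0 d0 h0 where L0: "local_forms l p0 e0 H0 d0 h0" using loc[OF p0] by blast
  have fh0: "form d0 (h0 j)" for j using L0 by (simp add: local_forms_def)
  have "(\<chi> j. h0 j p0) \<noteq> 0" using L0 p0 by (simp add: local_forms_def)
  then obtain j0 where j0: "h0 j0 p0 \<noteq> 0" by (auto simp: Finite_Cartesian_Product.vec_eq_iff)
  have fhp: "form (d0 * 3) (\<lambda>x. h0 j (param x))" for j by (rule form_comp[OF fh0 form_param])
  obtain x0 where x0: "h0 j0 (param x0) \<noteq> 0" using vanish_param[OF fh0] j0 p0 by blast
  obtain D \<gamma> where D: "polyfun D" and pg: "\<And>j. polyfun (\<gamma> j)"
    and fac: "\<And>j x. h0 j (param x) = D x * \<gamma> j x"
    and prim: "\<And>h. (\<forall>j. polyfun (h j)) \<Longrightarrow> (\<forall>i j x. h i x * \<gamma> j x = h j x * \<gamma> i x) \<Longrightarrow>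
       \<exists>E. polyfun E \<and> (\<forall>j x. h j x = E x * \<gamma> j x)"
    using polyfun_primitive_part[of "\<lambda>j x. h0 j (param x)" j0 x0] form_imp_polyfun[OF fhp] x0 by blast
  have d0: "d0 \<ge> 0" using form_neg[OF fh0, of j0 p0] j0 by force
  have fhp': "form (int (nat (d0 * 3))) (\<lambda>x. h0 j (param x))" for j using fhp d0 by simp
  obtain dD where dD: "form (int dD) D"
    using form_factor[OF D pg fhp' fac[symmetric] x0] by blast
  have \<gamma>0: "\<gamma> j0 x0 \<noteq> 0" and D0: "D x0 \<noteq> 0" using x0 fac by auto
  define m where "m = d0 * 3 - int dD"
  have fg: "form m (\<gamma> j)" for j
  proof (cases "\<exists>x. \<gamma> j x \<noteq> 0")
    case True
    then obtain x where "D x * \<gamma> j x \<noteq> 0" using polyfun_mult_eq_0[OF D pg[of j]] D0 by blast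
    then have x: "h0 j (param x) \<noteq> 0" by (simp add: fac)
    have "\<gamma> j x * D x = h0 j (param x)" for x by (simp add: fac mult.commute)
    from form_factor[OF pg D fhp' this x] obtain e where e: "form (int e) (\<gamma> j)" by blast
    have "form (int dD + int e) (\<lambda>x. h0 j (param x))"
      unfolding fac using form_mult[OF dD e] .
    then have "int dD + int e = d0 * 3" using form_degree_unique[OF _ fhp x] by blast
    then have "int e = m" by (simp add: m_def)
    then show ?thesis using e by metis
  next
    case False
    then have "\<gamma> j = (\<lambda>_. 0)" by auto
    then show ?thesis by (simp add: form_zero)
  qed
  \<comment> \<open>\<open>good r\<close> says that \<open>q ^ r\<close> divides all
    \<open>\<gamma> j\<close> in the coordinate ring of the cubic. Each division lowers the degree
    by two, and in negative degree the tuple would vanish, so there is a largest such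
    \<open>r\<close>.\<close>
  define good where "good r \<longleftrightarrow> (\<exists>f. (\<forall>j. form (m - 2 * int r) (f j)) \<and>
     (\<forall>j x. P x = 0 \<longrightarrow> q (pr4 x) ^ r * f j x = \<gamma> j (pr4 x)))" for r
  have good0: "good 0" unfolding good_def
    by (rule exI[of _ "\<lambda>j x. \<gamma> j (pr4 x)"]) (auto intro: form_comp_pr4 fg)
  have bound: "r \<le> nat m" if gr: "good r" for r
  proof (rule ccontr)
    assume "\<not> r \<le> nat m"
    then have neg: "m - 2 * int r < 0" by linarith
    obtain f where f: "\<And>j. form (m - 2 * int r) (f j)"
       "\<And>j x. P x = 0 \<Longrightarrow> q (pr4 x) ^ r * f j x = \<gamma> j (pr4 x)" using gr unfolding good_def by blast
    have "q x ^ nat m * \<gamma> j0 x = 0" for x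
      using f(2)[OF P_param, of x j0] form_neg[OF f(1) neg] form_scale[OF fg[of j0], of "q x" x]
      by (simp add: param_def)
    then have "(\<forall>x. q x ^ nat m = 0) \<or> (\<forall>x. \<gamma> j0 x = 0)"
      by (intro polyfun_mult_eq_0 polyfun_power form_imp_polyfun[OF form_q] pg)
    then show False using \<gamma>0 q_nonzero by auto
  qed
  obtain r where r: "good r" and rmax: "\<And>s. good s \<Longrightarrow> s \<le> r"
    using good0 bound by (metis Nat.nat.distinct(1) Nat.ex_has_greatest_nat)
  obtain f where f: "\<And>j. form (m - 2 * int r) (f j)"
       and qf: "\<And>j x. P x = 0 \<Longrightarrow> q (pr4 x) ^ r * f j x = \<gamma> j (pr4 x)" using r unfolding good_def by blast
  have nf: "\<exists>j. \<not> (\<exists>f'. form (m - 2 * int r - 2) f' \<and> (\<forall>x. P x = 0 \<longrightarrow> f j x = q (pr4 x) * f' x))"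
  proof (rule ccontr)
    assume "\<not> ?thesis"
    then obtain f' where f': "\<And>j. form (m - 2 * int r - 2) (f' j)"
      "\<And>j x. P x = 0 \<Longrightarrow> f j x = q (pr4 x) * f' j x" by metis
    have "good (Suc r)" unfolding good_def
    proof (intro exI[of _ f'] conjI allI impI)
      fix j show "form (m - 2 * int (Suc r)) (f' j)" using f'(1)[of j] by (simp add: algebra_simps)
    next
      fix j x assume "P x = 0"
      then show "q (pr4 x) ^ Suc r * f' j x = \<gamma> j (pr4 x)"
        using qf[of x j] f'(2)[of x j] by (simp add: mult_ac)
    qed
    then show False using rmax[of "Suc r"] by simp
  qed
  have "(\<chi> j. f j w) \<noteq> 0 \<and> l w = vec.span {\<chi> j. f j w}" if w: "P w = 0" "w \<noteq> 0" for w
  proof -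
    obtain e H d h where L: "local_forms l w e H d h" using loc[OF w] by blast
    have fh: "form d (h j)" for j using L by (simp add: local_forms_def)
    have hw: "(\<chi> j. h j w) \<noteq> 0" "l w = vec.span {\<chi> j. h j w}" using L w by (auto simp: local_forms_def)
    then obtain j1 where j1: "h j1 w \<noteq> 0" by (auto simp: Finite_Cartesian_Product.vec_eq_iff)
    have d: "d \<ge> 0" using form_neg[OF fh, of j1 w] j1 by force
    have fhp2: "form (d * 3) (\<lambda>x. h j (param x))" for j by (rule form_comp[OF fh form_param])
    have "h i (param x) * \<gamma> j x = h j (param x) * \<gamma> i x" for i j x
    proof (rule polyfun_cancel[of D "\<lambda>x. h i (param x) * \<gamma> j x" "\<lambda>x. h j (param x) * \<gamma> i x" x0])
      show "D x * (h i (param x) * \<gamma> j x) = D x * (h j (param x) * \<gamma> i x)" for x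
        using local_forms_cross[OF L w(1) L0 p0(1) P_param, of i x j] by (simp add: fac mult_ac)
    qed (auto intro!: polyfun_mult pg D D0 form_imp_polyfun[OF fhp2])
    then obtain E where E: "polyfun E" "\<And>j x. h j (param x) = E x * \<gamma> j x"
      using prim[of "\<lambda>j x. h j (param x)"] form_imp_polyfun[OF fhp2] by blast
    obtain x1 where x1: "h j1 (param x1) \<noteq> 0" using vanish_param[OF fh] j1 w by blast
    have fhp2': "form (int (nat (d * 3))) (\<lambda>x. h j (param x))" for j using fhp2 d by simp
    obtain dE where dE: "form (int dE) E" using form_factor[OF E(1) pg fhp2' E(2)[symmetric] x1] by blast
    \<comment> \<open>\<open>h\<close> is a multiple of \<open>f\<close> up to the denominator
      \<open>q ^ s\<close>. The identity \<open>param_pr4\<close> provides \<open>s = nat d\<close>.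
      Since some \<open>f j\<close> is not divisible by the prime \<open>q\<close>, a factor
      \<open>q\<close> can always be taken out of \<open>a\<close>, and \<open>s\<close> drops to
      zero.\<close>
    define step where "step s \<longleftrightarrow> (\<exists>a. form (2 * int s + d - (m - 2 * int r)) a \<and> (\<forall>j x. P x = 0 \<longrightarrow> q (pr4 x) ^ s * h j x = a x * f j x))" for s
    have "form (int dE + m) (\<lambda>x. h j1 (param x))" unfolding E(2) by (rule form_mult[OF dE fg])
    then have deg: "int dE + m = d * 3" using form_degree_unique[OF _ fhp2 x1] by blast
    have "step (nat d)" unfolding step_def
    proof (intro exI conjI allI impI)
      have "form (int dE + int r * 2) (\<lambda>x. E (pr4 x) * q (pr4 x) ^ r)"
        by (intro form_mult form_power form_comp_pr4 dE form_q)
      then show "form (2 * int (nat d) + d - (m - 2 * int r)) (\<lambda>x. E (pr4 x) * q (pr4 x) ^ r)"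
        by (rule form_cong) (use deg d in auto)
      fix j x assume x: "P x = 0"
      show "q (pr4 x) ^ nat d * h j x = E (pr4 x) * q (pr4 x) ^ r * f j x"
        using E(2)[of j "pr4 x"] qf[OF x, of j] unfolding param_pr4[OF x] form_scale[OF fh]
        by (simp add: mult_ac)
    qed
    then obtain s where s: "step s" and smin: "\<And>s'. step s' \<Longrightarrow> s \<le> s'"
      by (metis LeastI Least_le)
    have "s = 0"
    proof (rule ccontr)
      assume "s \<noteq> 0"
      then obtain s' where s': "s = Suc s'" by (cases s) auto
      define n where "n = 2 * int s + d - (m - 2 * int r)"
      obtain a where a: "form n a" "\<And>j x. P x = 0 \<Longrightarrow> q (pr4 x) ^ s * h j x = a x * f j x"
        using s unfolding step_def n_def by blast
      obtain j where nj: "\<not> (\<exists>f'. form (m - 2 * int r - 2) f' \<and> (\<forall>x. P x = 0 \<longrightarrow> f j x = q (pr4 x) * f' x))"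
        using nf by blast
      have "a x * f j x = q (pr4 x) * (q (pr4 x) ^ s' * h j x)" if "P x = 0" for x
        using a(2)[OF that, of j] by (simp add: s' mult.assoc)
      from q_prime[OF a(1) f this] nj obtain a' where a': "form (n - 2) a'"
        "\<And>x. P x = 0 \<Longrightarrow> a x = q (pr4 x) * a' x" by blast
      have "q (pr4 x) ^ s' * h j x = a' x * f j x" if x: "P x = 0" for j x
      proof -
        have "form (int s' * 2 + d) (\<lambda>x. q (pr4 x) ^ s' * h j x)"
          by (intro form_mult form_power form_comp_pr4 form_q fh)
        moreover have "form (n - 2 + (m - 2 * int r)) (\<lambda>x. a' x * f j x)" by (intro form_mult a' f)
        ultimately have "form (int s' * 2 + d) (\<lambda>x. q (pr4 x) ^ s' * h j x - a' x * f j x)"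
          by (intro form_diff) (simp_all add: n_def s' add.commute mult.commute)
        from irreducible_P[OF form_comp_pr4[OF form_q] this]
        have "(\<forall>x. P x = 0 \<longrightarrow> q (pr4 x) = 0) \<or> (\<forall>x. P x = 0 \<longrightarrow> q (pr4 x) ^ s' * h j x - a' x * f j x = 0)"
          using a(2)[of _ j] a'(2) by (simp add: s' algebra_simps)
        moreover obtain y where "q y \<noteq> 0" using q_nonzero by blast
        then have "q (pr4 (param y)) \<noteq> 0" by (simp add: param_def q_scale)
        ultimately show ?thesis using x P_param by auto
      qed
      moreover have "form (2 * int s' + d - (m - 2 * int r)) a'"
        using a'(1) by (simp add: n_def s' algebra_simps)
      ultimately have "step s'" unfolding step_def by blast
      then show False using smin[of s'] s' by simp
    qed
    then obtain a where a: "\<And>j x. P x = 0 \<Longrightarrow> h j x = a x * f j x"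
      using s unfolding step_def by auto
    \<comment> \<open>With no denominator left, \<open>f\<close> cannot vanish at \<open>w\<close>
      because \<open>h\<close> does not: this excludes common zeros.\<close>
    have hv: "(\<chi> j. h j w) = a w *s (\<chi> j. f j w)"
      using a[OF w(1)] by (simp add: Finite_Cartesian_Product.vec_eq_iff)
    then have "a w \<noteq> 0" "(\<chi> j. f j w) \<noteq> 0" using hw(1) by auto
    then show ?thesis using hw(2) hv span_scale by metis
  qed
  then show ?thesis using f by blast
qed

end

section \<open>Linearity of automorphisms\<close>

lemma mult_vec_axis_sum:
  fixes A :: "'k::field ^ 'n::finite ^ 'm::finite"
  shows "A *v x = (\<Sum>i\<in>UNIV. x $ i *s (A *v axis i 1))"
  by (simp add: Finite_Cartesian_Product.vec_eq_iff matrix_vector_mult_basis column_def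
      matrix_vector_mult_def mult.commute axis_def if_distrib cong: if_cong)

lemma invertible_iff_kernel:
  fixes A :: "'k::field ^ 'n::finite ^ 'n"
  shows "invertible A \<longleftrightarrow> (\<forall>x. A *v x = 0 \<longrightarrow> x = 0)"
  by (simp add: invertible_left_inverse matrix_left_invertible_ker)

context factorial_cubic
begin

lemma linear_automorphism:
  assumes loc: "\<And>p. P p = 0 \<Longrightarrow> p \<noteq> 0 \<Longrightarrow> \<exists>e H d h. local_forms l p e H d h"
    and loc': "\<And>p. P p = 0 \<Longrightarrow> p \<noteq> 0 \<Longrightarrow> \<exists>e H d h. local_forms l' p e H d h"
    and inverse: "\<And>w u. P w = 0 \<Longrightarrow> w \<noteq> 0 \<Longrightarrow> u \<noteq> 0 \<Longrightarrow> l w = vec.span {u} \<Longrightarrow> P u = 0 \<and> l' u = vec.span {w}"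
  shows "\<exists>A t. invertible A \<and> (\<forall>w. P w = 0 \<longrightarrow> w \<noteq> 0 \<longrightarrow> l w = vec.span {A *v w}) \<and> (\<forall>x. P (A *v x) = t * P x)"
proof -
  obtain d f where f: "\<And>j :: 5. form d (f j)"
    and fl: "\<And>w. P w = 0 \<Longrightarrow> w \<noteq> 0 \<Longrightarrow> (\<chi> j. f j w) \<noteq> 0 \<and> l w = vec.span {\<chi> j. f j w}"
    using global_forms[OF loc] by blast
  obtain d' f' where f': "\<And>j :: 5. form d' (f' j)"
    and fl': "\<And>w. P w = 0 \<Longrightarrow> w \<noteq> 0 \<Longrightarrow> (\<chi> j. f' j w) \<noteq> 0 \<and> l' w = vec.span {\<chi> j. f' j w}"
    using global_forms[OF loc'] by blast
  define \<phi> where "\<phi> w = (\<chi> j. f j w)" for w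
  define \<psi> where "\<psi> w = (\<chi> j. f' j w)" for w
  have comp: "\<exists>t. t \<noteq> 0 \<and> \<psi> (\<phi> w) = t *s w" if w: "P w = 0" "w \<noteq> 0" for w
  proof -
    have 1: "\<phi> w \<noteq> 0" "l w = vec.span {\<phi> w}" using fl[OF w] by (auto simp: \<phi>_def)
    then have 2: "P (\<phi> w) = 0" "l' (\<phi> w) = vec.span {w}" using inverse[OF w] by auto
    then have "\<psi> (\<phi> w) \<noteq> 0" "vec.span {\<psi> (\<phi> w)} = vec.span {w}" using fl'[OF 2(1) 1(1)] by (auto simp: \<psi>_def)
    then show ?thesis using span_eq_imp_scale by blast
  qed
  have ax: "P (axis i 1) = 0" "axis i 1 \<noteq> (0 :: 'k ^ 5)" for i by (auto simp: P_axis axis_eq_0_iff)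
  have deg: "d \<ge> 0" "d' \<ge> 0"
  proof -
    have "(\<chi> j. f j (axis 1 1)) \<noteq> 0" "(\<chi> j. f' j (axis 1 1)) \<noteq> 0" using fl[OF ax] fl'[OF ax] by blast+
    then obtain j j' where j: "f j (axis 1 1) \<noteq> 0" "f' j' (axis 1 1) \<noteq> 0"
      unfolding Finite_Cartesian_Product.vec_eq_iff by auto
    show "d \<ge> 0" using form_neg[OF f, of j "axis 1 1"] j by linarith
    show "d' \<ge> 0" using form_neg[OF f', of j' "axis 1 1"] j by linarith
  qed
  \<comment> \<open>The line through \<open>axis 1 1\<close> and \<open>axis 2 1\<close> lies on the
    cubic, since every monomial of \<open>P\<close> involves three distinct coordinates.\<close>
  define r where "r p = mk5 (p $ 1) (p $ 2) 0 0 0" for p :: "'k ^ 2"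
  have r: "form 1 (\<lambda>p. r p $ i)" for i unfolding r_def by (intro form_mk5 form_proj form_zero)
  have Pr: "P (r p) = 0" for p by (simp add: P_def q_def c_def r_def)
  have r0: "r p \<noteq> 0" if "p \<noteq> 0" for p
    using that by (auto simp: r_def vec_eq_5 Finite_Cartesian_Product.vec_eq_iff forall_2)
  define g where "g j p = \<psi> (\<phi> (r p)) $ j" for j and p :: "'k ^ 2"
  have g: "form (d' * d) (g j)" for j
  proof -
    have "form (d' * d) (\<lambda>x. f' j (\<phi> x))" by (rule form_comp[OF f']) (simp add: \<phi>_def f)
    from form_comp1[OF this r] show ?thesis by (simp add: g_def[abs_def] \<psi>_def)
  qed
  have gr: "\<exists>t. t \<noteq> 0 \<and> g 1 p = t * p $ 1 \<and> g 2 p = t * p $ 2" if "p \<noteq> 0" for p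
    using comp[OF Pr r0[OF that]] by (auto simp: g_def r_def)
  have g10: "g 1 (zero_at 1 p) = 0" for p
  proof (rule polyfun_cancel[of "\<lambda>p. p $ 2" "\<lambda>p. g 1 (zero_at 1 p)" "\<lambda>_. 0" "\<chi> _. 1"])
    fix p :: "'k ^ 2"
    show "p $ 2 * g 1 (zero_at 1 p) = p $ 2 * 0"
      using gr[of "zero_at 1 p"] by (cases "zero_at 1 p = 0") (auto simp: Finite_Cartesian_Product.vec_eq_iff forall_2)
  qed (auto intro: polyfun_proj polyfun_const form_imp_polyfun[OF form_comp_zero_at[OF g]])
  obtain H where H: "form (d' * d - 1) H" "\<And>p. g 1 p = p $ 1 * H p"
    using form_dvd_proj[OF g g10] by blast
  have H2: "g 2 p = p $ 2 * H p" for p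
  proof (rule polyfun_cancel[of "\<lambda>p. p $ 1" "g 2" "\<lambda>p. p $ 2 * H p" "\<chi> _. 1"])
    fix p :: "'k ^ 2"
    show "p $ 1 * g 2 p = p $ 1 * (p $ 2 * H p)"
      using gr[of p] H(2)[of p] by (cases "p = 0") (auto simp: algebra_simps)
  qed (auto intro: polyfun_proj polyfun_mult form_imp_polyfun[OF g] form_imp_polyfun[OF H(1)])
  \<comment> \<open>On this line \<open>\<psi>\<close> after \<open>\<phi>\<close> multiplies the
    two coordinates by the binary form \<open>H\<close> of degree \<open>d' * d - 1\<close>. Having
    no zero, it has degree zero.\<close>
  have "H p \<noteq> 0" if "p \<noteq> 0" for p
    using gr[OF that] H(2)[of p] H2[of p] that by (auto simp: Finite_Cartesian_Product.vec_eq_iff forall_2)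
  then have "d' * d = 1" using binary_form_zero_free[OF H(1)] by simp
  then have d1: "d = 1" "d' = 1" using deg zmult_eq_1_iff[of d' d] by auto
  have l1: "\<forall>j. \<exists>a. \<forall>x. f j x = (\<Sum>i\<in>UNIV. a $ i * x $ i)" using form_1_linear[OF f d1(1)] by blast
  have l2: "\<forall>j. \<exists>a. \<forall>x. f' j x = (\<Sum>i\<in>UNIV. a $ i * x $ i)" using form_1_linear[OF f' d1(2)] by blast
  from choice[OF l1] obtain a where a: "\<forall>j x. f j x = (\<Sum>i\<in>UNIV. a j $ i * x $ i)" by (rule exE)
  from choice[OF l2] obtain a' where a': "\<forall>j x. f' j x = (\<Sum>i\<in>UNIV. a' j $ i * x $ i)" by (rule exE)
  define A where "A = (\<chi> j. a j)"
  define A' where "A' = (\<chi> j. a' j)"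
  have A: "\<phi> x = A *v x" and A': "\<psi> x = A' *v x" for x
    by (simp_all add: \<phi>_def \<psi>_def A_def A'_def a a' matrix_vector_mult_def Finite_Cartesian_Product.vec_eq_iff)
  have "\<forall>i. \<exists>t. t \<noteq> 0 \<and> A' *v (A *v axis i 1) = t *s axis i 1" using comp[OF ax] by (simp add: A A')
  from choice[OF this] obtain t where "\<forall>i. t i \<noteq> 0 \<and> A' *v (A *v axis i 1) = t i *s axis i 1" by (rule exE)
  then have t: "\<And>i. t i \<noteq> 0" "\<And>i. A' *v (A *v axis i 1) = t i *s axis i 1" by blast+
  have "x = 0" if "A *v x = 0" for x
  proof -
    have "(A' ** A) *v x = 0" using that by (simp add: matrix_vector_mul_assoc[symmetric])
    then have "(\<Sum>i\<in>UNIV. x $ i *s (t i *s axis i 1)) = 0"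
      using mult_vec_axis_sum[of "A' ** A" x] t(2) by (simp add: matrix_vector_mul_assoc[symmetric])
    then have "x $ j * t j = 0" for j
      by (simp add: Finite_Cartesian_Product.vec_eq_iff axis_def if_distrib cong: if_cong)
    then show ?thesis using t(1) by (simp add: Finite_Cartesian_Product.vec_eq_iff)
  qed
  then have inv: "invertible A" using invertible_iff_kernel by blast
  have Pl: "P (A *v w) = 0" if "P w = 0" for w
  proof (cases "w = 0")
    case True then show ?thesis using form_at_0[OF form_P] by simp
  next
    case False
    then have "A *v w \<noteq> 0" "l w = vec.span {A *v w}" using fl[OF that False] A by (auto simp: \<phi>_def)
    then show ?thesis using inverse[OF that False] by blast
  qed
  \<comment> \<open>\<open>P\<close> composed with \<open>A\<close> vanishes on the cubic, so it is
    divisible by \<open>P\<close>, with a quotient of degree zero.\<close>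
  have "form 3 (\<lambda>x. P (A *v x))" by (rule form_comp1[OF form_P form_linear])
  from vanish_param_dvd[OF this] obtain k where "form (3 - 3) k" "\<And>x. P (A *v x) = P x * k x"
    using Pl[OF P_param] by blast
  moreover obtain s where "\<And>x. k x = s" using form_0_const[OF calculation(1)] by auto
  ultimately have "\<forall>x. P (A *v x) = s * P x" by simp
  moreover have "\<forall>w. P w = 0 \<longrightarrow> w \<noteq> 0 \<longrightarrow> l w = vec.span {A *v w}" using fl A by (auto simp: \<phi>_def)
  ultimately show ?thesis using inv by blast
qed

end

section \<open>Cubics with nodes at the coordinate points\<close>

lemma UNIV_5_distinct:
  assumes "distinct [i, j, k, l, m :: 5]"
  shows "UNIV = {i, j, k, l, m}"
proof -
  have "card {i, j, k, l, m} = 5" using assms by auto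
  moreover have "card (UNIV :: 5 set) = 5" by simp
  ultimately show ?thesis by (intro card_subset_eq[symmetric]) auto
qed

lemma sum_5_distinct:
  assumes "distinct [i, j, k, l, m :: 5]"
  shows "sum f UNIV = f i + f j + f k + f l + f m"
  using assms unfolding UNIV_5_distinct[OF assms] by (auto simp: ac_simps)

definition node_disc :: "'k::field \<Rightarrow> 'k \<Rightarrow> 'k \<Rightarrow> 'k" where
  "node_disc p q r = p\<^sup>2 + q\<^sup>2 + r\<^sup>2 - 2 * p * q - 2 * p * r - 2 * q * r"

text \<open>\<^const>\<open>node_disc\<close> is the determinant of the symmetric matrix with zero diagonal whose entries
  above the diagonal are \<open>a, b, c, d, e, f\<close>.\<close>

lemma node_disc_kernel:
  fixes a :: "'k::field_char_0"
  assumes rows: "a * y2 + b * y3 + c * y4 = 0" "a * y1 + d * y3 + e * y4 = 0"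
    "b * y1 + d * y2 + f * y4 = 0" "c * y1 + e * y2 + f * y3 = 0"
    and nz: "d \<noteq> 0" "e \<noteq> 0" "f \<noteq> 0" and D: "node_disc (a * f) (b * e) (c * d) \<noteq> 0"
  shows "y1 = 0" "y2 = 0" "y3 = 0" "y4 = 0"
proof -
  \<comment> \<open>The coefficients are the first row of the adjugate matrix.\<close>
  have "node_disc (a * f) (b * e) (c * d) * y1 = 2 * d * e * f * (a * y2 + b * y3 + c * y4)
     + f * (a * f - b * e - c * d) * (a * y1 + d * y3 + e * y4)
     + e * (b * e - a * f - c * d) * (b * y1 + d * y2 + f * y4)
     + d * (c * d - a * f - b * e) * (c * y1 + e * y2 + f * y3)"
    by (simp add: node_disc_def algebra_simps power2_eq_square)
  then have "node_disc (a * f) (b * e) (c * d) * y1 = 0" unfolding rows by simp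
  then show 1: "y1 = 0" using D by simp
  have "2 * d * e * y2 = e * (b * y1 + d * y2 + f * y4) + d * (c * y1 + e * y2 + f * y3) - f * (a * y1 + d * y3 + e * y4)"
    by (simp add: 1 algebra_simps)
  then have "2 * d * e * y2 = 0" unfolding rows by simp
  then show 2: "y2 = 0" using nz by simp
  show "y4 = 0" using rows(3) nz 1 2 by simp
  show "y3 = 0" using rows(4) nz 1 2 by simp
qed

text \<open>The coefficients of a polarized cubic whose nodes are the coordinate points: \<open>nondegenerate\<close> says
  that these points are nodes, and \<open>no_sixth\<close> that they are the only singular points.\<close>

locale node_coeffs =
  fixes a :: "5 \<Rightarrow> 5 \<Rightarrow> 5 \<Rightarrow> 'k::{alg_closed_field,field_char_0}"
  assumes sym1: "a i j k = a j i k" and sym2: "a i j k = a i k j" and diag: "a i i k = 0"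
    and nondegenerate: "(\<And>j. (\<Sum>k\<in>UNIV. y $ k * a i j k) = 0) \<Longrightarrow> k \<noteq> i \<Longrightarrow> y $ k = 0"
    and no_sixth: "(\<And>k. (\<Sum>i\<in>UNIV. \<Sum>j\<in>UNIV. x $ i * x $ j * a i j k) = 0) \<Longrightarrow> \<exists>i. \<forall>j. j \<noteq> i \<longrightarrow> x $ j = 0"
begin

lemma diag': "a i k i = 0" "a k i i = 0"
  using diag sym1 sym2 by metis+

lemma nondegenerate_6:
  assumes d: "distinct [i, j, k, l, m]"
    and rows: "y2 * a i j k + y3 * a i j l + y4 * a i j m = 0" "y1 * a i j k + y3 * a i k l + y4 * a i k m = 0"
     "y1 * a i j l + y2 * a i k l + y4 * a i l m = 0" "y1 * a i j m + y2 * a i k m + y3 * a i l m = 0"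
  shows "y1 = 0 \<and> y2 = 0 \<and> y3 = 0 \<and> y4 = 0"
proof -
  define y :: "'k ^ 5" where "y = (\<chi> t. if t = j then y1 else if t = k then y2 else if t = l then y3 else if t = m then y4 else 0)"
  have ys: "y $ i = 0" "y $ j = y1" "y $ k = y2" "y $ l = y3" "y $ m = y4" using d by (auto simp: y_def)
  have s: "a i k j = a i j k" "a i l j = a i j l" "a i m j = a i j m" "a i l k = a i k l" "a i m k = a i k m" "a i m l = a i l m"
    using sym2 by metis+
  have "(\<Sum>t\<in>UNIV. y $ t * a i u t) = 0" for u
  proof -
    have "u \<in> {i, j, k, l, m}" using UNIV_5_distinct[OF d] by blast
    then show ?thesis unfolding sum_5_distinct[OF d]
      using rows by (elim insertE emptyE) (auto simp: ys s diag diag')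
  qed
  from nondegenerate[of y, OF this] show ?thesis using ys d by (metis distinct_length_2_or_more)
qed

text \<open>The equations are the partial derivatives of the cubic up to a constant factor, and two
  nonzero coordinates distinguish the point from the coordinate points. The free labelling lets one
  argument serve for all nodes.\<close>

lemma no_sixth_5:
  assumes d: "distinct [i, j, k, l, m]"
    and eqs: "x2 * x3 * a i j k + x2 * x4 * a i j l + x2 * x5 * a i j m + x3 * x4 * a i k l + x3 * x5 * a i k m + x4 * x5 * a i l m = 0"
     "x1 * x3 * a i j k + x1 * x4 * a i j l + x1 * x5 * a i j m + x3 * x4 * a j k l + x3 * x5 * a j k m + x4 * x5 * a j l m = 0"
     "x1 * x2 * a i j k + x1 * x4 * a i k l + x1 * x5 * a i k m + x2 * x4 * a j k l + x2 * x5 * a j k m + x4 * x5 * a k l m = 0"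
     "x1 * x2 * a i j l + x1 * x3 * a i k l + x1 * x5 * a i l m + x2 * x3 * a j k l + x2 * x5 * a j l m + x3 * x5 * a k l m = 0"
     "x1 * x2 * a i j m + x1 * x3 * a i k m + x1 * x4 * a i l m + x2 * x3 * a j k m + x2 * x4 * a j l m + x3 * x4 * a k l m = 0"
    and nz: "x1 \<noteq> 0" "x2 \<noteq> 0"
  shows False
proof -
  define x :: "'k ^ 5" where "x = (\<chi> t. if t = i then x1 else if t = j then x2 else if t = k then x3 else if t = l then x4 else x5)"
  have xs: "x $ i = x1" "x $ j = x2" "x $ k = x3" "x $ l = x4" "x $ m = x5" using d by (auto simp: x_def)
  have s: "a p q r = a q p r" "a p q r = a p r q" "a p q r = a r p q" "a p q r = a q r p" "a p q r = a r q p" for p q r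
    using sym1 sym2 by metis+
  have S: "a j i k = a i j k" "a j i l = a i j l" "a j i m = a i j m" "a i k j = a i j k" "a i l j = a i j l" "a i m j = a i j m"
    "a k i j = a i j k" "a l i j = a i j l" "a m i j = a i j m" "a j k i = a i j k" "a j l i = a i j l" "a j m i = a i j m"
    "a k j i = a i j k" "a l j i = a i j l" "a m j i = a i j m"
    "a k i l = a i k l" "a k i m = a i k m" "a i l k = a i k l" "a i m k = a i k m" "a l i k = a i k l" "a m i k = a i k m"
    "a k l i = a i k l" "a k m i = a i k m" "a l k i = a i k l" "a m k i = a i k m"
    "a l i m = a i l m" "a i m l = a i l m" "a m i l = a i l m" "a l m i = a i l m" "a m l i = a i l m"
    "a k j l = a j k l" "a j l k = a j k l" "a l j k = a j k l" "a k l j = a j k l" "a l k j = a j k l"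
    "a k j m = a j k m" "a j m k = a j k m" "a m j k = a j k m" "a k m j = a j k m" "a m k j = a j k m"
    "a l j m = a j l m" "a j m l = a j l m" "a m j l = a j l m" "a l m j = a j l m" "a m l j = a j l m"
    "a l k m = a k l m" "a k m l = a k l m" "a m k l = a k l m" "a l m k = a k l m" "a m l k = a k l m"
    by (fact s)+
  have "(\<Sum>p\<in>UNIV. \<Sum>q\<in>UNIV. x $ p * x $ q * a p q u) = 0" for u
  proof -
    have "u \<in> {i, j, k, l, m}" using UNIV_5_distinct[OF d] by blast
    then show ?thesis
    proof (elim insertE emptyE)
      assume u: "u = i"
      have "(\<Sum>p\<in>UNIV. \<Sum>q\<in>UNIV. x $ p * x $ q * a p q u) = 2 * (x2 * x3 * a i j k + x2 * x4 * a i j l + x2 * x5 * a i j m + x3 * x4 * a i k l + x3 * x5 * a i k m + x4 * x5 * a i l m)"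
        unfolding u sum_5_distinct[OF d] xs by (simp add: S diag diag' algebra_simps)
      then show ?thesis using eqs(1) by simp
    next
      assume u: "u = j"
      have "(\<Sum>p\<in>UNIV. \<Sum>q\<in>UNIV. x $ p * x $ q * a p q u) = 2 * (x1 * x3 * a i j k + x1 * x4 * a i j l + x1 * x5 * a i j m + x3 * x4 * a j k l + x3 * x5 * a j k m + x4 * x5 * a j l m)"
        unfolding u sum_5_distinct[OF d] xs by (simp add: S diag diag' algebra_simps)
      then show ?thesis using eqs(2) by simp
    next
      assume u: "u = k"
      have "(\<Sum>p\<in>UNIV. \<Sum>q\<in>UNIV. x $ p * x $ q * a p q u) = 2 * (x1 * x2 * a i j k + x1 * x4 * a i k l + x1 * x5 * a i k m + x2 * x4 * a j k l + x2 * x5 * a j k m + x4 * x5 * a k l m)"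
        unfolding u sum_5_distinct[OF d] xs by (simp add: S diag diag' algebra_simps)
      then show ?thesis using eqs(3) by simp
    next
      assume u: "u = l"
      have "(\<Sum>p\<in>UNIV. \<Sum>q\<in>UNIV. x $ p * x $ q * a p q u) = 2 * (x1 * x2 * a i j l + x1 * x3 * a i k l + x1 * x5 * a i l m + x2 * x3 * a j k l + x2 * x5 * a j l m + x3 * x5 * a k l m)"
        unfolding u sum_5_distinct[OF d] xs by (simp add: S diag diag' algebra_simps)
      then show ?thesis using eqs(4) by simp
    next
      assume u: "u = m"
      have "(\<Sum>p\<in>UNIV. \<Sum>q\<in>UNIV. x $ p * x $ q * a p q u) = 2 * (x1 * x2 * a i j m + x1 * x3 * a i k m + x1 * x4 * a i l m + x2 * x3 * a j k m + x2 * x4 * a j l m + x3 * x4 * a k l m)"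
        unfolding u sum_5_distinct[OF d] xs by (simp add: S diag diag' algebra_simps)
      then show ?thesis using eqs(5) by simp
    qed
  qed
  from no_sixth[OF this] obtain t where t: "\<And>j. j \<noteq> t \<Longrightarrow> x $ j = 0" by blast
  have "t = i" "t = j" using t[of i] t[of j] xs nz by auto
  then show False using d by simp
qed

text \<open>If the plane through three nodes lies on the cubic, the two conics cut out on it by the partial
  derivatives meet in a fourth point, a sixth singular point of the cubic.\<close>

lemma minor_nonzero:
  assumes d: "distinct [i, j, k, l, m]" and 0: "a i j k = 0"
  shows "a i j l * a i k m - a i j m * a i k l \<noteq> 0"
proof
  assume e: "a i j l * a i k m - a i j m * a i k l = 0"
  \<comment> \<open>The four numbers form a kernel vector of the Hessian at the node
    \<open>i\<close>. Once all entries of the minor vanish, the unit vector in direction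
    \<open>j\<close> lies in the kernel too, which is absurd.\<close>
  have 1: "a i k l = 0 \<and> - a i j l = 0 \<and> (0::'k) = 0 \<and> (0::'k) = 0"
    by (rule nondegenerate_6[OF d]) (use e 0 in \<open>auto simp: algebra_simps\<close>)
  have 2: "a i k m = 0 \<and> - a i j m = 0 \<and> (0::'k) = 0 \<and> (0::'k) = 0"
    by (rule nondegenerate_6[OF d]) (use e 0 1 in \<open>auto simp: algebra_simps\<close>)
  have "(1::'k) = 0 \<and> (0::'k) = 0 \<and> (0::'k) = 0 \<and> (0::'k) = 0"
    by (rule nondegenerate_6[OF d]) (use 0 1 2 in auto)
  then show False by simp
qed

lemma a_nonzero:
  assumes d: "distinct [i, j, k, l, m]"
  shows "a i j k \<noteq> 0"
proof
  assume 0: "a i j k = 0"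
  have s: "a j i l = a i j l" "a j i m = a i j m" "a k i l = a i k l" "a k i m = a i k m" "a k j l = a j k l" "a k j m = a j k m"
    using sym1 by auto
  have z: "a j i k = 0" "a k i j = 0" using 0 sym1 sym2 by metis+
  \<comment> \<open>The cross product of the coefficient vectors of the two conics, the partial
    derivatives in the directions \<open>l\<close> and \<open>m\<close>. The singular point has
    inverse coordinates proportional to \<open>y1\<close>, \<open>y2\<close>, \<open>y3\<close>; the
    products of two of its coordinates are then proportional to \<open>y3\<close>,
    \<open>y2\<close>, \<open>y1\<close>.\<close>
  define y1 where "y1 = a i k l * a i j m - a i j l * a i k m"
  define y2 where "y2 = a i j l * a j k m - a j k l * a i j m"
  define y3 where "y3 = a j k l * a i k m - a i k l * a j k m"
  have d': "distinct [j, i, k, l, m]" "distinct [k, i, j, l, m]" using d by auto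
  have nz: "y1 \<noteq> 0" "y2 \<noteq> 0" "y3 \<noteq> 0"
    using minor_nonzero[OF d 0] minor_nonzero[OF d'(1) z(1)] minor_nonzero[OF d'(2) z(2)]
    by (auto simp: y1_def y2_def y3_def s mult.commute)
  have "y3 * a i j u + y2 * a i k u + y1 * a j k u = 0" if "u = l \<or> u = m" for u
    using that by (elim disjE) (simp_all add: y1_def y2_def y3_def algebra_simps)
  moreover have "y2 * y3 * (y1 * y3) * a i j u + y2 * y3 * (y1 * y2) * a i k u + y1 * y3 * (y1 * y2) * a j k u
      = y1 * y2 * y3 * (y3 * a i j u + y2 * a i k u + y1 * a j k u)" for u
    by (simp add: algebra_simps)
  ultimately have E: "y2 * y3 * (y1 * y3) * a i j u + y2 * y3 * (y1 * y2) * a i k u + y1 * y3 * (y1 * y2) * a j k u = 0"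
    if "u = l \<or> u = m" for u using that by simp
  show False
    by (rule no_sixth_5[OF d, where ?x1.0 = "y2 * y3" and ?x2.0 = "y1 * y3" and ?x3.0 = "y1 * y2" and ?x4.0 = 0 and ?x5.0 = 0])
       (use nz 0 E in simp_all)
qed

text \<open>In the coordinates other than \<open>i\<close> the Hessian at the node \<open>i\<close>
  is, up to a constant, a symmetric matrix with zero diagonal and determinant
  \<open>node_disc\<close>. If it vanished, the first column of the adjugate would be a kernel
  vector, and its first entry is a product of nonzero coefficients.\<close>

lemma node_disc_nonzero:
  assumes d: "distinct [i, j, k, l, m]"
  shows "node_disc (a i j k * a i l m) (a i j l * a i k m) (a i j m * a i k l) \<noteq> 0"
proof
  assume D: "node_disc (a i j k * a i l m) (a i j l * a i k m) (a i j m * a i k l) = 0"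
  define p q r where "p = a i j k * a i l m" and "q = a i j l * a i k m" and "r = a i j m * a i k l"
  have "2 * a i k l * a i k m * a i l m = 0 \<and> a i l m * (p - q - r) = 0 \<and> a i k m * (q - p - r) = 0 \<and> a i k l * (r - p - q) = 0"
  proof (rule nondegenerate_6[OF d])
    have "a i l m * (p - q - r) * a i j k + a i k m * (q - p - r) * a i j l + a i k l * (r - p - q) * a i j m = node_disc p q r"
      by (simp add: node_disc_def p_def q_def r_def algebra_simps power2_eq_square)
    then show "a i l m * (p - q - r) * a i j k + a i k m * (q - p - r) * a i j l + a i k l * (r - p - q) * a i j m = 0"
      using D by (simp add: p_def q_def r_def)
  qed (simp_all add: p_def q_def r_def algebra_simps)
  moreover have "a i k l \<noteq> 0" "a i k m \<noteq> 0" "a i l m \<noteq> 0"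
    using a_nonzero[of i k l j m] a_nonzero[of i k m j l] a_nonzero[of i l m j k] d by auto
  ultimately show False by simp
qed

end

section \<open>Parametrizing a smooth plane conic\<close>

lemma form_mk3:
  assumes "form d f1" "form d f2" "form d f3"
  shows "form d (\<lambda>x. mk3 (f1 x) (f2 x) (f3 x) $ i)"
  using exhaust_3[of i] assms by (elim disjE) simp_all

text \<open>The square of the last determinant is four times
  \<open>\<beta>^2 - \<alpha> * \<gamma>\<close>, so the two linear factors of the quadric are
  independent.\<close>

lemma binary_quadric_factor:
  fixes \<alpha> \<beta> \<gamma> :: "'k::{alg_closed_field,field_char_0}"
  assumes "\<beta>\<^sup>2 \<noteq> \<alpha> * \<gamma>"
  shows "\<exists>u1 u2 w1 w2. u1 * w1 = \<alpha> \<and> u1 * w2 + u2 * w1 = 2 * \<beta> \<and> u2 * w2 = \<gamma> \<and> u1 * w2 - u2 * w1 \<noteq> 0"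
proof -
  have "\<exists>u1 u2 w1 w2. u1 * w1 = \<alpha> \<and> u1 * w2 + u2 * w1 = 2 * \<beta> \<and> u2 * w2 = \<gamma>"
  proof (cases "\<alpha> = 0")
    case True
    then show ?thesis by (intro exI[of _ 0] exI[of _ 1] exI[of _ "2 * \<beta>"] exI[of _ \<gamma>]) auto
  next
    case False
    obtain \<delta> where \<delta>: "\<delta>\<^sup>2 = \<beta>\<^sup>2 - \<alpha> * \<gamma>" using sqrt_exists by blast
    have "(\<beta> + \<delta>) / \<alpha> * (\<beta> - \<delta>) = (\<beta>\<^sup>2 - \<delta>\<^sup>2) / \<alpha>" by (simp add: algebra_simps power2_eq_square)
    also have "\<dots> = \<gamma>" using False by (simp add: \<delta>)
    finally show ?thesis using False
      by (intro exI[of _ 1] exI[of _ "(\<beta> + \<delta>) / \<alpha>"] exI[of _ \<alpha>] exI[of _ "\<beta> - \<delta>"]) auto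
  qed
  then obtain u1 u2 w1 w2 where u: "u1 * w1 = \<alpha>" "u1 * w2 + u2 * w1 = 2 * \<beta>" "u2 * w2 = \<gamma>" by blast
  have "(u1 * w2 - u2 * w1)\<^sup>2 = (u1 * w2 + u2 * w1)\<^sup>2 - 4 * (u1 * w1) * (u2 * w2)"
    by (simp add: algebra_simps power2_eq_square)
  also have "\<dots> = 4 * (\<beta>\<^sup>2 - \<alpha> * \<gamma>)" unfolding u by (simp add: algebra_simps power2_eq_square)
  finally have "u1 * w2 - u2 * w1 \<noteq> 0" using assms by auto
  then show ?thesis using u by blast
qed

text \<open>The hypothesis \<open>nd\<close> expresses smoothness of the conic on the plane of
  coordinate sum zero in Lagrange form, with multiplier \<open>\<mu>\<close>. Completing the square
  in \<open>y1\<close> and factoring the remaining binary quadric gives the standard conic.\<close>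

lemma conic_parametrization:
  fixes b12 b13 b14 b23 b24 b34 :: "'k::{alg_closed_field,field_char_0}"
  assumes b23: "b23 \<noteq> 0"
    and nd: "\<And>y1 y2 y3 y4 \<mu>. y1 + y2 + y3 + y4 = 0 \<Longrightarrow> b34 * y2 + b24 * y3 + b23 * y4 = \<mu> \<Longrightarrow>
      b34 * y1 + b14 * y3 + b13 * y4 = \<mu> \<Longrightarrow> b24 * y1 + b14 * y2 + b12 * y4 = \<mu> \<Longrightarrow>
      b23 * y1 + b13 * y2 + b12 * y3 = \<mu> \<Longrightarrow> y2 = 0 \<and> y3 = 0"
  shows "\<exists>(L :: 'k ^ 3 \<Rightarrow> 'k ^ 4) (N :: 'k ^ 4 \<Rightarrow> 'k ^ 3) \<kappa>.
    (\<forall>i. form 1 (\<lambda>p. L p $ i)) \<and> (\<forall>i. form 1 (\<lambda>y. N y $ i)) \<and>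
    (\<forall>p. L p $ 1 + L p $ 2 + L p $ 3 + L p $ 4 = 0) \<and>
    (\<forall>y. y $ 1 + y $ 2 + y $ 3 + y $ 4 = 0 \<longrightarrow> L (N y) = y) \<and> \<kappa> \<noteq> 0 \<and>
    (\<forall>p y. y = L p \<longrightarrow> b34 * y $ 1 * y $ 2 + b24 * y $ 1 * y $ 3 + b23 * y $ 1 * y $ 4
      + b14 * y $ 2 * y $ 3 + b13 * y $ 2 * y $ 4 + b12 * y $ 3 * y $ 4 = \<kappa> * ((p $ 1)\<^sup>2 - p $ 2 * p $ 3))"
proof -
  \<comment> \<open>Coefficients of the conic after eliminating
    \<open>y4 = - y1 - y2 - y3\<close>.\<close>
  define A B C D E G where defs: "A = - b23" "B = b34 - b13 - b23" "C = b24 - b12 - b23" "D = - b13"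
    "E = b14 - b13 - b12" "G = - b12"
  \<comment> \<open>Completing the square: \<open>4 A\<close> times the conic is \<open>(2 A y1 + B
    y2 + C y3)^2 - (\<alpha> y2^2 + 2 \<beta> y2 y3 + \<gamma> y3^2)\<close>.\<close>
  define \<alpha> \<beta> \<gamma> where greek: "\<alpha> = B\<^sup>2 - 4 * A * D" "\<beta> = B * C - 2 * A * E" "\<gamma> = C\<^sup>2 - 4 * A * G"
  have A0: "A \<noteq> 0" using b23 by (simp add: defs)
  have "\<beta>\<^sup>2 \<noteq> \<alpha> * \<gamma>"
  proof
    assume deg: "\<beta>\<^sup>2 = \<alpha> * \<gamma>"
    obtain y2 y3 where y: "\<alpha> * y2 + \<beta> * y3 = 0" "\<beta> * y2 + \<gamma> * y3 = 0" "y2 \<noteq> 0 \<or> y3 \<noteq> 0"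
    proof (cases "\<alpha> = 0 \<and> \<beta> = 0")
      case True then show ?thesis using that[of 1 0] by simp
    next
      case False then show ?thesis using that[of \<beta> "- \<alpha>"] deg by (auto simp: power2_eq_square)
    qed
    define y1 where "y1 = - (B * y2 + C * y3) / (2 * A)"
    define y4 where "y4 = - y1 - y2 - y3"
    have y1: "2 * A * y1 = - (B * y2 + C * y3)" using A0 by (simp add: y1_def)
    have "2 * A * (B * y1 + 2 * D * y2 + E * y3) = B * (2 * A * y1) + 4 * A * D * y2 + 2 * A * E * y3"
      by (simp add: algebra_simps)
    also have "\<dots> = - (\<alpha> * y2 + \<beta> * y3)" unfolding y1 greek by (simp add: algebra_simps power2_eq_square)
    finally have g2: "B * y1 + 2 * D * y2 + E * y3 = 0" using A0 y(1) by simp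
    have "2 * A * (C * y1 + E * y2 + 2 * G * y3) = C * (2 * A * y1) + 2 * A * E * y2 + 4 * A * G * y3"
      by (simp add: algebra_simps)
    also have "\<dots> = - (\<beta> * y2 + \<gamma> * y3)" unfolding y1 greek by (simp add: algebra_simps power2_eq_square)
    finally have g3: "C * y1 + E * y2 + 2 * G * y3 = 0" using A0 y(2) by simp
    have "y2 = 0 \<and> y3 = 0"
    proof (rule nd[of y1 y2 y3 y4 "b23 * y1 + b13 * y2 + b12 * y3"])
      have "b34 * y2 + b24 * y3 + b23 * y4 - (b23 * y1 + b13 * y2 + b12 * y3) = 2 * A * y1 + (B * y2 + C * y3)"
        by (simp add: y4_def defs algebra_simps)
      then show "b34 * y2 + b24 * y3 + b23 * y4 = b23 * y1 + b13 * y2 + b12 * y3" using y1 by simp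
      have "b34 * y1 + b14 * y3 + b13 * y4 - (b23 * y1 + b13 * y2 + b12 * y3) = B * y1 + 2 * D * y2 + E * y3"
        by (simp add: y4_def defs algebra_simps)
      then show "b34 * y1 + b14 * y3 + b13 * y4 = b23 * y1 + b13 * y2 + b12 * y3" using g2 by simp
      have "b24 * y1 + b14 * y2 + b12 * y4 - (b23 * y1 + b13 * y2 + b12 * y3) = C * y1 + E * y2 + 2 * G * y3"
        by (simp add: y4_def defs algebra_simps)
      then show "b24 * y1 + b14 * y2 + b12 * y4 = b23 * y1 + b13 * y2 + b12 * y3" using g3 by simp
    qed (simp_all add: y4_def)
    then show False using y(3) by simp
  qed
  from binary_quadric_factor[OF this] obtain u1 u2 w1 w2 where
    u: "u1 * w1 = \<alpha>" "u1 * w2 + u2 * w1 = 2 * \<beta>" "u2 * w2 = \<gamma>" and uw: "u1 * w2 - u2 * w1 \<noteq> 0" by blast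
  define \<delta> where "\<delta> = u1 * w2 - u2 * w1"
  have \<delta>: "\<delta> \<noteq> 0" using uw by (simp add: \<delta>_def)
  define N where "N y = mk3 (2 * A * y $ 1 + B * y $ 2 + C * y $ 3) (u1 * y $ 2 + u2 * y $ 3) (w1 * y $ 2 + w2 * y $ 3)" for y :: "'k ^ 4"
  define L2 where "L2 p = inverse \<delta> * (w2 * p $ 2 - u2 * p $ 3)" for p :: "'k ^ 3"
  define L3 where "L3 p = inverse \<delta> * (u1 * p $ 3 - w1 * p $ 2)" for p :: "'k ^ 3"
  define L1 where "L1 p = inverse (2 * A) * (p $ 1 - B * L2 p - C * L3 p)" for p :: "'k ^ 3"
  define L where "L p = mk4 (L1 p) (L2 p) (L3 p) (- L1 p - L2 p - L3 p)" for p
  have L23: "form 1 L2" "form 1 L3" unfolding L2_def L3_def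
    by (intro form_cmult form_diff form_proj)+
  have L1: "form 1 L1" unfolding L1_def by (intro form_cmult form_diff form_proj L23)
  have fL: "form 1 (\<lambda>p. L p $ i)" for i unfolding L_def
    by (intro form_mk4 form_diff form_uminus L1 L23)
  have fN: "form 1 (\<lambda>y. N y $ i)" for i unfolding N_def
    by (intro form_mk3 form_add form_cmult form_proj)
  have sumL: "L p $ 1 + L p $ 2 + L p $ 3 + L p $ 4 = 0" for p by (simp add: L_def)
  have LN: "L (N y) = y" if "y $ 1 + y $ 2 + y $ 3 + y $ 4 = 0" for y
  proof -
    have "w2 * (u1 * y $ 2 + u2 * y $ 3) - u2 * (w1 * y $ 2 + w2 * y $ 3) = \<delta> * y $ 2"
      "u1 * (w1 * y $ 2 + w2 * y $ 3) - w1 * (u1 * y $ 2 + u2 * y $ 3) = \<delta> * y $ 3"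
      by (simp_all add: \<delta>_def algebra_simps)
    then have 23: "L2 (N y) = y $ 2" "L3 (N y) = y $ 3" using \<delta> by (simp_all add: L2_def L3_def N_def)
    have 1: "L1 (N y) = y $ 1" using A0 by (simp add: L1_def 23) (simp add: N_def)
    have "y $ 4 = - y $ 1 - y $ 2 - y $ 3" using that by (simp add: algebra_simps add_eq_0_iff)
    then show ?thesis by (simp add: vec_eq_4 L_def 1 23)
  qed
  have conic: "b34 * y $ 1 * y $ 2 + b24 * y $ 1 * y $ 3 + b23 * y $ 1 * y $ 4
      + b14 * y $ 2 * y $ 3 + b13 * y $ 2 * y $ 4 + b12 * y $ 3 * y $ 4 = inverse (4 * A) * ((p $ 1)\<^sup>2 - p $ 2 * p $ 3)"
    if y: "y = L p" for y p
  proof -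
    define y1 y2 y3 where yd: "y1 = L1 p" "y2 = L2 p" "y3 = L3 p"
    have ys: "y $ 1 = y1" "y $ 2 = y2" "y $ 3 = y3" "y $ 4 = - y1 - y2 - y3" by (simp_all add: y L_def yd)
    have "2 * A * L1 p = (2 * A * inverse (2 * A)) * (p $ 1 - B * L2 p - C * L3 p)"
      unfolding L1_def by (simp only: mult.assoc)
    also have "\<dots> = p $ 1 - B * L2 p - C * L3 p" using A0 by simp
    finally have p1: "p $ 1 = 2 * A * y1 + B * y2 + C * y3" by (simp add: yd algebra_simps)
    have dL: "\<delta> * L2 p = w2 * p $ 2 - u2 * p $ 3" "\<delta> * L3 p = u1 * p $ 3 - w1 * p $ 2"
      using \<delta> by (simp_all add: L2_def L3_def mult.assoc[symmetric])
    have "\<delta> * (u1 * y2 + u2 * y3) = u1 * (\<delta> * y2) + u2 * (\<delta> * y3)" by (simp add: algebra_simps)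
    also have "\<dots> = \<delta> * p $ 2" unfolding yd dL by (simp add: \<delta>_def algebra_simps)
    finally have p2: "p $ 2 = u1 * y2 + u2 * y3" using \<delta> by simp
    have "\<delta> * (w1 * y2 + w2 * y3) = w1 * (\<delta> * y2) + w2 * (\<delta> * y3)" by (simp add: algebra_simps)
    also have "\<dots> = \<delta> * p $ 3" unfolding yd dL by (simp add: \<delta>_def algebra_simps)
    finally have p3: "p $ 3 = w1 * y2 + w2 * y3" using \<delta> by simp
    have "p $ 2 * p $ 3 = (u1 * w1) * y2\<^sup>2 + (u1 * w2 + u2 * w1) * y2 * y3 + (u2 * w2) * y3\<^sup>2"
      unfolding p2 p3 by (simp add: algebra_simps power2_eq_square)
    then have "p $ 2 * p $ 3 = \<alpha> * y2\<^sup>2 + 2 * \<beta> * y2 * y3 + \<gamma> * y3\<^sup>2" unfolding u .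
    then have "(p $ 1)\<^sup>2 - p $ 2 * p $ 3 = 4 * A * (A * y1\<^sup>2 + B * y1 * y2 + C * y1 * y3 + D * y2\<^sup>2 + E * y2 * y3 + G * y3\<^sup>2)"
      unfolding p1 greek by (simp add: algebra_simps power2_eq_square)
    then have *: "inverse (4 * A) * ((p $ 1)\<^sup>2 - p $ 2 * p $ 3) = A * y1\<^sup>2 + B * y1 * y2 + C * y1 * y3 + D * y2\<^sup>2 + E * y2 * y3 + G * y3\<^sup>2"
      using A0 by simp
    show ?thesis unfolding ys * by (simp add: defs algebra_simps power2_eq_square)
  qed
  show ?thesis
    by (rule exI[of _ L], rule exI[of _ N], rule exI[of _ "inverse (4 * A)"]) (use fL fN sumL LN conic A0 in auto)
qed

context node_coeffs
begin

text \<open>Each coefficient is \<open>a\<close> at the triple complementary to a pair of variables.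
  With the variable of node \<open>i\<close> set to zero, this is the Hessian matrix at that node
  with complementary pairs exchanged, and its determinant is the same
  \<open>node_disc\<close>.\<close>

lemma kernel_zero_coord:
  assumes d: "distinct [i, j, k, l, m]"
    and rows: "a i l m * y3 + a i k m * y4 + a i k l * y5 = 0" "a i l m * y2 + a i j m * y4 + a i j l * y5 = 0"
      "a i k m * y2 + a i j m * y3 + a i j k * y5 = 0" "a i k l * y2 + a i j l * y3 + a i j k * y4 = 0"
  shows "y2 = 0 \<and> y3 = 0 \<and> y4 = 0 \<and> y5 = 0"
proof -
  have nz: "a i j m \<noteq> 0" "a i j l \<noteq> 0" "a i j k \<noteq> 0"
    using a_nonzero[of i j m k l] a_nonzero[of i j l k m] a_nonzero[of i j k l m] d by auto
  have D: "node_disc (a i l m * a i j k) (a i k m * a i j l) (a i k l * a i j m) \<noteq> 0"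
    using node_disc_nonzero[OF d] by (simp add: mult.commute)
  show ?thesis using node_disc_kernel[OF rows nz D] by blast
qed

text \<open>The rows are the gradient of the quadric into which the Cremona map turns the cubic, so
  this is smoothness of that quadric. A kernel vector with a zero coordinate contradicts
  nondegeneracy of a node; inverting the coordinates of any other one gives a sixth singular
  point.\<close>

lemma kernel_trivial:
  assumes r: "a 3 4 5 * y2 + a 2 4 5 * y3 + a 2 3 5 * y4 + a 2 3 4 * y5 = 0"
    "a 3 4 5 * y1 + a 1 4 5 * y3 + a 1 3 5 * y4 + a 1 3 4 * y5 = 0"
    "a 2 4 5 * y1 + a 1 4 5 * y2 + a 1 2 5 * y4 + a 1 2 4 * y5 = 0"
    "a 2 3 5 * y1 + a 1 3 5 * y2 + a 1 2 5 * y3 + a 1 2 3 * y5 = 0"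
    "a 2 3 4 * y1 + a 1 3 4 * y2 + a 1 2 4 * y3 + a 1 2 3 * y4 = 0"
  shows "y1 = 0 \<and> y2 = 0 \<and> y3 = 0 \<and> y4 = 0 \<and> y5 = 0"
proof -
  have s: "a 2 1 k = a 1 2 k" "a 3 1 k = a 1 3 k" "a 4 1 k = a 1 4 k" "a 5 1 k = a 1 5 k"
    "a 3 2 k = a 2 3 k" "a 4 2 k = a 2 4 k" "a 5 2 k = a 2 5 k" "a 4 3 k = a 3 4 k" "a 5 3 k = a 3 5 k"
    "a i 2 1 = a i 1 2" "a i 3 1 = a i 1 3" "a i 4 1 = a i 1 4" "a i 5 1 = a i 1 5" "a i 3 2 = a i 2 3"
    "a i 4 2 = a i 2 4" "a i 5 2 = a i 2 5" "a i 4 3 = a i 3 4" "a i 5 3 = a i 3 5" "a i 5 4 = a i 4 5" for i k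
    by (rule sym1 sym2)+
  consider "y1 = 0" | "y2 = 0" | "y3 = 0" | "y4 = 0" | "y5 = 0"
    | "y1 \<noteq> 0" "y2 \<noteq> 0" "y3 \<noteq> 0" "y4 \<noteq> 0" "y5 \<noteq> 0" by blast
  then show ?thesis
  proof cases
    case 1
    then show ?thesis using kernel_zero_coord[of 1 2 3 4 5 y3 y4 y5 y2] r by (auto simp: s)
  next
    case 2
    then show ?thesis using kernel_zero_coord[of 2 1 3 4 5 y3 y4 y5 y1] r by (auto simp: s)
  next
    case 3
    then show ?thesis using kernel_zero_coord[of 3 1 2 4 5 y2 y4 y5 y1] r by (auto simp: s)
  next
    case 4
    then show ?thesis using kernel_zero_coord[of 4 1 2 3 5 y2 y3 y5 y1] r by (auto simp: s)
  next
    case 5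
    then show ?thesis using kernel_zero_coord[of 5 1 2 3 4 y2 y3 y4 y1] r by (auto simp: s)
  next
    case 6
    have d: "distinct [1, 2, 3, 4, 5 :: 5]" by simp
    define R where "R = (\<lambda>i :: 5. if i = 1 then a 3 4 5 * y2 + a 2 4 5 * y3 + a 2 3 5 * y4 + a 2 3 4 * y5
      else if i = 2 then a 3 4 5 * y1 + a 1 4 5 * y3 + a 1 3 5 * y4 + a 1 3 4 * y5
      else if i = 3 then a 2 4 5 * y1 + a 1 4 5 * y2 + a 1 2 5 * y4 + a 1 2 4 * y5
      else if i = 4 then a 2 3 5 * y1 + a 1 3 5 * y2 + a 1 2 5 * y3 + a 1 2 3 * y5
      else a 2 3 4 * y1 + a 1 3 4 * y2 + a 1 2 4 * y3 + a 1 2 3 * y4)"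
    have R: "R i = 0" for i using r by (simp add: R_def)
    have two: "x = 0" if "2 * x = 0" for x :: 'k using that by simp
    \<comment> \<open>By Euler's relation this combination of the rows is twice the part of the
      quadric free of \<open>y1\<close>. Divided by \<open>y2 * y3 * y4 * y5\<close>, that part is,
      up to a constant, the first partial derivative of the cubic at the inverted point.\<close>
    have "2 * (a 1 2 3 * y4 * y5 + a 1 2 4 * y3 * y5 + a 1 2 5 * y3 * y4 + a 1 3 4 * y2 * y5 + a 1 3 5 * y2 * y4 + a 1 4 5 * y2 * y3)
       = y2 * R 2 + y3 * R 3 + y4 * R 4 + y5 * R 5 - y1 * R 1" by (simp add: R_def algebra_simps)
    then have "2 * (a 1 2 3 * y4 * y5 + a 1 2 4 * y3 * y5 + a 1 2 5 * y3 * y4 + a 1 3 4 * y2 * y5 + a 1 3 5 * y2 * y4 + a 1 4 5 * y2 * y3) = 0" unfolding R by simp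
    then have E1: "a 1 2 3 * y4 * y5 + a 1 2 4 * y3 * y5 + a 1 2 5 * y3 * y4 + a 1 3 4 * y2 * y5 + a 1 3 5 * y2 * y4 + a 1 4 5 * y2 * y3 = 0" by (rule two)
    have "2 * (a 1 2 3 * y4 * y5 + a 1 2 4 * y3 * y5 + a 1 2 5 * y3 * y4 + a 2 3 4 * y1 * y5 + a 2 3 5 * y1 * y4 + a 2 4 5 * y1 * y3)
       = y1 * R 1 + y3 * R 3 + y4 * R 4 + y5 * R 5 - y2 * R 2" by (simp add: R_def algebra_simps)
    then have "2 * (a 1 2 3 * y4 * y5 + a 1 2 4 * y3 * y5 + a 1 2 5 * y3 * y4 + a 2 3 4 * y1 * y5 + a 2 3 5 * y1 * y4 + a 2 4 5 * y1 * y3) = 0" unfolding R by simp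
    then have E2: "a 1 2 3 * y4 * y5 + a 1 2 4 * y3 * y5 + a 1 2 5 * y3 * y4 + a 2 3 4 * y1 * y5 + a 2 3 5 * y1 * y4 + a 2 4 5 * y1 * y3 = 0" by (rule two)
    have "2 * (a 1 2 3 * y4 * y5 + a 1 3 4 * y2 * y5 + a 1 3 5 * y2 * y4 + a 2 3 4 * y1 * y5 + a 2 3 5 * y1 * y4 + a 3 4 5 * y1 * y2)
       = y1 * R 1 + y2 * R 2 + y4 * R 4 + y5 * R 5 - y3 * R 3" by (simp add: R_def algebra_simps)
    then have "2 * (a 1 2 3 * y4 * y5 + a 1 3 4 * y2 * y5 + a 1 3 5 * y2 * y4 + a 2 3 4 * y1 * y5 + a 2 3 5 * y1 * y4 + a 3 4 5 * y1 * y2) = 0" unfolding R by simp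
    then have E3: "a 1 2 3 * y4 * y5 + a 1 3 4 * y2 * y5 + a 1 3 5 * y2 * y4 + a 2 3 4 * y1 * y5 + a 2 3 5 * y1 * y4 + a 3 4 5 * y1 * y2 = 0" by (rule two)
    have "2 * (a 1 2 4 * y3 * y5 + a 1 3 4 * y2 * y5 + a 1 4 5 * y2 * y3 + a 2 3 4 * y1 * y5 + a 2 4 5 * y1 * y3 + a 3 4 5 * y1 * y2)
       = y1 * R 1 + y2 * R 2 + y3 * R 3 + y5 * R 5 - y4 * R 4" by (simp add: R_def algebra_simps)
    then have "2 * (a 1 2 4 * y3 * y5 + a 1 3 4 * y2 * y5 + a 1 4 5 * y2 * y3 + a 2 3 4 * y1 * y5 + a 2 4 5 * y1 * y3 + a 3 4 5 * y1 * y2) = 0" unfolding R by simp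
    then have E4: "a 1 2 4 * y3 * y5 + a 1 3 4 * y2 * y5 + a 1 4 5 * y2 * y3 + a 2 3 4 * y1 * y5 + a 2 4 5 * y1 * y3 + a 3 4 5 * y1 * y2 = 0" by (rule two)
    have "2 * (a 1 2 5 * y3 * y4 + a 1 3 5 * y2 * y4 + a 1 4 5 * y2 * y3 + a 2 3 5 * y1 * y4 + a 2 4 5 * y1 * y3 + a 3 4 5 * y1 * y2)
       = y1 * R 1 + y2 * R 2 + y3 * R 3 + y4 * R 4 - y5 * R 5" by (simp add: R_def algebra_simps)
    then have "2 * (a 1 2 5 * y3 * y4 + a 1 3 5 * y2 * y4 + a 1 4 5 * y2 * y3 + a 2 3 5 * y1 * y4 + a 2 4 5 * y1 * y3 + a 3 4 5 * y1 * y2) = 0" unfolding R by simp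
    then have E5: "a 1 2 5 * y3 * y4 + a 1 3 5 * y2 * y4 + a 1 4 5 * y2 * y3 + a 2 3 5 * y1 * y4 + a 2 4 5 * y1 * y3 + a 3 4 5 * y1 * y2 = 0" by (rule two)
    define x1 x2 x3 x4 x5 where x: "x1 = inverse y1" "x2 = inverse y2" "x3 = inverse y3" "x4 = inverse y4" "x5 = inverse y5"
    have False
    proof (rule no_sixth_5[OF d, where ?x1.0 = x1 and ?x2.0 = x2 and ?x3.0 = x3 and ?x4.0 = x4 and ?x5.0 = x5])
      show "x2 * x3 * a 1 2 3 + x2 * x4 * a 1 2 4 + x2 * x5 * a 1 2 5 + x3 * x4 * a 1 3 4 + x3 * x5 * a 1 3 5 + x4 * x5 * a 1 4 5 = 0"
        using 6 E1 by (simp add: x field_simps)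
      show "x1 * x3 * a 1 2 3 + x1 * x4 * a 1 2 4 + x1 * x5 * a 1 2 5 + x3 * x4 * a 2 3 4 + x3 * x5 * a 2 3 5 + x4 * x5 * a 2 4 5 = 0"
        using 6 E2 by (simp add: x field_simps)
      show "x1 * x2 * a 1 2 3 + x1 * x4 * a 1 3 4 + x1 * x5 * a 1 3 5 + x2 * x4 * a 2 3 4 + x2 * x5 * a 2 3 5 + x4 * x5 * a 3 4 5 = 0"
        using 6 E3 by (simp add: x field_simps)
      show "x1 * x2 * a 1 2 4 + x1 * x3 * a 1 3 4 + x1 * x5 * a 1 4 5 + x2 * x3 * a 2 3 4 + x2 * x5 * a 2 4 5 + x3 * x5 * a 3 4 5 = 0"
        using 6 E4 by (simp add: x field_simps)
      show "x1 * x2 * a 1 2 5 + x1 * x3 * a 1 3 5 + x1 * x4 * a 1 4 5 + x2 * x3 * a 2 3 5 + x2 * x4 * a 2 4 5 + x3 * x4 * a 3 4 5 = 0"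
        using 6 E5 by (simp add: x field_simps)
    qed (use 6 x in auto)
    then show ?thesis ..
  qed
qed

end

section \<open>Cubic forms as symmetric trilinear forms\<close>

lemma form_Suc_decompose:
  "form d f \<Longrightarrow> d \<ge> 1 \<Longrightarrow> \<exists>g. (\<forall>i. form (d - 1) (g i)) \<and> (\<forall>x. f x = (\<Sum>i\<in>UNIV. x $ i * g i x))"
proof (induction rule: form.induct)
  case (form_zero d)
  show ?case by (rule exI[of _ "\<lambda>i x. 0"]) (simp add: form.form_zero)
next
  case (form_coord d f i)
  have "form d (if j = i then f else (\<lambda>_. 0))" for j using form_coord.hyps form.form_zero by auto
  moreover have "x $ i * f x = (\<Sum>j\<in>UNIV. x $ j * (if j = i then f else (\<lambda>_. 0)) x)" for x
    by (simp add: if_distrib if_distribR cong: if_cong)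
  ultimately show ?case by (intro exI[of _ "\<lambda>j. if j = i then f else (\<lambda>_. 0)"]) simp
next
  case (form_add d f g)
  then obtain f' g' where f': "\<And>i. form (d - 1) (f' i)" "\<And>x. f x = (\<Sum>i\<in>UNIV. x $ i * f' i x)"
    and g': "\<And>i. form (d - 1) (g' i)" "\<And>x. g x = (\<Sum>i\<in>UNIV. x $ i * g' i x)" by auto
  have "f x + g x = (\<Sum>i\<in>UNIV. x $ i * (f' i x + g' i x))" for x
    unfolding f'(2) g'(2) by (simp add: sum.distrib algebra_simps)
  then show ?case using form.form_add[OF f'(1) g'(1)]
    by (intro exI[of _ "\<lambda>i x. f' i x + g' i x"]) auto
qed simp

locale sym_trilinear =
  fixes S :: "'k::field_char_0 ^ 'n::finite \<Rightarrow> 'k ^ 'n \<Rightarrow> 'k ^ 'n \<Rightarrow> 'k"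
  assumes S12: "S u v w = S v u w" and S23: "S u v w = S u w v"
    and S_add: "S (u + u') v w = S u v w + S u' v w" and S_scale: "S (c *s u) v w = c * S u v w"
begin

lemma S_add2: "S u (v + v') w = S u v w + S u v' w"
  by (simp only: S12[of u "v + v'"] S12[of u v] S12[of u v'] S_add)
lemma S_add3: "S u v (w + w') = S u v w + S u v w'"
  by (simp only: S23[of u v "w + w'"] S23[of u v w] S23[of u v w'] S_add2)
lemma S_scale2: "S u (c *s v) w = c * S u v w"
  by (simp only: S12[of u "c *s v"] S12[of u v] S_scale)
lemma S_scale3: "S u v (c *s w) = c * S u v w"
  by (simp only: S23[of u v "c *s w"] S23[of u v w] S_scale2)
lemma S_zero: "S 0 v w = 0" using S_scale[of 0 0] by simp
lemma S_zero3: "S u v 0 = 0" using S_scale3[of u v 0 0] by simp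
lemma S_sum: "S (\<Sum>i\<in>A. x i *s e i) v w = (\<Sum>i\<in>A. x i * S (e i) v w)"
  by (induction A rule: infinite_finite_induct) (auto simp: S_zero S_add S_scale)
lemma S_zero2: "S u 0 w = 0" using S_scale2[of u 0 0 w] by simp
lemma S_sum2: "S u (\<Sum>i\<in>A. x i *s e i) w = (\<Sum>i\<in>A. x i * S u (e i) w)"
  by (induction A rule: infinite_finite_induct) (auto simp: S_zero2 S_add2 S_scale2)
lemma S_sum3: "S u v (\<Sum>i\<in>A. x i *s e i) = (\<Sum>i\<in>A. x i * S u v (e i))"
  by (induction A rule: infinite_finite_induct) (auto simp: S_zero3 S_add3 S_scale3)

lemma S_diff3: "S u v (w - w') = S u v w - S u v w'"
  using S_add3[of u v "w - w'" w'] by simp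

lemmas S_linear = S_diff3 S_add S_add2 S_add3 S_scale S_scale2 S_scale3

end

text \<open>An arbitrary coefficient tensor of the cubic is averaged over the six permutations of
  its arguments; characteristic zero permits the division.\<close>

lemma cubic_polarization:
  fixes f :: "'k::field_char_0 ^ 'n::finite \<Rightarrow> 'k"
  assumes "form 3 f"
  shows "\<exists>S. sym_trilinear S \<and> (\<forall>x. f x = S x x x)"
proof -
  obtain g where g: "\<And>i. form 2 (g i)" "\<And>x. f x = (\<Sum>i\<in>UNIV. x $ i * g i x)"
    using form_Suc_decompose[OF assms] by auto
  have "\<forall>i. \<exists>h. (\<forall>j. form 1 (h j)) \<and> (\<forall>x. g i x = (\<Sum>j\<in>UNIV. x $ j * h j x))"
    using form_Suc_decompose[OF g(1)] by auto
  from choice[OF this] obtain h where h: "\<And>i j. form 1 (h i j)" "\<And>i x. g i x = (\<Sum>j\<in>UNIV. x $ j * h i j x)"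
    by blast
  define a where "a i j = (SOME a. \<forall>x. h i j x = (\<Sum>k\<in>UNIV. a $ k * x $ k))" for i j
  have a: "h i j x = (\<Sum>k\<in>UNIV. a i j $ k * x $ k)" for i j x
    using someI_ex[OF form_1_linear[OF h(1)[of i j] refl]] unfolding a_def by blast
  define C where "C u v w = (\<Sum>i\<in>UNIV. \<Sum>j\<in>UNIV. \<Sum>k\<in>UNIV. u $ i * (v $ j * (w $ k * a i j $ k)))" for u v w
  have C_add: "C (u + u') v w = C u v w + C u' v w" "C u (v + v') w = C u v w + C u v' w"
     "C u v (w + w') = C u v w + C u v w'" for u u' v v' w w'
    by (simp_all add: C_def sum.distrib[symmetric] algebra_simps)
  have C_scale: "C (c *s u) v w = c * C u v w" "C u (c *s v) w = c * C u v w" "C u v (c *s w) = c * C u v w" for c u v w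
    by (simp_all add: C_def sum_distrib_left algebra_simps)
  have fC: "f x = C x x x" for x
    unfolding g(2) h(2) a C_def by (simp add: sum_distrib_left algebra_simps)
  define S where "S u v w = inverse 6 * (C u v w + C u w v + C v u w + C v w u + C w u v + C w v u)" for u v w
  have "sym_trilinear S"
  proof
    show "S u v w = S v u w" for u v w by (simp add: S_def algebra_simps)
    show "S u v w = S u w v" for u v w by (simp add: S_def algebra_simps)
    show "S (u + u') v w = S u v w + S u' v w" for u u' v w by (simp add: S_def C_add algebra_simps)
    show "S (c *s u) v w = c * S u v w" for c u v w by (simp add: S_def C_scale algebra_simps)
  qed
  moreover have "f x = S x x x" for x
  proof -
    have "S x x x = inverse 6 * (6 * C x x x)" by (simp add: S_def)
    also have "\<dots> = f x" unfolding fC by (simp only: mult.assoc[symmetric]) simp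
    finally show ?thesis by simp
  qed
  ultimately show ?thesis by blast
qed

lemma matrix_inv_both:
  fixes A :: "'k::field ^ 'n::finite ^ 'n"
  assumes "invertible A"
  shows "A ** matrix_inv A = mat 1" "matrix_inv A ** A = mat 1"
proof -
  have "A ** matrix_inv A = mat 1 \<and> matrix_inv A ** A = mat 1"
    using assms unfolding invertible_def matrix_inv_def by (rule someI_ex)
  then show "A ** matrix_inv A = mat 1" "matrix_inv A ** A = mat 1" by auto
qed

locale cubic = sym_trilinear S for S :: "'k::{alg_closed_field,field_char_0} ^ 5 \<Rightarrow> 'k ^ 5 \<Rightarrow> 'k ^ 5 \<Rightarrow> 'k" +
  fixes F :: "(5, 'k) mpoly"
  assumes F_S: "peval F x = S x x x"
begin

lemma partial_S: "peval (partial i F) v = 3 * S v v (axis i 1)"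
proof -
  obtain p where p: "\<And>t. peval F (v + t *s axis i 1) = poly p t"
    "coeff p 1 = (\<Sum>j\<in>UNIV. axis i 1 $ j * peval (partial j F) v)" using peval_line by blast
  let ?w = "axis i 1 :: 'k ^ 5"
  have "poly p t = poly [:S v v v, 3 * S v v ?w, 3 * S v ?w ?w, S ?w ?w ?w:] t" for t
  proof -
    have e: "S v ?w v = S v v ?w" "S ?w v v = S v v ?w" "S ?w v ?w = S v ?w ?w" "S ?w ?w v = S v ?w ?w"
      using S12 S23 by metis+
    show ?thesis unfolding p(1)[symmetric] F_S by (simp add: S_linear e algebra_simps)
  qed
  then have "p = [:S v v v, 3 * S v v ?w, 3 * S v ?w ?w, S ?w ?w ?w:]" using poly_eq_poly_eq_iff by blast
  then have "coeff p 1 = 3 * S v v ?w" by simp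
  then show ?thesis using p(2) by (simp add: axis_def if_distrib if_distribR cong: if_cong)
qed

lemma partial_partial_S: "peval (partial i (partial j F)) v = 6 * S v (axis i 1) (axis j 1)"
proof -
  obtain p where p: "\<And>t. peval (partial j F) (v + t *s axis i 1) = poly p t"
    "coeff p 1 = (\<Sum>k\<in>UNIV. axis i 1 $ k * peval (partial k (partial j F)) v)" using peval_line by blast
  let ?w = "axis i 1 :: 'k ^ 5" and ?e = "axis j 1 :: 'k ^ 5"
  have "poly p t = poly [:3 * S v v ?e, 6 * S v ?w ?e, 3 * S ?w ?w ?e:] t" for t
    unfolding p(1)[symmetric] partial_S by (simp add: S_linear S12[of ?w v] algebra_simps)
  then have "p = [:3 * S v v ?e, 6 * S v ?w ?e, 3 * S ?w ?w ?e:]" using poly_eq_poly_eq_iff by blast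
  then have "coeff p 1 = 6 * S v ?w ?e" by simp
  then show ?thesis using p(2) by (simp add: axis_def if_distrib if_distribR cong: if_cong)
qed

lemma vec_axis_sum: "(\<Sum>i\<in>UNIV. x $ i *s axis i 1) = (x :: 'k ^ 5)"
  by (simp add: Finite_Cartesian_Product.vec_eq_iff axis_def if_distrib cong: if_cong)

lemma S_axis: "(\<And>i. S u v (axis i 1) = 0) \<Longrightarrow> S u v w = 0"
  using S_sum3[of u v "\<lambda>i. w $ i" "\<lambda>i. axis i 1" UNIV] by (simp add: vec_axis_sum)

lemma span_in_Sing_iff:
  assumes "v \<noteq> 0"
  shows "vec.span {v} \<in> Sing F \<longleftrightarrow> (\<forall>w. S v v w = 0)"
proof
  assume "vec.span {v} \<in> Sing F"
  moreover have "v \<in> vec.span {v}" by (simp add: vec.span_base)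
  ultimately have "peval (partial i F) v = 0" for i by (simp add: Sing_def)
  then have "S v v (axis i 1) = 0" for i by (simp add: partial_S)
  then show "\<forall>w. S v v w = 0" using S_axis by blast
next
  assume s: "\<forall>w. S v v w = 0"
  have "peval F u = 0 \<and> peval (partial i F) u = 0" if "u \<in> vec.span {v}" for u i
    using that s by (auto simp: span_singleton F_S partial_S S_linear)
  then show "vec.span {v} \<in> Sing F"
    using assms by (auto simp: Sing_def hypersurface_def proj_space_def)
qed

lemma Sing_obtain:
  assumes "p \<in> Sing F"
  obtains v where "v \<noteq> 0" "p = vec.span {v}" "\<And>w. S v v w = 0"
proof -
  from assms obtain v where "v \<noteq> 0" "p = vec.span {v}" by (auto simp: Sing_def hypersurface_def proj_space_def)
  then show ?thesis using that span_in_Sing_iff assms by auto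
qed

lemma hessian_S: "(\<Sum>a\<in>UNIV. \<Sum>b\<in>UNIV. u $ a * hessian F v $ a $ b * w $ b) = 6 * S v u w"
proof -
  have "S v u w = S v (\<Sum>a\<in>UNIV. u $ a *s axis a 1) (\<Sum>b\<in>UNIV. w $ b *s axis b 1)"
    unfolding vec_axis_sum ..
  also have "\<dots> = (\<Sum>a\<in>UNIV. \<Sum>b\<in>UNIV. u $ a * (w $ b * S v (axis a 1) (axis b 1)))"
    unfolding S_sum2 unfolding S_sum3 unfolding sum_distrib_left ..
  finally show ?thesis
    by (simp add: hessian_def partial_partial_S sum_distrib_left algebra_simps)
qed

text \<open>The definition of a node uses an affine chart. So \<open>w\<close> is moved along
  \<open>v\<close> into the hyperplane of the chart, which preserves the assumption because
  \<open>v\<close> itself lies in the radical.\<close>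

lemma node_radical:
  assumes v: "v \<noteq> 0" "\<And>w. S v v w = 0" and node: "node F (vec.span {v})" and w: "\<And>u. S v u w = 0"
  shows "\<exists>c. w = c *s v"
proof -
  obtain i where i: "v $ i \<noteq> 0" using v(1) by (auto simp: Finite_Cartesian_Product.vec_eq_iff)
  define v' where "v' = inverse (v $ i) *s v"
  have v': "v' \<in> vec.span {v}" "v' $ i = 1" using i by (auto simp: v'_def span_singleton)
  define w' where "w' = w + (- w $ i) *s v'"
  have Svv: "S v u v = 0" for u using v(2) S23 by metis
  have "S v' u w' = 0" for u by (simp add: w'_def v'_def S_linear w Svv)
  then have "(\<Sum>a\<in>UNIV. \<Sum>b\<in>UNIV. u $ a * hessian F v' $ a $ b * w' $ b) = 0" for u
    unfolding hessian_S by simp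
  moreover have "w' $ i = 0" using v'(2) by (simp add: w'_def)
  ultimately have "w' = 0" using node v' unfolding node_def by blast
  then have "w = (w $ i * inverse (v $ i)) *s v"
    by (simp add: w'_def v'_def vector_smult_assoc add_eq_0_iff)
  then show ?thesis by blast
qed

text \<open>Representatives of the nodes that form a basis. Their scalars and their order remain
  free, and the normal forms below fix them.\<close>

definition frame :: "(5 \<Rightarrow> 'k ^ 5) \<Rightarrow> bool" where
  "frame v \<longleftrightarrow> Sing F = range (\<lambda>i. vec.span {v i}) \<and> invertible (\<chi> r c. v c $ r)"

definition mat_of :: "(5 \<Rightarrow> 'k ^ 5) \<Rightarrow> 'k ^ 5 ^ 5" where
  "mat_of v = (\<chi> r c. v c $ r)"

lemma mat_of_mult: "mat_of v *v x = (\<Sum>i\<in>UNIV. x $ i *s v i)"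
  by (simp add: mat_of_def matrix_vector_mult_def Finite_Cartesian_Product.vec_eq_iff mult.commute)

lemma mat_of_axis: "mat_of v *v axis i 1 = v i"
  unfolding mat_of_mult
  by (simp add: Finite_Cartesian_Product.vec_eq_iff axis_def if_distrib if_distribR cong: if_cong)

lemma frame_inv:
  assumes "frame v"
  shows "mat_of v *v (matrix_inv (mat_of v) *v x) = x" "matrix_inv (mat_of v) *v (mat_of v *v x) = x"
proof -
  have "invertible (mat_of v)" using assms by (simp add: frame_def mat_of_def)
  then show "mat_of v *v (matrix_inv (mat_of v) *v x) = x" "matrix_inv (mat_of v) *v (mat_of v *v x) = x"
    by (simp_all add: matrix_vector_mul_assoc matrix_inv_both)
qed

lemma frame_nonzero: "frame v \<Longrightarrow> v i \<noteq> 0"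
  using frame_inv(2)[of v "axis i 1"] mat_of_axis by (metis axis_eq_0_iff matrix_vector_mult_0_right one_neq_zero)

lemma frame_Sing: "frame v \<Longrightarrow> vec.span {v i} \<in> Sing F"
  by (auto simp: frame_def)

lemma frame_S: "frame v \<Longrightarrow> S (v i) (v i) w = 0"
  using span_in_Sing_iff[OF frame_nonzero] frame_Sing by blast

lemma S_mat_of: "S (mat_of v *v x) (mat_of v *v y) (mat_of v *v z) =
   (\<Sum>i\<in>UNIV. \<Sum>j\<in>UNIV. \<Sum>k\<in>UNIV. x $ i * (y $ j * (z $ k * S (v i) (v j) (v k))))"
  unfolding mat_of_mult unfolding S_sum unfolding S_sum2 unfolding S_sum3 unfolding sum_distrib_left ..

lemma frame_node_coeffs:
  assumes v: "frame v" and nodes: "\<forall>p\<in>Sing F. node F p"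
  shows "node_coeffs (\<lambda>i j k. S (v i) (v j) (v k))"
proof
  show "S (v i) (v j) (v k) = S (v j) (v i) (v k)" for i j k by (rule S12)
  show "S (v i) (v j) (v k) = S (v i) (v k) (v j)" for i j k by (rule S23)
  show "S (v i) (v i) (v k) = 0" for i k by (rule frame_S[OF v])
  have surj: "\<exists>x. u = mat_of v *v x" for u using frame_inv(1)[OF v] by metis
  show "y $ k = 0" if y: "\<And>j. (\<Sum>k\<in>UNIV. y $ k * S (v i) (v j) (v k)) = 0" and k: "k \<noteq> i" for y k i
  proof -
    define w where "w = mat_of v *v y"
    have 1: "S (v i) (v j) w = 0" for j unfolding w_def mat_of_mult S_sum3 by (rule y)
    have "S (v i) u w = 0" for u
    proof -
      obtain x where "u = mat_of v *v x" using surj by blast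
      then show ?thesis by (simp add: mat_of_mult S_sum2 1)
    qed
    then obtain c where "w = c *s v i"
      using node_radical[OF frame_nonzero[OF v] frame_S[OF v]] nodes frame_Sing[OF v] by blast
    then have "mat_of v *v y = mat_of v *v (c *s axis i 1)" by (simp add: w_def vector_scalar_commute mat_of_axis)
    then have "y = c *s axis i 1" using frame_inv(2)[OF v] by metis
    then show ?thesis using k by (simp add: axis_def)
  qed
  show "\<exists>i. \<forall>j. j \<noteq> i \<longrightarrow> x $ j = 0"
    if x: "\<And>k. (\<Sum>i\<in>UNIV. \<Sum>j\<in>UNIV. x $ i * x $ j * S (v i) (v j) (v k)) = 0" for x
  proof (cases "x = 0")
    case False
    define u where "u = mat_of v *v x"
    have u0: "u \<noteq> 0" using False frame_inv(2)[OF v, of x] unfolding u_def by (metis matrix_vector_mult_0_right)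
    have 1: "S u u (v k) = 0" for k
      using x[of k] unfolding u_def mat_of_mult unfolding S_sum unfolding S_sum2 unfolding sum_distrib_left by (simp add: mult.assoc)
    have "S u u w = 0" for w
    proof -
      obtain z where "w = mat_of v *v z" using surj by blast
      then show ?thesis by (simp add: mat_of_mult S_sum3 1)
    qed
    then have "vec.span {u} \<in> Sing F" using span_in_Sing_iff[OF u0] by blast
    then obtain i where "vec.span {u} = vec.span {v i}" using v by (auto simp: frame_def)
    from span_eq_imp_scale[OF this u0] obtain c where "u = c *s v i" by blast
    then have "mat_of v *v x = mat_of v *v (c *s axis i 1)" by (simp add: u_def vector_scalar_commute mat_of_axis)
    then have "x = c *s axis i 1" using frame_inv(2)[OF v] by metis
    then show ?thesis by (intro exI[of _ i]) (simp add: axis_def)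
  qed simp
qed

end

context node_coeffs
begin

lemma cubic_sum:
  "(\<Sum>i\<in>UNIV. \<Sum>j\<in>UNIV. \<Sum>k\<in>UNIV. x $ i * (x $ j * (x $ k * a i j k))) =
    6 * (x $ 1 * x $ 2 * x $ 3 * a 1 2 3 + x $ 1 * x $ 2 * x $ 4 * a 1 2 4 + x $ 1 * x $ 2 * x $ 5 * a 1 2 5
      + x $ 1 * x $ 3 * x $ 4 * a 1 3 4 + x $ 1 * x $ 3 * x $ 5 * a 1 3 5 + x $ 1 * x $ 4 * x $ 5 * a 1 4 5
      + x $ 2 * x $ 3 * x $ 4 * a 2 3 4 + x $ 2 * x $ 3 * x $ 5 * a 2 3 5 + x $ 2 * x $ 4 * x $ 5 * a 2 4 5
      + x $ 3 * x $ 4 * x $ 5 * a 3 4 5)"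
proof -
  have s: "a 2 1 k = a 1 2 k" "a 3 1 k = a 1 3 k" "a 4 1 k = a 1 4 k" "a 5 1 k = a 1 5 k"
    "a 3 2 k = a 2 3 k" "a 4 2 k = a 2 4 k" "a 5 2 k = a 2 5 k" "a 4 3 k = a 3 4 k" "a 5 3 k = a 3 5 k" "a 5 4 k = a 4 5 k"
    "a i 2 1 = a i 1 2" "a i 3 1 = a i 1 3" "a i 4 1 = a i 1 4" "a i 5 1 = a i 1 5" "a i 3 2 = a i 2 3"
    "a i 4 2 = a i 2 4" "a i 5 2 = a i 2 5" "a i 4 3 = a i 3 4" "a i 5 3 = a i 3 5" "a i 5 4 = a i 4 5" for i k
    by (rule sym1 sym2)+
  show ?thesis unfolding sum_5 by (simp add: s diag diag' algebra_simps)
qed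

text \<open>A critical point of the plane conic with multiplier \<open>\<mu>\<close> becomes, with
  fifth coordinate \<open>- \<mu>\<close>, a kernel vector as in \<open>kernel_trivial\<close>,
  because the coefficients of that coordinate all equal \<open>m\<close>. Hence the conic is smooth
  and can be parametrized.\<close>

lemma factorial_cubic_exists:
  assumes m: "a 2 3 4 = m" "a 1 3 4 = m" "a 1 2 4 = m" "a 1 2 3 = m"
  shows "\<exists>L N \<kappa>. factorial_cubic (a 1 2 5 / m) (a 1 3 5 / m) (a 1 4 5 / m) (a 2 3 5 / m) (a 2 4 5 / m) (a 3 4 5 / m) L N \<kappa>"
proof -
  have m0: "m \<noteq> 0" using a_nonzero[of 1 2 3 4 5] m by simp
  have nz: "a 1 2 5 \<noteq> 0" "a 1 3 5 \<noteq> 0" "a 1 4 5 \<noteq> 0" "a 2 3 5 \<noteq> 0" "a 2 4 5 \<noteq> 0" "a 3 4 5 \<noteq> 0"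
    using a_nonzero[of 1 2 5 3 4] a_nonzero[of 1 3 5 2 4] a_nonzero[of 1 4 5 2 3] a_nonzero[of 2 3 5 1 4]
      a_nonzero[of 2 4 5 1 3] a_nonzero[of 3 4 5 1 2] by simp_all
  then have nc: "nodal_cubic (a 1 2 5 / m) (a 1 3 5 / m) (a 1 4 5 / m) (a 2 3 5 / m) (a 2 4 5 / m) (a 3 4 5 / m)"
    using m0 by unfold_locales auto
  have b23: "a 2 3 5 / m \<noteq> 0" using nz m0 by simp
  have nd: "y2 = 0 \<and> y3 = 0" if "y1 + y2 + y3 + y4 = 0" "a 3 4 5 / m * y2 + a 2 4 5 / m * y3 + a 2 3 5 / m * y4 = \<mu>"
    "a 3 4 5 / m * y1 + a 1 4 5 / m * y3 + a 1 3 5 / m * y4 = \<mu>" "a 2 4 5 / m * y1 + a 1 4 5 / m * y2 + a 1 2 5 / m * y4 = \<mu>"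
    "a 2 3 5 / m * y1 + a 1 3 5 / m * y2 + a 1 2 5 / m * y3 = \<mu>" for y1 y2 y3 y4 \<mu>
  proof -
    have c: "m * (x / m * y) = x * y" for x y using m0 by simp
    have "m * (a 3 4 5 / m * y2 + a 2 4 5 / m * y3 + a 2 3 5 / m * y4) = m * \<mu>"
      "m * (a 3 4 5 / m * y1 + a 1 4 5 / m * y3 + a 1 3 5 / m * y4) = m * \<mu>"
      "m * (a 2 4 5 / m * y1 + a 1 4 5 / m * y2 + a 1 2 5 / m * y4) = m * \<mu>"
      "m * (a 2 3 5 / m * y1 + a 1 3 5 / m * y2 + a 1 2 5 / m * y3) = m * \<mu>" "m * (y1 + y2 + y3 + y4) = 0"
      by (simp_all only: that mult_zero_right)
    then have "a 3 4 5 * y2 + a 2 4 5 * y3 + a 2 3 5 * y4 + m * - \<mu> = 0"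
      "a 3 4 5 * y1 + a 1 4 5 * y3 + a 1 3 5 * y4 + m * - \<mu> = 0"
      "a 2 4 5 * y1 + a 1 4 5 * y2 + a 1 2 5 * y4 + m * - \<mu> = 0"
      "a 2 3 5 * y1 + a 1 3 5 * y2 + a 1 2 5 * y3 + m * - \<mu> = 0" "m * y1 + m * y2 + m * y3 + m * y4 = 0"
      unfolding distrib_left c by (simp_all only: mult_minus_right right_minus)
    then show ?thesis using kernel_trivial[of y2 y3 y4 "- \<mu>" y1] unfolding m by blast
  qed
  have "\<exists>(L :: 'k ^ 3 \<Rightarrow> 'k ^ 4) (N :: 'k ^ 4 \<Rightarrow> 'k ^ 3) \<kappa>.
    (\<forall>i. form 1 (\<lambda>p. L p $ i)) \<and> (\<forall>i. form 1 (\<lambda>y. N y $ i)) \<and>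
    (\<forall>p. L p $ 1 + L p $ 2 + L p $ 3 + L p $ 4 = 0) \<and>
    (\<forall>y. y $ 1 + y $ 2 + y $ 3 + y $ 4 = 0 \<longrightarrow> L (N y) = y) \<and> \<kappa> \<noteq> 0 \<and>
    (\<forall>p y. y = L p \<longrightarrow> a 3 4 5 / m * y $ 1 * y $ 2 + a 2 4 5 / m * y $ 1 * y $ 3 + a 2 3 5 / m * y $ 1 * y $ 4
      + a 1 4 5 / m * y $ 2 * y $ 3 + a 1 3 5 / m * y $ 2 * y $ 4 + a 1 2 5 / m * y $ 3 * y $ 4 = \<kappa> * ((p $ 1)\<^sup>2 - p $ 2 * p $ 3))"
    by (rule conic_parametrization[OF b23], rule nd)
  then obtain L :: "'k ^ 3 \<Rightarrow> 'k ^ 4" and N \<kappa> where L: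
    "\<forall>i. form 1 (\<lambda>p. L p $ i)" "\<forall>i. form 1 (\<lambda>y. N y $ i)"
    "\<forall>p. L p $ 1 + L p $ 2 + L p $ 3 + L p $ 4 = 0"
    "\<forall>y. y $ 1 + y $ 2 + y $ 3 + y $ 4 = 0 \<longrightarrow> L (N y) = y" "\<kappa> \<noteq> 0"
    "\<forall>p y. y = L p \<longrightarrow> a 3 4 5 / m * y $ 1 * y $ 2 + a 2 4 5 / m * y $ 1 * y $ 3 + a 2 3 5 / m * y $ 1 * y $ 4
      + a 1 4 5 / m * y $ 2 * y $ 3 + a 1 3 5 / m * y $ 2 * y $ 4 + a 1 2 5 / m * y $ 3 * y $ 4 = \<kappa> * ((p $ 1)\<^sup>2 - p $ 2 * p $ 3)"
    by (elim exE conjE)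
  have "factorial_cubic (a 1 2 5 / m) (a 1 3 5 / m) (a 1 4 5 / m) (a 2 3 5 / m) (a 2 4 5 / m) (a 3 4 5 / m) L N \<kappa>"
    by (intro factorial_cubic.intro nc factorial_cubic_axioms.intro) (use L in blast)+
  then show ?thesis by blast
qed

end

section \<open>Frames of nodes and the normal form of the equation\<close>

context cubic
begin

lemma frame_iff_kernel:
  "frame v \<longleftrightarrow> Sing F = range (\<lambda>i. vec.span {v i}) \<and> (\<forall>x. (\<Sum>i\<in>UNIV. x $ i *s v i) = 0 \<longrightarrow> x = 0)"
  unfolding frame_def mat_of_def[symmetric] invertible_iff_kernel mat_of_mult ..

lemma frame_scale:
  assumes v: "frame v" and c: "\<And>i. c i \<noteq> 0"
  shows "frame (\<lambda>i. c i *s v i)"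
  unfolding frame_iff_kernel
proof (intro conjI allI impI)
  show "Sing F = range (\<lambda>i. vec.span {c i *s v i})" using v c by (simp add: frame_def span_scale)
  fix x :: "'k ^ 5" assume "(\<Sum>i\<in>UNIV. x $ i *s (c i *s v i)) = 0"
  then have "(\<Sum>i\<in>UNIV. (\<chi> i. x $ i * c i) $ i *s v i) = 0" by (simp add: vector_smult_assoc)
  then have "(\<chi> i. x $ i * c i) = 0" using v unfolding frame_iff_kernel by blast
  then show "x = 0" using c by (simp add: Finite_Cartesian_Product.vec_eq_iff)
qed

lemma frame_perm:
  assumes v: "frame v" and \<pi>: "bij \<pi>"
  shows "frame (\<lambda>i. v (\<pi> i))"
  unfolding frame_iff_kernel
proof (intro conjI allI impI)
  have "range (\<lambda>i. vec.span {v (\<pi> i)}) = (\<lambda>i. vec.span {v i}) ` range \<pi>" by (simp add: image_image)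
  then show "Sing F = range (\<lambda>i. vec.span {v (\<pi> i)})" using v \<pi> by (simp add: frame_def bij_is_surj)
  fix x :: "'k ^ 5" assume x: "(\<Sum>i\<in>UNIV. x $ i *s v (\<pi> i)) = 0"
  have "(\<Sum>i\<in>UNIV. x $ inv_into UNIV \<pi> i *s v i) = (\<Sum>i\<in>UNIV. x $ inv_into UNIV \<pi> (\<pi> i) *s v (\<pi> i))"
    by (rule sum.reindex_bij_betw[OF \<pi>, symmetric])
  then have "(\<Sum>i\<in>UNIV. (\<chi> i. x $ inv_into UNIV \<pi> i) $ i *s v i) = 0" using x \<pi> by (simp add: bij_is_inj)
  then have "(\<chi> i. x $ inv_into UNIV \<pi> i) = 0" using v unfolding frame_iff_kernel by blast
  then have "x $ inv_into UNIV \<pi> (\<pi> i) = 0" for i by (simp add: Finite_Cartesian_Product.vec_eq_iff)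
  then show "x = 0" using \<pi> by (simp add: Finite_Cartesian_Product.vec_eq_iff bij_is_inj)
qed

lemma frame_exists:
  assumes card: "card (Sing F) = 5" and glp: "general_linear_position (Sing F)"
  shows "\<exists>v. frame v"
proof -
  have fin: "finite (Sing F)" using card card.infinite by force
  then obtain p where p: "bij_betw p (UNIV :: 5 set) (Sing F)"
    using finite_same_card_bij[of "UNIV :: 5 set" "Sing F"] card by auto
  have "\<forall>i. \<exists>v. p i = vec.span {v}"
    using p by (metis Sing_obtain UNIV_I bij_betwE)
  from choice[OF this] obtain v where v: "\<And>i. p i = vec.span {v i}" by blast
  have S: "Sing F = range (\<lambda>i. vec.span {v i})" using p v by (auto simp: bij_betw_def)
  have "vec.dim (\<Union>(Sing F)) = 5" using glp fin card unfolding general_linear_position_def by auto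
  then have "vec.span (\<Union>(Sing F)) = UNIV"
    using vec.dim_eq_span[of "\<Union>(Sing F)" UNIV] by (simp add: vec_dim_card card_cart_basis)
  moreover have "\<Union>(Sing F) \<subseteq> vec.span (columns (mat_of v))"
  proof
    fix x assume "x \<in> \<Union>(Sing F)"
    then obtain i where "x \<in> vec.span {v i}" using S by auto
    moreover have "v i \<in> columns (mat_of v)"
      unfolding columns_def column_def mat_of_def by (auto simp: Finite_Cartesian_Product.vec_eq_iff)
    ultimately show "x \<in> vec.span (columns (mat_of v))" by (meson vec.span_mono empty_subsetI insert_subset subsetD)
  qed
  ultimately have "vec.span (columns (mat_of v)) = UNIV"
    by (metis UNIV_I subsetI subset_antisym subset_UNIV vec.span_mono vec.span_span)
  then have "invertible (mat_of v)" by (simp add: matrix_right_invertible_span_columns[symmetric] invertible_right_inverse)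
  then show ?thesis using S by (auto simp: frame_def mat_of_def)
qed

lemma normal_form:
  assumes v: "frame v" and nodes: "\<forall>p\<in>Sing F. node F p"
  shows "\<exists>v' b12 b13 b14 b23 b24 b34 L N \<kappa> s. frame v' \<and> (\<forall>i. vec.span {v' i} = vec.span {v i}) \<and>
    factorial_cubic b12 b13 b14 b23 b24 b34 L N \<kappa> \<and> s \<noteq> 0 \<and>
    (\<forall>x. peval F (mat_of v' *v x) = s * nodal_cubic.P b12 b13 b14 b23 b24 b34 x)"
proof -
  interpret a: node_coeffs "\<lambda>i j k. S (v i) (v j) (v k)" by (rule frame_node_coeffs[OF v nodes])
  \<comment> \<open>Each of the first four vectors is scaled by the coefficient of the opposite
    triple; the four coefficients without the fifth node then all become
    \<open>c 1 * c 2 * c 3 * c 4\<close>.\<close>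
  define c where "c i = (if i = 1 then S (v 2) (v 3) (v 4) else if i = 2 then S (v 1) (v 3) (v 4)
     else if i = 3 then S (v 1) (v 2) (v 4) else if i = 4 then S (v 1) (v 2) (v 3) else 1)" for i :: 5
  have c0: "c i \<noteq> 0" for i
    using a.a_nonzero[of 2 3 4 1 5] a.a_nonzero[of 1 3 4 2 5] a.a_nonzero[of 1 2 4 3 5] a.a_nonzero[of 1 2 3 4 5]
    by (simp add: c_def)
  define v' where "v' i = c i *s v i" for i
  have v': "frame v'" unfolding v'_def by (rule frame_scale[OF v c0])
  interpret a': node_coeffs "\<lambda>i j k. S (v' i) (v' j) (v' k)" by (rule frame_node_coeffs[OF v' nodes])
  define m where "m = c 1 * c 2 * c 3 * c 4"
  have m0: "m \<noteq> 0" using c0 by (simp add: m_def)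
  have cs: "c 1 = S (v 2) (v 3) (v 4)" "c 2 = S (v 1) (v 3) (v 4)" "c 3 = S (v 1) (v 2) (v 4)" "c 4 = S (v 1) (v 2) (v 3)"
    by (simp_all add: c_def)
  have m: "S (v' 2) (v' 3) (v' 4) = m" "S (v' 1) (v' 3) (v' 4) = m" "S (v' 1) (v' 2) (v' 4) = m" "S (v' 1) (v' 2) (v' 3) = m"
    by (simp_all add: v'_def m_def S_linear cs[symmetric])
  let ?b = "\<lambda>i j. S (v' i) (v' j) (v' 5) / m"
  obtain L N \<kappa> where fc: "factorial_cubic (?b 1 2) (?b 1 3) (?b 1 4) (?b 2 3) (?b 2 4) (?b 3 4) L N \<kappa>"
    using a'.factorial_cubic_exists[OF m] by blast
  interpret fc: factorial_cubic "?b 1 2" "?b 1 3" "?b 1 4" "?b 2 3" "?b 2 4" "?b 3 4" L N \<kappa> by (rule fc)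
  have pe: "peval F (mat_of v' *v x) = 6 * m * fc.P x" for x
  proof -
    have e: "m * (y / m * z) = y * z" for y z using m0 by simp
    have "m * fc.P x = x $ 5 * (m * (?b 1 2 * (x $ 1 * x $ 2)) + m * (?b 1 3 * (x $ 1 * x $ 3)) + m * (?b 1 4 * (x $ 1 * x $ 4))
      + m * (?b 2 3 * (x $ 2 * x $ 3)) + m * (?b 2 4 * (x $ 2 * x $ 4)) + m * (?b 3 4 * (x $ 3 * x $ 4)))
      + m * (x $ 2 * x $ 3 * x $ 4 + x $ 1 * x $ 3 * x $ 4 + x $ 1 * x $ 2 * x $ 4 + x $ 1 * x $ 2 * x $ 3)"
      unfolding fc.P_def fc.q_def fc.c_def pr4_nth by (simp only: distrib_left mult.assoc mult.left_commute)
    then show ?thesis unfolding F_S S_mat_of a'.cubic_sum m e mult.assoc[of 6] by (simp add: algebra_simps)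
  qed
  have s0: "6 * m \<noteq> 0" using m0 by simp
  have sp: "\<forall>i. vec.span {v' i} = vec.span {v i}" unfolding v'_def using c0 span_scale by blast
  show ?thesis by (intro exI conjI, rule v', rule sp, rule fc, rule s0, intro allI, rule pe)
qed

end

section \<open>The Zariski topology\<close>

definition nonvanishing :: "('k::field ^ 'n::finite \<Rightarrow> 'k) \<Rightarrow> ('k ^ 'n) set set" where
  "nonvanishing H = {vec.span {v} | v. v \<noteq> 0 \<and> H v \<noteq> 0}"

lemma form_span_nonzero:
  assumes "form e H" "vec.span {v} = vec.span {w}" "v \<noteq> 0"
  shows "H v \<noteq> 0 \<longleftrightarrow> H w \<noteq> 0"
  using span_eq_imp_scale[OF assms(2,3)] form_scale[OF assms(1)] by auto

lemma span_in_nonvanishing: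
  assumes "form e H" "v \<noteq> 0"
  shows "vec.span {v} \<in> nonvanishing H \<longleftrightarrow> H v \<noteq> 0"
proof
  assume "vec.span {v} \<in> nonvanishing H"
  then obtain w where "vec.span {v} = vec.span {w}" "H w \<noteq> 0" unfolding nonvanishing_def by blast
  then show "H v \<noteq> 0" using form_span_nonzero[OF assms(1) _ assms(2)] by blast
next
  assume "H v \<noteq> 0"
  then show "vec.span {v} \<in> nonvanishing H" unfolding nonvanishing_def using assms(2) by blast
qed

lemma span_in_hypersurface:
  fixes F :: "('n::finite, 'k::field) mpoly"
  assumes "form e (peval F)" "v \<noteq> 0"
  shows "vec.span {v} \<in> hypersurface F \<longleftrightarrow> peval F v = 0"
proof
  assume "vec.span {v} \<in> hypersurface F"
  then show "peval F v = 0" unfolding hypersurface_def using vec.span_base[of v "{v}"] by blast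
next
  assume "peval F v = 0"
  then have "peval F u = 0" if "u \<in> vec.span {v}" for u
    using that form_scale[OF assms(1), of _ v] by (auto simp: span_singleton)
  then show "vec.span {v} \<in> hypersurface F" unfolding hypersurface_def proj_space_def using assms(2) by blast
qed

lemma in_proj_space: "p \<in> proj_space \<longleftrightarrow> (\<exists>v. v \<noteq> 0 \<and> p = vec.span {v})"
  unfolding proj_space_def by blast

lemma nonvanishing_open:
  assumes "form e H"
  shows "openin zariski (nonvanishing H)"
proof (cases "e < 0")
  case True
  then have "nonvanishing H = {}" using form_neg[OF assms] by (auto simp: nonvanishing_def)
  then show ?thesis by simp
next
  case False
  then obtain Q where Q: "homogeneous (nat e) Q" "peval Q = H" using form_imp_peval[OF assms] by auto
  have iff: "vec.span {v} \<in> nonvanishing H \<longleftrightarrow> vec.span {v} \<notin> hypersurface Q" if "v \<noteq> 0" for v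
    using span_in_hypersurface[of e Q v] span_in_nonvanishing[of e H v] assms Q(2) that by simp
  have "p \<in> nonvanishing H \<longleftrightarrow> p \<in> proj_space - hypersurface Q" for p
  proof (cases "p \<in> proj_space")
    case True
    then obtain v where "v \<noteq> 0" "p = vec.span {v}" unfolding in_proj_space by blast
    with iff[of v] True show ?thesis by simp
  next
    case False
    then have "p \<notin> nonvanishing H" unfolding nonvanishing_def proj_space_def by fast
    with False show ?thesis by simp
  qed
  then have "nonvanishing H = proj_space - hypersurface Q" by blast
  moreover have "openin zariski (proj_space - hypersurface Q)"
    unfolding zariski_def by (rule topology_generated_by_Basis, rule CollectI) (intro exI conjI, rule refl, rule Q(1))
  ultimately show ?thesis by simp
qed

lemma nonvanishing_one: "nonvanishing (\<lambda>_. 1) = (proj_space :: ('k::field ^ 'n::finite) set set)"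
  unfolding nonvanishing_def proj_space_def by simp

lemma topspace_zariski: "topspace (zariski :: ('k::field ^ 'n::finite) set topology) = proj_space"
proof (rule subset_antisym)
  show "topspace (zariski :: ('k ^ 'n) set topology) \<subseteq> proj_space"
    unfolding zariski_def topology_generated_by_topspace by (rule Union_least) auto
  have "openin zariski (nonvanishing (\<lambda>_ :: 'k ^ 'n. 1 :: 'k))" by (rule nonvanishing_open) (rule form_const)
  then have "nonvanishing (\<lambda>_ :: 'k ^ 'n. 1 :: 'k) \<subseteq> topspace zariski" by (rule openin_subset)
  then show "(proj_space :: ('k ^ 'n) set set) \<subseteq> topspace zariski" by (simp only: nonvanishing_one)
qed

text \<open>The complements of hypersurfaces generate the topology as a subbasis; multiplying forms
  replaces a finite intersection by a single complement.\<close>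

lemma zariski_open_nonvanishing:
  fixes v :: "'k::field ^ 'n::finite"
  assumes "openin zariski U" "vec.span {v} \<in> U" "v \<noteq> 0"
  shows "\<exists>e H. form e H \<and> H v \<noteq> 0 \<and> nonvanishing H \<subseteq> U"
proof -
  have "generate_topology_on {proj_space - hypersurface F | F d. homogeneous d F} U"
    using assms(1) unfolding zariski_def openin_topology_generated_by_iff .
  then show ?thesis using assms(2)
  proof (induction rule: generate_topology_on.induct)
    case Empty then show ?case by simp
  next
    case (Int a b)
    then obtain e H e' H' where H: "form e H" "H v \<noteq> 0" "nonvanishing H \<subseteq> a"
      "form e' H'" "H' v \<noteq> 0" "nonvanishing H' \<subseteq> b" by blast
    have "nonvanishing (\<lambda>x. H x * H' x) \<subseteq> a \<inter> b" using H(3,6) by (auto simp: nonvanishing_def)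
    then show ?case using form_mult[OF H(1,4)] H(2,5)
      by (intro exI[of _ "e + e'"] exI[of _ "\<lambda>x. H x * H' x"]) simp
  next
    case (UN K)
    then obtain k where k: "k \<in> K" "vec.span {v} \<in> k" by auto
    from UN.IH[OF k] obtain e H where "form e H" "H v \<noteq> 0" "nonvanishing H \<subseteq> k" by blast
    then show ?case using k(1) by blast
  next
    case (Basis s)
    then obtain Q d where Q: "s = proj_space - hypersurface Q" "homogeneous d Q" by auto
    note fQ = form_peval[OF Q(2)]
    have "peval Q v \<noteq> 0" using Basis.prems span_in_hypersurface[OF fQ \<open>v \<noteq> 0\<close>] by (auto simp: Q(1))
    moreover have "nonvanishing (peval Q) \<subseteq> s"
      using span_in_hypersurface[OF fQ] by (auto simp: Q(1) nonvanishing_def in_proj_space)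
    ultimately show ?case using fQ by blast
  qed
qed

lemma regular_map_local_forms:
  fixes X :: "('k::field ^ 'n::finite) set set" and v :: "'k ^ 'n"
  assumes "regular_map X Y \<phi>" "vec.span {v} \<in> X" "v \<noteq> 0"
  shows "\<exists>e H d h. form e H \<and> (\<forall>j. form d (h j)) \<and> H v \<noteq> 0 \<and>
    (\<forall>w. vec.span {w} \<in> X \<longrightarrow> w \<noteq> 0 \<longrightarrow> H w \<noteq> 0 \<longrightarrow> (\<chi> j. h j w) \<noteq> 0 \<and> \<phi> (vec.span {w}) = vec.span {\<chi> j. h j w})"
proof -
  from bspec[OF conjunct2[OF assms(1)[unfolded regular_map_def]] assms(2)]
  obtain U d f where U: "openin (subtopology zariski X) U" "vec.span {v} \<in> U" "\<forall>j. homogeneous d (f j)"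
    and f: "\<forall>q\<in>U. \<forall>v\<in>q - {0}. (\<chi> j. peval (f j) v) \<noteq> 0 \<and> \<phi> q = vec.span {\<chi> j. peval (f j) v}"
    by (elim exE conjE)
  obtain V where V: "openin zariski V" "U = V \<inter> X" using U(1) unfolding openin_subtopology by (elim exE conjE)
  have vV: "vec.span {v} \<in> V" using U(2) unfolding V(2) by (rule IntD1)
  obtain e H where H: "form e H" "H v \<noteq> 0" "nonvanishing H \<subseteq> V"
    using zariski_open_nonvanishing[OF V(1) vV assms(3)] by (elim exE conjE)
  have fo: "\<forall>j. form (int d) (peval (f j))" using U(3) form_peval by blast
  have "(\<chi> j. peval (f j) w) \<noteq> 0 \<and> \<phi> (vec.span {w}) = vec.span {\<chi> j. peval (f j) w}"
    if "vec.span {w} \<in> X" "w \<noteq> 0" "H w \<noteq> 0" for w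
  proof -
    have "vec.span {w} \<in> nonvanishing H" unfolding nonvanishing_def using that(2,3) by blast
    then have "vec.span {w} \<in> U" unfolding V(2) using H(3) that(1) by (intro IntI) (rule subsetD)
    moreover have "w \<in> vec.span {w} - {0}" using that(2) by (simp add: vec.span_base)
    ultimately show ?thesis using f by blast
  qed
  with H(1,2) fo show ?thesis by (intro exI[of _ e] exI[of _ H] exI[of _ "int d"] exI[of _ "\<lambda>j. peval (f j)"] conjI allI impI) simp_all
qed

lemma image_span_singleton:
  fixes B :: "'k::field ^ 'n::finite ^ 'm::finite"
  shows "(*v) B ` vec.span {u} = vec.span {B *v u}"
  unfolding span_singleton image_image by (simp add: vector_scalar_commute)

locale five_nodal_cubic = cubic S F
  for S :: "'k::{alg_closed_field,field_char_0} ^ 5 \<Rightarrow> 'k ^ 5 \<Rightarrow> 'k ^ 5 \<Rightarrow> 'k" and F +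
  assumes card_Sing: "card (Sing F) = 5" and nodes: "\<forall>p\<in>Sing F. node F p"
    and position: "general_linear_position (Sing F)" and form_F: "form 3 (peval F)"
begin

lemma normal_form_obtain:
  assumes v: "frame v"
  obtains v' b12 b13 b14 b23 b24 b34 L N \<kappa> s where "frame v'" "\<And>i. vec.span {v' i} = vec.span {v i}"
    "factorial_cubic b12 b13 b14 b23 b24 b34 L N \<kappa>"
    "s \<noteq> 0" "\<And>x. peval F (mat_of v' *v x) = s * nodal_cubic.P b12 b13 b14 b23 b24 b34 x"
proof -
  from normal_form[OF v nodes] obtain v' b12 b13 b14 b23 b24 b34 L N \<kappa> s where 1: "frame v'"
    and 2: "\<forall>i. vec.span {v' i} = vec.span {v i}"
    and 3: "factorial_cubic b12 b13 b14 b23 b24 b34 L N \<kappa>" and 4: "s \<noteq> 0"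
    and 5: "\<forall>x. peval F (mat_of v' *v x) = s * nodal_cubic.P b12 b13 b14 b23 b24 b34 x"
    by (elim exE conjE)
  show ?thesis by (rule that[OF 1 2[rule_format] 3 4 5[rule_format]])
qed

lemma irreducible_F:
  assumes a: "form n a" and b: "form m b" and ab: "\<And>x. peval F x = 0 \<Longrightarrow> a x * b x = 0"
  shows "(\<forall>x. peval F x = 0 \<longrightarrow> a x = 0) \<or> (\<forall>x. peval F x = 0 \<longrightarrow> b x = 0)"
proof -
  obtain v0 where "frame v0" using frame_exists[OF card_Sing position] by blast
  then obtain v b12 b13 b14 b23 b24 b34 L N \<kappa> s where v: "frame v"
    and "\<And>i. vec.span {v i} = vec.span {v0 i}" and fc: "factorial_cubic b12 b13 b14 b23 b24 b34 L N \<kappa>"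
    and s: "s \<noteq> 0" "\<And>x. peval F (mat_of v *v x) = s * nodal_cubic.P b12 b13 b14 b23 b24 b34 x"
    by (rule normal_form_obtain) (rule that)
  interpret fc: factorial_cubic b12 b13 b14 b23 b24 b34 L N \<kappa> by (rule fc)
  have z: "fc.P x = 0 \<longleftrightarrow> peval F (mat_of v *v x) = 0" for x using s by simp
  have "(\<forall>x. fc.P x = 0 \<longrightarrow> a (mat_of v *v x) = 0) \<or> (\<forall>x. fc.P x = 0 \<longrightarrow> b (mat_of v *v x) = 0)"
    by (rule fc.irreducible_P[OF form_comp1[OF a form_linear] form_comp1[OF b form_linear]]) (simp add: z ab)
  then show ?thesis unfolding z using frame_inv(1)[OF v] by metis
qed

text \<open>Provides a point of the cubic in general position with respect to finitely many
  conditions.\<close>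

lemma irreducible_F_prod:
  assumes "finite A" "\<And>i. i \<in> A \<Longrightarrow> form (n i) (a i)" "\<And>i. i \<in> A \<Longrightarrow> \<exists>x. peval F x = 0 \<and> a i x \<noteq> 0"
  shows "\<exists>x. peval F x = 0 \<and> (\<forall>i\<in>A. a i x \<noteq> 0)"
proof -
  have "form (\<Sum>i\<in>A. n i) (\<lambda>x. \<Prod>i\<in>A. a i x) \<and> (\<exists>x. peval F x = 0 \<and> (\<Prod>i\<in>A. a i x) \<noteq> 0)"
    using assms
  proof (induction A rule: finite_induct)
    case empty
    have "peval F 0 = 0" using form_at_0[OF form_F] by simp
    then show ?case using form_const[of 1] by auto
  next
    case (insert i A)
    then have 1: "form (\<Sum>i\<in>A. n i) (\<lambda>x. \<Prod>i\<in>A. a i x)" "\<exists>x. peval F x = 0 \<and> (\<Prod>i\<in>A. a i x) \<noteq> 0"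
      "form (n i) (a i)" "\<exists>x. peval F x = 0 \<and> a i x \<noteq> 0" by auto
    have "\<exists>x. peval F x = 0 \<and> a i x * (\<Prod>i\<in>A. a i x) \<noteq> 0"
      using irreducible_F[OF 1(3,1)] 1(2,4) by blast
    then show ?case using form_mult[OF 1(3,1)] insert.hyps by simp
  qed
  then show ?thesis using assms(1) by auto
qed

text \<open>The matrix \<open>M\<close> of a frame transports the local representations of the
  automorphism and of its inverse to the normal form, where linearity is known; the result is
  conjugated back.\<close>

lemma Aut_linear:
  assumes "\<phi> \<in> Aut (hypersurface F)"
  shows "\<exists>A t. invertible A \<and> (\<forall>w. peval F w = 0 \<longrightarrow> w \<noteq> 0 \<longrightarrow> \<phi> (vec.span {w}) = vec.span {A *v w}) \<and>
    (\<forall>x. peval F (A *v x) = t * peval F x)"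
proof -
  let ?X = "hypersurface F"
  obtain v0 where "frame v0" using frame_exists[OF card_Sing position] by blast
  then obtain v b12 b13 b14 b23 b24 b34 L N \<kappa> s where v: "frame v"
    and "\<And>i. vec.span {v i} = vec.span {v0 i}" and fc: "factorial_cubic b12 b13 b14 b23 b24 b34 L N \<kappa>"
    and s: "s \<noteq> 0" "\<And>x. peval F (mat_of v *v x) = s * nodal_cubic.P b12 b13 b14 b23 b24 b34 x"
    by (rule normal_form_obtain) (rule that)
  interpret fc: factorial_cubic b12 b13 b14 b23 b24 b34 L N \<kappa> by (rule fc)
  define M where "M = mat_of v"
  define M' where "M' = matrix_inv M"
  have MM: "M *v (M' *v x) = x" "M' *v (M *v x) = x" for x using frame_inv[OF v] by (simp_all add: M_def M'_def)
  have M0: "M *v x = 0 \<longleftrightarrow> x = 0" "M' *v x = 0 \<longleftrightarrow> x = 0" for x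
    by (metis MM matrix_vector_mult_0_right)+
  have z: "fc.P x = 0 \<longleftrightarrow> peval F (M *v x) = 0" for x using s by (simp add: M_def)
  have X: "vec.span {M *v x} \<in> ?X \<longleftrightarrow> fc.P x = 0" if "x \<noteq> 0" for x
    using span_in_hypersurface[OF form_F, of "M *v x"] that M0 z by simp
  have loc: "\<exists>e H d h. fc.local_forms (\<lambda>x. (*v) M' ` \<psi> (vec.span {M *v x})) p e H d h"
    if psi: "regular_map ?X ?X \<psi>" and p: "fc.P p = 0" "p \<noteq> 0" for \<psi> p
  proof -
    have "M *v p \<noteq> 0" "vec.span {M *v p} \<in> ?X" using p X M0 by auto
    from regular_map_local_forms[OF psi this(2,1)] obtain e H d h where
      H: "form e H" "\<forall>j. form d (h j)" "H (M *v p) \<noteq> 0" and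
      h: "\<And>w. vec.span {w} \<in> ?X \<Longrightarrow> w \<noteq> 0 \<Longrightarrow> H w \<noteq> 0 \<Longrightarrow> (\<chi> j. h j w) \<noteq> 0 \<and> \<psi> (vec.span {w}) = vec.span {\<chi> j. h j w}"
      by blast
    define h' where "h' j x = (M' *v (\<chi> j. h j (M *v x))) $ j" for j x
    have h'v: "(\<chi> j. h' j x) = M' *v (\<chi> j. h j (M *v x))" for x
      by (simp add: h'_def Finite_Cartesian_Product.vec_eq_iff)
    have hM: "form d (\<lambda>x. h j (M *v x))" for j by (rule form_comp1[OF H(2)[rule_format] form_linear])
    have "form (1 * d) (h' j)" for j unfolding h'_def
      by (rule form_comp[OF form_linear]) (simp add: hM)
    then have 1: "form d (h' j)" for j by simp
    have 2: "form e (\<lambda>x. H (M *v x))" by (rule form_comp1[OF H(1) form_linear])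
    have "fc.local_forms (\<lambda>x. (*v) M' ` \<psi> (vec.span {M *v x})) p e (\<lambda>x. H (M *v x)) d h'"
      unfolding fc.local_forms_def
    proof (intro conjI allI impI)
      fix w assume w: "fc.P w = 0" "w \<noteq> 0" "H (M *v w) \<noteq> 0"
      have hw: "(\<chi> j. h j (M *v w)) \<noteq> 0" "\<psi> (vec.span {M *v w}) = vec.span {\<chi> j. h j (M *v w)}"
        using h[of "M *v w"] X[OF w(2)] w M0 by auto
      show "(\<chi> j. h' j w) \<noteq> 0" unfolding h'v using hw(1) M0 by blast
      show "(*v) M' ` \<psi> (vec.span {M *v w}) = vec.span {\<chi> j. h' j w}"
        unfolding h'v hw(2) by (rule image_span_singleton)
    qed (use 1 2 H(3) in auto)
    then show ?thesis by blast
  qed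
  have bi: "bij_betw \<phi> ?X ?X" "regular_map ?X ?X \<phi>" "regular_map ?X ?X (inv_into ?X \<phi>)"
    using assms by (auto simp: Aut_def biregular_map_def)
  have img: "(*v) M ` ((*v) M' ` A) = A" for A by (simp add: image_image MM)
  have "\<exists>A t. invertible A \<and> (\<forall>w. fc.P w = 0 \<longrightarrow> w \<noteq> 0 \<longrightarrow> (*v) M' ` \<phi> (vec.span {M *v w}) = vec.span {A *v w})
     \<and> (\<forall>x. fc.P (A *v x) = t * fc.P x)"
  proof (rule fc.linear_automorphism[OF loc[OF bi(2)] loc[OF bi(3)]])
    fix w u assume w: "fc.P w = 0" "w \<noteq> 0" and u: "u \<noteq> 0" and e: "(*v) M' ` \<phi> (vec.span {M *v w}) = vec.span {u}"
    have "\<phi> (vec.span {M *v w}) = vec.span {M *v u}" using arg_cong[OF e, of "(`) ((*v) M)"]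
      unfolding img image_span_singleton .
    moreover have wX: "vec.span {M *v w} \<in> ?X" using X w by blast
    ultimately have uX: "vec.span {M *v u} \<in> ?X" "inv_into ?X \<phi> (vec.span {M *v u}) = vec.span {M *v w}"
      using bi(1) by (metis bij_betwE, metis bij_betw_inv_into_left)
    then show "fc.P u = 0 \<and> (*v) M' ` inv_into ?X \<phi> (vec.span {M *v u}) = vec.span {w}"
      using X[OF u] by (simp add: image_span_singleton MM)
  qed
  then obtain A t where A: "invertible A" "\<And>w. fc.P w = 0 \<Longrightarrow> w \<noteq> 0 \<Longrightarrow> (*v) M' ` \<phi> (vec.span {M *v w}) = vec.span {A *v w}"
    "\<And>x. fc.P (A *v x) = t * fc.P x" by blast
  define B where "B = M ** A ** M'"
  have B: "B *v x = M *v (A *v (M' *v x))" for x by (simp add: B_def matrix_vector_mul_assoc matrix_mul_assoc)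
  have "invertible B" unfolding invertible_iff_kernel B using A(1) M0 by (metis invertible_iff_kernel)
  moreover have "\<phi> (vec.span {w}) = vec.span {B *v w}" if w: "peval F w = 0" "w \<noteq> 0" for w
  proof -
    have "fc.P (M' *v w) = 0" "M' *v w \<noteq> 0" using w z[of "M' *v w"] M0 by (simp_all add: MM)
    from A(2)[OF this] have "(*v) M' ` \<phi> (vec.span {w}) = vec.span {A *v (M' *v w)}" by (simp add: MM)
    from arg_cong[OF this, of "(`) ((*v) M)"] show ?thesis unfolding img image_span_singleton B .
  qed
  moreover have "peval F (B *v x) = t * peval F x" for x
  proof -
    have "peval F (B *v x) = s * fc.P (A *v (M' *v x))" unfolding B M_def s(2) ..
    also have "\<dots> = t * (s * fc.P (M' *v x))" unfolding A(3) by simp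
    also have "\<dots> = t * peval F x" unfolding s(2)[symmetric] M_def[symmetric] MM ..
    finally show ?thesis .
  qed
  ultimately show ?thesis by blast
qed

end

section \<open>Birational maps given by forms\<close>

lemma regular_map_of_forms:
  fixes fv :: "'k::field ^ 'n::finite \<Rightarrow> 'k ^ 'm::finite"
  assumes X: "X \<subseteq> proj_space" and fv: "\<And>i. form d (\<lambda>x. fv x $ i)"
    and \<phi>: "\<And>v. v \<noteq> 0 \<Longrightarrow> vec.span {v} \<in> X \<Longrightarrow> fv v \<noteq> 0 \<and> \<phi> (vec.span {v}) = vec.span {fv v} \<and> vec.span {fv v} \<in> Y"
  shows "regular_map X Y \<phi>"
  unfolding regular_map_def
proof (intro conjI ballI)
  show "\<phi> \<in> X \<rightarrow> Y"
  proof
    fix p assume p: "p \<in> X"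
    then obtain v where "v \<noteq> 0" "p = vec.span {v}" using X in_proj_space by blast
    then show "\<phi> p \<in> Y" using \<phi>[of v] p by simp
  qed
  fix p assume p: "p \<in> X"
  then obtain v where v: "v \<noteq> 0" "p = vec.span {v}" using X in_proj_space by blast
  have "fv v \<noteq> 0" using \<phi>[of v] p v by simp
  then obtain i where "fv v $ i \<noteq> 0" by (auto simp: Finite_Cartesian_Product.vec_eq_iff)
  then have d: "d \<ge> 0" using form_neg[OF fv, of v i] by linarith
  define f where "f i = (SOME P. homogeneous (nat d) P \<and> peval P = (\<lambda>x. fv x $ i))" for i
  have f: "homogeneous (nat d) (f i)" "peval (f i) = (\<lambda>x. fv x $ i)" for i
    using someI_ex[OF form_imp_peval[OF fv d], of i] unfolding f_def by blast+
  have fx: "(\<chi> j. peval (f j) x) = fv x" for x by (simp add: f(2) Finite_Cartesian_Product.vec_eq_iff)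
  show "\<exists>U d f. openin (subtopology zariski X) U \<and> p \<in> U \<and> (\<forall>j. homogeneous d (f j)) \<and>
        (\<forall>q\<in>U. \<forall>v\<in>q - {0}. (\<chi> j. peval (f j) v) \<noteq> 0 \<and> \<phi> q = vec.span {\<chi> j. peval (f j) v})"
  proof (rule exI[of _ X], rule exI[of _ "nat d"], rule exI[of _ f], intro conjI ballI allI)
    show "openin (subtopology zariski X) X"
      using X topspace_zariski by (metis openin_topspace topspace_subtopology_subset)
    show "p \<in> X" by (rule p)
    show "homogeneous (nat d) (f j)" for j by (rule f(1))
    fix q w assume q: "q \<in> X" and w: "w \<in> q - {0}"
    obtain u where u: "u \<noteq> 0" "q = vec.span {u}" using X q in_proj_space by blast
    from w u obtain t where t: "w = t *s u" "t \<noteq> 0" by (auto simp: span_singleton)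
    have qw: "q = vec.span {w}" unfolding u(2) t(1) by (rule span_scale[OF t(2), symmetric])
    have w0: "w \<noteq> 0" using w by simp
    show "(\<chi> j. peval (f j) w) \<noteq> 0" "\<phi> q = vec.span {\<chi> j. peval (f j) w}"
      unfolding fx using \<phi>[OF w0] q qw by auto
  qed
qed

text \<open>The hypothesis \<open>irr\<close> is irreducibility of \<open>X\<close>: two principal
  open sets that meet \<open>X\<close> have a common point on it. It is kept abstract to cover both
  the cubic and the projective space.\<close>

lemma dense_nonvanishing:
  fixes X :: "('k::field ^ 'n::finite) set set"
  assumes X: "X \<subseteq> proj_space" and H: "form e H" and v0: "vec.span {v0} \<in> X" "v0 \<noteq> 0" "H v0 \<noteq> 0"
    and irr: "\<And>n a m b. form n a \<Longrightarrow> form m b \<Longrightarrow> (\<exists>v. v \<noteq> 0 \<and> vec.span {v} \<in> X \<and> a v \<noteq> 0) \<Longrightarrow>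
      (\<exists>v. v \<noteq> 0 \<and> vec.span {v} \<in> X \<and> b v \<noteq> 0) \<Longrightarrow> \<exists>v. v \<noteq> 0 \<and> vec.span {v} \<in> X \<and> a v \<noteq> 0 \<and> b v \<noteq> 0"
  shows "subtopology zariski X closure_of (X \<inter> nonvanishing H) = X"
proof -
  have ts: "topspace (subtopology zariski X) = X"
    using X topspace_zariski by (metis topspace_subtopology_subset)
  have "p \<in> subtopology zariski X closure_of (X \<inter> nonvanishing H)" if p: "p \<in> X" for p
    unfolding in_closure_of ts
  proof (intro conjI allI impI)
    show "p \<in> X" by (rule p)
    fix T assume T: "p \<in> T \<and> openin (subtopology zariski X) T"
    obtain v where v: "v \<noteq> 0" "p = vec.span {v}" using X p in_proj_space by blast
    obtain V where V: "openin zariski V" "T = V \<inter> X" using T unfolding openin_subtopology by blast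
    have "vec.span {v} \<in> V" using T V(2) v(2) by blast
    from zariski_open_nonvanishing[OF V(1) this v(1)] obtain e' H' where
      H': "form e' H'" "H' v \<noteq> 0" "nonvanishing H' \<subseteq> V" by (elim exE conjE)
    obtain w where w: "w \<noteq> 0" "vec.span {w} \<in> X" "H w \<noteq> 0" "H' w \<noteq> 0"
      using irr[OF H H'(1)] v0 H'(2) v p by blast
    have "vec.span {w} \<in> nonvanishing H" "vec.span {w} \<in> nonvanishing H'"
      using w span_in_nonvanishing[OF H] span_in_nonvanishing[OF H'(1)] by auto
    then show "\<exists>y. y \<in> X \<inter> nonvanishing H \<and> y \<in> T" using w(2) H'(3) V(2) by blast
  qed
  moreover have "subtopology zariski X closure_of (X \<inter> nonvanishing H) \<subseteq> X"
    using closure_of_subset_topspace[of "subtopology zariski X"] ts by blast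
  ultimately show ?thesis by blast
qed

lemma some_representative:
  assumes "v \<noteq> 0"
  shows "\<exists>c. c \<noteq> 0 \<and> (SOME w. w \<noteq> 0 \<and> vec.span {v} = vec.span {w}) = c *s (v :: 'k::field ^ 'n::finite)"
proof -
  have "(SOME w. w \<noteq> 0 \<and> vec.span {v} = vec.span {w}) \<noteq> 0 \<and>
     vec.span {v} = vec.span {SOME w. w \<noteq> 0 \<and> vec.span {v} = vec.span {w}}"
    by (rule someI[of "\<lambda>w. w \<noteq> 0 \<and> vec.span {v} = vec.span {w}" v]) (use assms in simp)
  then show ?thesis using span_eq_imp_scale[of "SOME w. w \<noteq> 0 \<and> vec.span {v} = vec.span {w}" v] by simp
qed

text \<open>For a tuple of forms of one degree the chosen representative matters only up to a
  nonzero factor, see \<open>proj_map_span\<close>.\<close>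

definition proj_map :: "('k::field ^ 'n::finite \<Rightarrow> 'k ^ 'm::finite) \<Rightarrow> ('k ^ 'n) set \<Rightarrow> ('k ^ 'm) set" where
  "proj_map f p = vec.span {f (SOME v. v \<noteq> 0 \<and> p = vec.span {v})}"

lemma proj_map_span:
  fixes f :: "'k::field ^ 'n::finite \<Rightarrow> 'k ^ 'm::finite"
  assumes f: "\<And>i. form d (\<lambda>x. f x $ i)" and v: "v \<noteq> 0"
  shows "proj_map f (vec.span {v}) = vec.span {f v}"
proof -
  obtain c where c: "c \<noteq> 0" "(SOME w. w \<noteq> 0 \<and> vec.span {v} = vec.span {w}) = c *s v"
    using some_representative[OF v] by blast
  have "f (c *s v) = c ^ nat d *s f v"
    using form_scale[OF f] by (simp add: Finite_Cartesian_Product.vec_eq_iff)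
  then show ?thesis unfolding proj_map_def c(2) using span_scale[of "c ^ nat d"] c(1) by simp
qed

context five_nodal_cubic
begin

lemma X_span: "v \<noteq> 0 \<Longrightarrow> vec.span {v} \<in> hypersurface F \<longleftrightarrow> peval F v = 0"
  by (rule span_in_hypersurface[OF form_F])

text \<open>\<open>H\<close> and \<open>K\<close> cut out open sets between which \<open>fv\<close>
  and \<open>gv\<close> are mutually inverse up to scalars. The point \<open>x0\<close> shows that
  these sets are nonempty, and irreducibility makes them dense.\<close>

lemma equivariantly_birational_of_forms:
  fixes fv :: "'k ^ 5 \<Rightarrow> 'k ^ 4" and gv :: "'k ^ 4 \<Rightarrow> 'k ^ 5"
  assumes fv: "\<And>i. form d (\<lambda>x. fv x $ i)" and gv: "\<And>i. form e (\<lambda>z. gv z $ i)"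
    and H: "form dH H" and K: "form dK K"
    and fg: "\<And>x. peval F x = 0 \<Longrightarrow> x \<noteq> 0 \<Longrightarrow> H x \<noteq> 0 \<Longrightarrow> fv x \<noteq> 0 \<and> K (fv x) \<noteq> 0 \<and> (\<exists>\<mu>. \<mu> \<noteq> 0 \<and> gv (fv x) = \<mu> *s x)"
    and gf: "\<And>z. z \<noteq> 0 \<Longrightarrow> K z \<noteq> 0 \<Longrightarrow> peval F (gv z) = 0 \<and> gv z \<noteq> 0 \<and> H (gv z) \<noteq> 0 \<and> (\<exists>\<nu>. \<nu> \<noteq> 0 \<and> fv (gv z) = \<nu> *s z)"
    and x0: "peval F x0 = 0" "x0 \<noteq> 0" "H x0 \<noteq> 0"
    and act: "\<And>g x. g \<in> G \<Longrightarrow> peval F x = 0 \<Longrightarrow> x \<noteq> 0 \<Longrightarrow> H x \<noteq> 0 \<Longrightarrow>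
       \<exists>y. \<alpha> g (vec.span {x}) = vec.span {y} \<and> y \<noteq> 0 \<and> (\<exists>c. c \<noteq> 0 \<and> fv y = c *s (R g *v fv x))"
  shows "equivariantly_birational G (hypersurface F) \<alpha> proj_space (\<lambda>g. proj_action (R g))"
proof -
  let ?X = "hypersurface F" and ?Y = "proj_space :: ('k ^ 4) set set"
  define U where "U = ?X \<inter> nonvanishing H"
  define W where "W = nonvanishing K"
  let ?\<phi> = "proj_map fv" and ?\<psi> = "proj_map gv"
  have X: "?X \<subseteq> proj_space" by (auto simp: hypersurface_def)
  have U_iff: "vec.span {x} \<in> U \<longleftrightarrow> peval F x = 0 \<and> H x \<noteq> 0" if "x \<noteq> 0" for x
    unfolding U_def using X_span[OF that] span_in_nonvanishing[OF H that] by simp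
  have W_iff: "vec.span {z} \<in> W \<longleftrightarrow> K z \<noteq> 0" if "z \<noteq> 0" for z
    unfolding W_def using span_in_nonvanishing[OF K that] by simp
  have UP: "U \<subseteq> proj_space" using X by (auto simp: U_def)
  have WP: "W \<subseteq> proj_space" unfolding W_def nonvanishing_def proj_space_def by fast
  have \<phi>1: "fv x \<noteq> 0" "?\<phi> (vec.span {x}) = vec.span {fv x}" "vec.span {fv x} \<in> W" "?\<psi> (vec.span {fv x}) = vec.span {x}"
    if "x \<noteq> 0" "vec.span {x} \<in> U" for x
  proof -
    have x: "peval F x = 0" "H x \<noteq> 0" using U_iff that by auto
    from fg[OF x(1) that(1) x(2)] obtain \<mu> where m: "fv x \<noteq> 0" "K (fv x) \<noteq> 0" "\<mu> \<noteq> 0" "gv (fv x) = \<mu> *s x" by blast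
    show "fv x \<noteq> 0" by (rule m)
    show "?\<phi> (vec.span {x}) = vec.span {fv x}" by (rule proj_map_span[OF fv that(1)])
    show "vec.span {fv x} \<in> W" using W_iff m by simp
    show "?\<psi> (vec.span {fv x}) = vec.span {x}" unfolding proj_map_span[OF gv m(1)] m(4) by (rule span_scale[OF m(3)])
  qed
  have \<psi>1: "gv z \<noteq> 0" "?\<psi> (vec.span {z}) = vec.span {gv z}" "vec.span {gv z} \<in> U" "?\<phi> (vec.span {gv z}) = vec.span {z}"
    if "z \<noteq> 0" "vec.span {z} \<in> W" for z
  proof -
    have "K z \<noteq> 0" using W_iff that by auto
    from gf[OF that(1) this] obtain \<nu> where m: "peval F (gv z) = 0" "gv z \<noteq> 0" "H (gv z) \<noteq> 0" "\<nu> \<noteq> 0" "fv (gv z) = \<nu> *s z" by blast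
    show "gv z \<noteq> 0" by (rule m)
    show "?\<psi> (vec.span {z}) = vec.span {gv z}" by (rule proj_map_span[OF gv that(1)])
    show "vec.span {gv z} \<in> U" using U_iff m by simp
    show "?\<phi> (vec.span {gv z}) = vec.span {z}" unfolding proj_map_span[OF fv m(2)] m(5) by (rule span_scale[OF m(4)])
  qed
  have U_rep: "\<exists>x. x \<noteq> 0 \<and> p = vec.span {x}" if "p \<in> U" for p using UP that in_proj_space by blast
  have W_rep: "\<exists>x. x \<noteq> 0 \<and> p = vec.span {x}" if "p \<in> W" for p using WP that in_proj_space by blast
  have bij: "bij_betw ?\<phi> U W"
  proof (rule bij_betw_byWitness[where f' = ?\<psi>])
    show "\<forall>p\<in>U. ?\<psi> (?\<phi> p) = p"
    proof
      fix p assume "p \<in> U"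
      then obtain x where "x \<noteq> 0" "p = vec.span {x}" using U_rep by blast
      then show "?\<psi> (?\<phi> p) = p" using \<phi>1[of x] \<open>p \<in> U\<close> by simp
    qed
    show "\<forall>p\<in>W. ?\<phi> (?\<psi> p) = p"
    proof
      fix p assume "p \<in> W"
      then obtain x where "x \<noteq> 0" "p = vec.span {x}" using W_rep by blast
      then show "?\<phi> (?\<psi> p) = p" using \<psi>1[of x] \<open>p \<in> W\<close> by simp
    qed
    show "?\<phi> ` U \<subseteq> W"
    proof
      fix r assume "r \<in> ?\<phi> ` U"
      then obtain p where p: "p \<in> U" "r = ?\<phi> p" by blast
      then obtain x where "x \<noteq> 0" "p = vec.span {x}" using U_rep by blast
      then show "r \<in> W" using \<phi>1[of x] p by simp
    qed
    show "?\<psi> ` W \<subseteq> U"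
    proof
      fix r assume "r \<in> ?\<psi> ` W"
      then obtain p where p: "p \<in> W" "r = ?\<psi> p" by blast
      then obtain x where "x \<noteq> 0" "p = vec.span {x}" using W_rep by blast
      then show "r \<in> U" using \<psi>1[of x] p by simp
    qed
  qed
  have inv: "inv_into U ?\<phi> (vec.span {z}) = vec.span {gv z}" if "z \<noteq> 0" "vec.span {z} \<in> W" for z
    using bij_betw_inv_into_left[OF bij \<psi>1(3)[OF that]] \<psi>1(4)[OF that] by simp
  have reg1: "regular_map U W ?\<phi>"
    by (rule regular_map_of_forms[OF UP fv]) (use \<phi>1 in auto)
  have reg2: "regular_map W U (inv_into U ?\<phi>)"
    by (rule regular_map_of_forms[OF WP gv]) (use \<psi>1 inv in auto)
  have opU: "openin (subtopology zariski ?X) U"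
    unfolding U_def openin_subtopology using nonvanishing_open[OF H] by (intro exI[of _ "nonvanishing H"]) auto
  have opW: "openin (subtopology zariski ?Y) W"
    unfolding openin_subtopology using nonvanishing_open[OF K] WP by (intro exI[of _ W]) (auto simp: W_def)
  have z0: "fv x0 \<noteq> 0" "K (fv x0) \<noteq> 0" using fg[OF x0] by auto
  have dU: "subtopology zariski ?X closure_of U = ?X" unfolding U_def
  proof (rule dense_nonvanishing[OF X H])
    show "vec.span {x0} \<in> ?X" using X_span x0 by simp
    show "x0 \<noteq> 0" "H x0 \<noteq> 0" by (rule x0)+
    fix n a m b assume a: "form n a" and b: "form m b"
      and a1: "\<exists>v. v \<noteq> 0 \<and> vec.span {v} \<in> ?X \<and> a v \<noteq> 0" and b1: "\<exists>v. v \<noteq> 0 \<and> vec.span {v} \<in> ?X \<and> b v \<noteq> 0"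
    \<comment> \<open>The additional factor \<open>v $ j\<close> keeps \<open>v\<close> away from
      the origin, where forms of degree zero need not vanish.\<close>
    obtain j where j: "x0 $ j \<noteq> 0" using x0(2) by (auto simp: Finite_Cartesian_Product.vec_eq_iff)
    have a2: "\<exists>v. peval F v = 0 \<and> a v \<noteq> 0" "\<exists>v. peval F v = 0 \<and> b v \<noteq> 0" using a1 b1 X_span by blast+
    have ab: "form (n + m) (\<lambda>x. a x * b x)" by (rule form_mult[OF a b])
    have "\<exists>v. peval F v = 0 \<and> a v * b v \<noteq> 0" using irreducible_F[OF a b] a2 by fastforce
    moreover have "\<exists>v. peval F v = 0 \<and> v $ j \<noteq> 0" using j x0(1) by blast
    ultimately obtain v where v: "peval F v = 0" "v $ j * (a v * b v) \<noteq> 0"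
      using irreducible_F[OF form_proj[of j] ab] by blast
    have v0: "v \<noteq> 0" using v(2) by auto
    have "vec.span {v} \<in> ?X" using X_span[OF v0] v(1) by blast
    then show "\<exists>v. v \<noteq> 0 \<and> vec.span {v} \<in> ?X \<and> a v \<noteq> 0 \<and> b v \<noteq> 0"
      using v0 v(2) by (intro exI[of _ v]) auto
  qed
  have dW: "subtopology zariski ?Y closure_of W = ?Y"
  proof -
    have "subtopology zariski ?Y closure_of (?Y \<inter> nonvanishing K) = ?Y"
    proof (rule dense_nonvanishing[OF subset_refl K])
      show "vec.span {fv x0} \<in> ?Y" using z0(1) in_proj_space by blast
      show "fv x0 \<noteq> 0" "K (fv x0) \<noteq> 0" by (rule z0)+
      fix n and a :: "'k ^ 4 \<Rightarrow> 'k" and m b assume a: "form n a" and b: "form m b"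
        and a1: "\<exists>v. v \<noteq> 0 \<and> vec.span {v} \<in> ?Y \<and> a v \<noteq> 0" and b1: "\<exists>v. v \<noteq> 0 \<and> vec.span {v} \<in> ?Y \<and> b v \<noteq> 0"
      obtain j where j: "fv x0 $ j \<noteq> 0" using z0(1) by (auto simp: Finite_Cartesian_Product.vec_eq_iff)
      have "\<exists>x. a x * b x \<noteq> 0"
        using polyfun_mult_eq_0[OF form_imp_polyfun[OF a] form_imp_polyfun[OF b]] a1 b1 by blast
      then obtain v where "v $ j * (a v * b v) \<noteq> 0"
        using polyfun_mult_eq_0[OF polyfun_proj[of j] form_imp_polyfun[OF form_mult[OF a b]]] j by blast
      then have "v \<noteq> 0 \<and> a v \<noteq> 0 \<and> b v \<noteq> 0" by auto
      then show "\<exists>v. v \<noteq> 0 \<and> vec.span {v} \<in> ?Y \<and> a v \<noteq> 0 \<and> b v \<noteq> 0"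
        using in_proj_space by blast
    qed
    moreover have "?Y \<inter> nonvanishing K = W" using WP by (auto simp: W_def)
    ultimately show ?thesis by simp
  qed
  have eq: "?\<phi> (\<alpha> g p) = proj_action (R g) (?\<phi> p)" if g: "g \<in> G" and p: "p \<in> U" "\<alpha> g p \<in> U" for g p
  proof -
    obtain x where x: "x \<noteq> 0" "p = vec.span {x}" using U_rep p(1) by blast
    have "peval F x = 0" "H x \<noteq> 0" using U_iff[OF x(1)] p(1) x(2) by auto
    from act[OF g this(1) x(1) this(2)] obtain y c where
      y: "\<alpha> g p = vec.span {y}" "y \<noteq> 0" "c \<noteq> 0" "fv y = c *s (R g *v fv x)" using x(2) by blast
    have "?\<phi> (\<alpha> g p) = vec.span {R g *v fv x}"
      unfolding y(1) proj_map_span[OF fv y(2)] y(4) by (rule span_scale[OF y(3)])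
    also have "\<dots> = proj_action (R g) (?\<phi> p)"
      unfolding x(2) proj_map_span[OF fv x(1)] proj_action_def image_span_singleton ..
    finally show ?thesis .
  qed
  show ?thesis unfolding equivariantly_birational_def biregular_map_def
    by (intro exI[of _ U] exI[of _ W] exI[of _ ?\<phi>] conjI ballI impI opU dU opW dW bij reg1 reg2 eq)
qed

end

section \<open>Linearization by projection from a fixed point\<close>

definition linear_map :: "('k::field ^ 'n::finite \<Rightarrow> 'k ^ 'm::finite) \<Rightarrow> bool" where
  "linear_map f \<longleftrightarrow> (\<forall>x y. f (x + y) = f x + f y) \<and> (\<forall>c x. f (c *s x) = c *s f x)"

lemma linear_map_sum:
  assumes "linear_map f"
  shows "f (\<Sum>i\<in>A. c i *s e i) = (\<Sum>i\<in>A. c i *s f (e i))"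
proof -
  have z: "f 0 = 0" using assms unfolding linear_map_def by (metis vector_smult_lzero)
  show ?thesis
    by (induction A rule: infinite_finite_induct) (use assms z in \<open>auto simp: linear_map_def\<close>)
qed

lemma linear_map_comp: "linear_map f \<Longrightarrow> linear_map g \<Longrightarrow> linear_map (\<lambda>x. f (g x))"
  by (simp add: linear_map_def)

lemma linear_map_matrix_mult: "linear_map ((*v) A)"
  by (simp add: linear_map_def matrix_vector_right_distrib vector_scalar_commute)

definition matrix_of :: "('k::field ^ 'n::finite \<Rightarrow> 'k ^ 'm::finite) \<Rightarrow> 'k ^ 'n ^ 'm" where
  "matrix_of f = (\<chi> i j. f (axis j 1) $ i)"

lemma matrix_of_mult:
  assumes "linear_map f" shows "matrix_of f *v z = f z"
proof -
  have "(\<Sum>j\<in>UNIV. z $ j *s axis j 1) = z"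
    by (simp add: Finite_Cartesian_Product.vec_eq_iff axis_def if_distrib cong: if_cong)
  then have "f z = (\<Sum>j\<in>UNIV. z $ j *s f (axis j 1))" using linear_map_sum[OF assms, of "\<lambda>j. z $ j" "\<lambda>j. axis j 1" UNIV] by simp
  then show ?thesis
    by (simp add: matrix_of_def matrix_vector_mult_def Finite_Cartesian_Product.vec_eq_iff mult.commute)
qed

definition scale_matrix :: "'k::field \<Rightarrow> 'k ^ 'n::finite ^ 'm::finite \<Rightarrow> 'k ^ 'n ^ 'm" where
  "scale_matrix c A = (\<chi> i j. c * A $ i $ j)"

lemma scale_matrix_mult: "scale_matrix c A *v x = c *s (A *v x)"
  by (simp add: scale_matrix_def matrix_vector_mult_def Finite_Cartesian_Product.vec_eq_iff sum_distrib_left mult.assoc)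

lemma invertible_nonzero: "invertible A \<Longrightarrow> x \<noteq> 0 \<Longrightarrow> (A :: 'k::field ^ 'n::finite ^ 'n) *v x \<noteq> 0"
  unfolding invertible_iff_kernel by blast

lemma invertible_inj: "invertible A \<Longrightarrow> (A :: 'k::field ^ 'n::finite ^ 'n) *v x = A *v y \<Longrightarrow> x = y"
  using invertible_nonzero[of A "x - y"] by (auto simp: matrix_vector_mult_diff_distrib)

context five_nodal_cubic
begin

text \<open>The matrices agree up to a factor on each vector of a frame. A point of the cubic with
  all frame coordinates nonzero forces these factors to coincide, and \<open>\<eta>\<close> forces
  the common factor to be one.\<close>

lemma linear_lift_unique:
  fixes B C :: "'k ^ 5 ^ 5"
  assumes B: "invertible B" and C: "invertible C"
    and eq: "\<And>w. peval F w = 0 \<Longrightarrow> w \<noteq> 0 \<Longrightarrow> vec.span {B *v w} = vec.span {C *v w}"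
    and \<eta>: "B *v \<eta> = C *v \<eta>" "\<eta> \<noteq> 0"
  shows "B = C"
proof -
  obtain v where v: "frame v" using frame_exists[OF card_Sing position] by blast
  define M' where "M' = matrix_inv (mat_of v)"
  note MM = frame_inv[OF v, folded M'_def]
  have scale: "\<exists>s. B *v w = s *s (C *v w)" if "peval F w = 0" "w \<noteq> 0" for w
    using span_eq_imp_scale[OF eq[OF that] invertible_nonzero[OF B that(2)]] by blast
  have v0: "peval F (v i) = 0" "v i \<noteq> 0" for i
    using frame_S[OF v, of i] frame_nonzero[OF v] by (simp_all add: F_S)
  have "\<forall>i. \<exists>s. B *v v i = s *s (C *v v i)" using scale v0 by blast
  from choice[OF this] obtain s where s: "\<And>i. B *v v i = s i *s (C *v v i)" by blast
  have "\<exists>x. peval F x = 0 \<and> (\<forall>i\<in>UNIV. (M' *v x) $ i \<noteq> 0)"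
  proof (rule irreducible_F_prod)
    fix i :: 5
    have "(M' *v v i) $ i \<noteq> 0" using MM(2)[of "axis i 1"] by (simp add: mat_of_axis)
    then show "\<exists>x. peval F x = 0 \<and> (M' *v x) $ i \<noteq> 0" using v0 by blast
  qed (simp, rule form_linear)
  then obtain x where x: "peval F x = 0" "\<And>i. (M' *v x) $ i \<noteq> 0" by blast
  then have "x \<noteq> 0" by auto
  then obtain t where t: "B *v x = t *s (C *v x)" using scale x(1) by blast
  define y where "y = M' *v x"
  have xy: "x = (\<Sum>i\<in>UNIV. y $ i *s v i)" using MM(1)[of x] by (simp add: mat_of_mult y_def)
  have Bs: "A *v (\<Sum>i\<in>UNIV. c i *s v i) = (\<Sum>i\<in>UNIV. c i *s (A *v v i))" for A c
    by (rule linear_map_sum[OF linear_map_matrix_mult])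
  have "C *v (\<Sum>i\<in>UNIV. (y $ i * s i) *s v i) = C *v (\<Sum>i\<in>UNIV. (t * y $ i) *s v i)"
    using t unfolding xy Bs s by (simp add: vector_smult_assoc vec.scale_sum_right)
  from invertible_inj[OF C this]
  have "mat_of v *v (\<chi> i. y $ i * s i) = mat_of v *v (\<chi> i. t * y $ i)" by (simp add: mat_of_mult)
  from arg_cong[OF this, of "\<lambda>x. M' *v x"] have "(\<chi> i. y $ i * s i) = (\<chi> i. t * y $ i)" unfolding MM(2) .
  then have ys: "y $ i * s i = t * y $ i" for i by (simp add: Finite_Cartesian_Product.vec_eq_iff)
  have y0: "y $ i \<noteq> 0" for i using x(2)[of i] by (simp add: y_def)
  have st: "s i = t" for i using ys[of i] y0[of i] by (simp add: mult.commute)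
  have BC: "B *v z = t *s (C *v z)" for z
  proof -
    have "z = (\<Sum>i\<in>UNIV. (M' *v z) $ i *s v i)" using MM(1)[of z] by (simp add: mat_of_mult)
    then have "B *v z = B *v (\<Sum>i\<in>UNIV. (M' *v z) $ i *s v i)" "C *v z = C *v (\<Sum>i\<in>UNIV. (M' *v z) $ i *s v i)"
      by simp_all
    then have "B *v z = (\<Sum>i\<in>UNIV. (M' *v z) $ i *s (t *s (C *v v i)))" "C *v z = (\<Sum>i\<in>UNIV. (M' *v z) $ i *s (C *v v i))"
      unfolding Bs s st .
    then show ?thesis by (simp add: vec.scale_sum_right vector_smult_assoc mult.commute)
  qed
  have "C *v \<eta> \<noteq> 0" by (rule invertible_nonzero[OF C \<eta>(2)])
  moreover have "C *v \<eta> = t *s (C *v \<eta>)" using BC[of \<eta>] \<eta>(1) by simp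
  ultimately have "t = 1" by (auto simp: Finite_Cartesian_Product.vec_eq_iff)
  then show ?thesis using BC by (simp add: matrix_eq)
qed

text \<open>Common to both cases: \<open>\<kappa>\<close> is the identity or a Cremona map,
  \<open>T\<close> the projection with centre \<open>\<eta>\<close>, and \<open>J\<close> a section
  of it. As each \<open>B g\<close> fixes the vector \<open>\<eta>\<close> and not only its line,
  \<open>linear_lift_unique\<close> makes \<open>B\<close> multiplicative, and \<open>R\<close> is
  its action on the quotient by \<open>\<eta>\<close>.\<close>

lemma linearizable_of_projection:
  fixes T :: "'k ^ 5 \<Rightarrow> 'k ^ 4" and J :: "'k ^ 4 \<Rightarrow> 'k ^ 5" and B :: "(('k ^ 5) set \<Rightarrow> ('k ^ 5) set) \<Rightarrow> 'k ^ 5 ^ 5"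
    and \<kappa> :: "'k ^ 5 \<Rightarrow> 'k ^ 5" and gv :: "'k ^ 4 \<Rightarrow> 'k ^ 5"
  assumes G: "subgroup G (BijGroup (hypersurface F))"
    and T: "linear_map T" and J: "linear_map J" and TJ: "\<And>z. T (J z) = z" and JT: "\<And>y. \<exists>s. y = J (T y) + s *s \<eta>"
    and T\<eta>: "T \<eta> = 0" "\<eta> \<noteq> 0"
    and B: "\<And>g. g \<in> G \<Longrightarrow> invertible (B g)" "\<And>g. g \<in> G \<Longrightarrow> B g *v \<eta> = \<eta>"
      "\<And>g w. g \<in> G \<Longrightarrow> peval F w = 0 \<Longrightarrow> w \<noteq> 0 \<Longrightarrow> g (vec.span {w}) = vec.span {B g *v w}"
      "\<And>g w. g \<in> G \<Longrightarrow> peval F w = 0 \<Longrightarrow> peval F (B g *v w) = 0"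
      "\<And>g x. g \<in> G \<Longrightarrow> \<kappa> (B g *v x) = B g *v \<kappa> x"
    and fv: "\<And>i. form d (\<lambda>x. T (\<kappa> x) $ i)" and gv: "\<And>i. form e (\<lambda>z. gv z $ i)"
    and H: "form dH H" and K: "form dK K"
    and fg: "\<And>x. peval F x = 0 \<Longrightarrow> x \<noteq> 0 \<Longrightarrow> H x \<noteq> 0 \<Longrightarrow>
      T (\<kappa> x) \<noteq> 0 \<and> K (T (\<kappa> x)) \<noteq> 0 \<and> (\<exists>\<mu>. \<mu> \<noteq> 0 \<and> gv (T (\<kappa> x)) = \<mu> *s x)"
    and gf: "\<And>z. z \<noteq> 0 \<Longrightarrow> K z \<noteq> 0 \<Longrightarrow>
      peval F (gv z) = 0 \<and> gv z \<noteq> 0 \<and> H (gv z) \<noteq> 0 \<and> (\<exists>\<nu>. \<nu> \<noteq> 0 \<and> T (\<kappa> (gv z)) = \<nu> *s z)"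
    and z0: "z0 \<noteq> 0" "K z0 \<noteq> 0"
  shows "linearizable G (hypersurface F)"
proof -
  let ?X = "hypersurface F"
  define R where "R g = matrix_of (\<lambda>z. T (B g *v J z))" for g
  have R: "R g *v z = T (B g *v J z)" for g z
    unfolding R_def by (rule matrix_of_mult[OF linear_map_comp[OF T linear_map_comp[OF linear_map_matrix_mult J]]])
  have TB: "T (B g *v y) = R g *v T y" if g: "g \<in> G" for g y
  proof -
    obtain s where s: "y = J (T y) + s *s \<eta>" using JT by blast
    have "B g *v y = B g *v J (T y) + s *s (B g *v \<eta>)"
      by (subst s) (simp add: matrix_vector_right_distrib vector_scalar_commute)
    then have "B g *v y = B g *v J (T y) + s *s \<eta>" using B(2)[OF g] by simp
    then show ?thesis using T T\<eta>(1) by (simp add: R linear_map_def)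
  qed
  have GX: "G \<subseteq> Bij ?X" using G subgroup.subset[OF G] by (simp add: BijGroup_def)
  have X: "\<And>w. w \<noteq> 0 \<Longrightarrow> vec.span {w} \<in> ?X \<longleftrightarrow> peval F w = 0" by (rule X_span)
  have invR: "invertible (R g)" if g: "g \<in> G" for g
    unfolding invertible_iff_kernel
  proof (intro allI impI)
    fix z assume "R g *v z = 0"
    then have "T (B g *v J z) = 0" by (simp add: R)
    moreover obtain s where s: "B g *v J z = J (T (B g *v J z)) + s *s \<eta>" using JT by blast
    moreover have "J 0 = 0" using J unfolding linear_map_def by (metis vector_smult_lzero)
    ultimately have "B g *v J z = B g *v (s *s \<eta>)" using B(2)[OF g] by (simp add: vector_scalar_commute)
    then have "B g *v (J z - s *s \<eta>) = 0" by (simp add: matrix_vector_mult_diff_distrib)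
    then have "J z = s *s \<eta>" using invertible_nonzero[OF B(1)[OF g], of "J z - s *s \<eta>"] by auto
    then have "T (J z) = s *s T \<eta>" using T by (simp add: linear_map_def)
    then show "z = 0" using TJ T\<eta>(1) by simp
  qed
  have Bmult: "B (g \<otimes>\<^bsub>BijGroup ?X\<^esub> h) = B g ** B h" if g: "g \<in> G" and h: "h \<in> G" for g h
  proof (rule linear_lift_unique[OF _ _ _ _ T\<eta>(2)])
    have gh: "g \<otimes>\<^bsub>BijGroup ?X\<^esub> h \<in> G" using subgroup.m_closed[OF G g h] .
    have comp: "g \<otimes>\<^bsub>BijGroup ?X\<^esub> h = compose ?X g h" using g h GX by (auto simp: BijGroup_def)
    show "invertible (B (g \<otimes>\<^bsub>BijGroup ?X\<^esub> h))" by (rule B(1)[OF gh])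
    show "invertible (B g ** B h)" using B(1) g h invertible_mult by blast
    show "B (g \<otimes>\<^bsub>BijGroup ?X\<^esub> h) *v \<eta> = (B g ** B h) *v \<eta>"
      using B(2) g h gh by (simp add: matrix_vector_mul_assoc[symmetric])
    fix w assume w: "peval F w = 0" "w \<noteq> 0"
    have hw: "peval F (B h *v w) = 0" "B h *v w \<noteq> 0"
      using B(4)[OF h w(1)] invertible_nonzero[OF B(1)[OF h] w(2)] by simp_all
    have "vec.span {B (g \<otimes>\<^bsub>BijGroup ?X\<^esub> h) *v w} = g (h (vec.span {w}))"
      using B(3)[OF gh w] X[OF w(2)] w(1) by (simp add: comp compose_def)
    also have "\<dots> = vec.span {B g *v (B h *v w)}" using B(3)[OF h w] B(3)[OF g hw] by simp
    finally show "vec.span {B (g \<otimes>\<^bsub>BijGroup ?X\<^esub> h) *v w} = vec.span {(B g ** B h) *v w}"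
      by (simp add: matrix_vector_mul_assoc)
  qed
  have "R \<in> hom (BijGroup ?X\<lparr>carrier := G\<rparr>) (GL :: ('k ^ 4 ^ 4) monoid)"
  proof (rule homI)
    show "R g \<in> carrier GL" if "g \<in> carrier (BijGroup ?X\<lparr>carrier := G\<rparr>)" for g
      using that invR by (simp add: GL_def)
    fix g h assume gh: "g \<in> carrier (BijGroup ?X\<lparr>carrier := G\<rparr>)" "h \<in> carrier (BijGroup ?X\<lparr>carrier := G\<rparr>)"
    then have g: "g \<in> G" and h: "h \<in> G" by simp_all
    have "R (g \<otimes>\<^bsub>BijGroup ?X\<^esub> h) *v z = (R g ** R h) *v z" for z
    proof -
      have "R (g \<otimes>\<^bsub>BijGroup ?X\<^esub> h) *v z = T (B g *v (B h *v J z))"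
        unfolding R Bmult[OF g h] by (simp add: matrix_vector_mul_assoc)
      also have "\<dots> = R g *v (R h *v z)" unfolding TB[OF g] R[of h] ..
      finally show ?thesis by (simp add: matrix_vector_mul_assoc)
    qed
    then show "R (g \<otimes>\<^bsub>BijGroup ?X\<lparr>carrier := G\<rparr>\<^esub> h) = R g \<otimes>\<^bsub>GL\<^esub> R h"
      by (simp add: GL_def matrix_eq)
  qed
  moreover have "equivariantly_birational G ?X (\<lambda>g. g) (proj_space :: ('k ^ 4) set set) (\<lambda>g. proj_action (R g))"
  proof (rule equivariantly_birational_of_forms[where fv = "\<lambda>x. T (\<kappa> x)" and gv = gv, OF fv gv H K fg gf])
    show "peval F (gv z0) = 0" "gv z0 \<noteq> 0" "H (gv z0) \<noteq> 0" using gf[OF z0] by auto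
    fix g x assume g: "g \<in> G" and x: "peval F x = 0" "x \<noteq> 0" "H x \<noteq> 0"
    have "B g *v x \<noteq> 0" by (rule invertible_nonzero[OF B(1)[OF g] x(2)])
    moreover have "T (\<kappa> (B g *v x)) = 1 *s (R g *v T (\<kappa> x))" using B(5)[OF g] TB[OF g] by simp
    ultimately show "\<exists>y. g (vec.span {x}) = vec.span {y} \<and> y \<noteq> 0 \<and> (\<exists>c. c \<noteq> 0 \<and> T (\<kappa> y) = c *s (R g *v T (\<kappa> x)))"
      using B(3)[OF g x(1,2)] one_neq_zero by blast
  qed
  ultimately show ?thesis unfolding linearizable_def by blast
qed

text \<open>Any linear lift has \<open>v\<close> as an eigenvector; dividing by the eigenvalue
  normalizes it.\<close>

lemma normalized_lift:
  assumes \<phi>: "\<phi> \<in> Aut (hypersurface F)" and v: "v \<noteq> 0" "peval F v = 0" and fixed: "\<phi> (vec.span {v}) = vec.span {v}"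
  shows "\<exists>B t. invertible B \<and> B *v v = v \<and> (\<forall>w. peval F w = 0 \<longrightarrow> w \<noteq> 0 \<longrightarrow> \<phi> (vec.span {w}) = vec.span {B *v w}) \<and>
    (\<forall>x. peval F (B *v x) = t * peval F x)"
proof -
  obtain A t where A: "invertible A" "\<And>w. peval F w = 0 \<Longrightarrow> w \<noteq> 0 \<Longrightarrow> \<phi> (vec.span {w}) = vec.span {A *v w}"
    "\<And>x. peval F (A *v x) = t * peval F x" using Aut_linear[OF \<phi>] by blast
  have "A *v v \<noteq> 0" by (rule invertible_nonzero[OF A(1) v(1)])
  moreover have "vec.span {A *v v} = vec.span {v}" using A(2)[OF v(2,1)] fixed by simp
  ultimately obtain c where c: "c \<noteq> 0" "A *v v = c *s v" using span_eq_imp_scale by blast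
  define B where "B = scale_matrix (inverse c) A"
  have B: "B *v x = inverse c *s (A *v x)" for x by (simp add: B_def scale_matrix_mult)
  have "invertible B" unfolding invertible_iff_kernel B using A(1) c(1) unfolding invertible_iff_kernel by simp
  moreover have "B *v v = v" unfolding B c(2) using c(1) by (simp add: vector_smult_assoc)
  moreover have "\<phi> (vec.span {w}) = vec.span {B *v w}" if "peval F w = 0" "w \<noteq> 0" for w
    unfolding B A(2)[OF that] using c(1) by (intro span_scale[symmetric]) simp
  moreover have "peval F (B *v x) = inverse c ^ 3 * t * peval F x" for x
    unfolding B using form_scale[OF form_F] A(3) by simp
  ultimately show ?thesis by blast
qed

lemma linearizable_of_fixed_node:
  assumes G: "subgroup G (BijGroup (hypersurface F))" "G \<subseteq> Aut (hypersurface F)"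
    and v0: "frame v0" and fixed: "\<And>g. g \<in> G \<Longrightarrow> g (vec.span {v0 5}) = vec.span {v0 5}"
  shows "linearizable G (hypersurface F)"
proof -
  from v0 obtain v b12 b13 b14 b23 b24 b34 L N \<kappa> s where v: "frame v"
    and vv: "\<And>i. vec.span {v i} = vec.span {v0 i}" and fc: "factorial_cubic b12 b13 b14 b23 b24 b34 L N \<kappa>"
    and s: "s \<noteq> 0" "\<And>x. peval F (mat_of v *v x) = s * nodal_cubic.P b12 b13 b14 b23 b24 b34 x"
    by (rule normal_form_obtain) (rule that)
  interpret fc: factorial_cubic b12 b13 b14 b23 b24 b34 L N \<kappa> by (rule fc)
  define M where "M = mat_of v"
  define M' where "M' = matrix_inv M"
  have MM: "M *v (M' *v x) = x" "M' *v (M *v x) = x" for x using frame_inv[OF v] by (simp_all add: M_def M'_def)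
  have FM: "peval F (M *v x) = s * fc.P x" for x unfolding M_def by (rule s(2))
  have v5: "v 5 \<noteq> 0" "peval F (v 5) = 0" "M *v axis 5 1 = v 5"
    using frame_nonzero[OF v] frame_S[OF v] by (simp_all add: F_S M_def mat_of_axis)
  have "\<forall>g\<in>G. \<exists>B. \<exists>t. invertible B \<and> B *v v 5 = v 5 \<and> (\<forall>w. peval F w = 0 \<longrightarrow> w \<noteq> 0 \<longrightarrow> g (vec.span {w}) = vec.span {B *v w}) \<and>
    (\<forall>x. peval F (B *v x) = t * peval F x)"
  proof
    fix g assume g: "g \<in> G"
    have "g (vec.span {v 5}) = vec.span {v 5}" using fixed[OF g] by (simp only: vv)
    from normalized_lift[OF subsetD[OF G(2) g] v5(1,2) this]
    show "\<exists>B. \<exists>t. invertible B \<and> B *v v 5 = v 5 \<and> (\<forall>w. peval F w = 0 \<longrightarrow> w \<noteq> 0 \<longrightarrow> g (vec.span {w}) = vec.span {B *v w}) \<and>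
      (\<forall>x. peval F (B *v x) = t * peval F x)" .
  qed
  from bchoice[OF this] obtain B where "\<forall>g\<in>G. \<exists>t. invertible (B g) \<and> B g *v v 5 = v 5 \<and>
    (\<forall>w. peval F w = 0 \<longrightarrow> w \<noteq> 0 \<longrightarrow> g (vec.span {w}) = vec.span {B g *v w}) \<and> (\<forall>x. peval F (B g *v x) = t * peval F x)"
    by (rule exE)
  note B = bspec[OF this]
  define T where "T x = pr4 (M' *v x)" for x
  define J where "J z = M *v vec5 z 0" for z
  obtain z0 where z0: "fc.q z0 \<noteq> 0" using fc.q_nonzero by blast
  have q0: "z \<noteq> 0" if "fc.q z \<noteq> 0" for z using that form_at_0[OF fc.form_q] by auto
  have lpr: "linear_map (pr4 :: 'k ^ 5 \<Rightarrow> 'k ^ 4)" by (simp add: linear_map_def vec_eq_4)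
  have lv5: "linear_map (\<lambda>z :: 'k ^ 4. vec5 z 0)" by (simp add: linear_map_def vec_eq_5)
  show ?thesis
  proof (rule linearizable_of_projection[where T = T and J = J and \<eta> = "v 5" and B = B and \<kappa> = "\<lambda>x. x"
        and gv = "\<lambda>z. M *v fc.param z" and H = "\<lambda>x. fc.q (T x)" and K = fc.q and d = 1 and ?z0.0 = z0, OF G(1)])
    show "linear_map T" unfolding T_def by (rule linear_map_comp[OF lpr linear_map_matrix_mult])
    show "linear_map J" unfolding J_def by (rule linear_map_comp[OF linear_map_matrix_mult lv5])
    show "T (J z) = z" for z by (simp add: T_def J_def MM)
    show "\<exists>s. y = J (T y) + s *s v 5" for y
    proof -
      have "M' *v y = vec5 (pr4 (M' *v y)) 0 + (M' *v y) $ 5 *s axis 5 1" by (simp add: vec_eq_5 axis_def)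
      then have "M *v (M' *v y) = M *v (vec5 (pr4 (M' *v y)) 0 + (M' *v y) $ 5 *s axis 5 1)" by simp
      then have "y = J (T y) + (M' *v y) $ 5 *s v 5"
        by (simp add: MM matrix_vector_right_distrib vector_scalar_commute v5(3) T_def J_def)
      then show ?thesis by blast
    qed
    have "T (M *v axis 5 1) = 0" unfolding T_def MM by (simp add: vec_eq_4 axis_def)
    then show "T (v 5) = 0" unfolding v5(3) .
    show "v 5 \<noteq> 0" by (rule v5)
    show "invertible (B g)" "B g *v v 5 = v 5" if "g \<in> G" for g using B[OF that] by blast+
    show "g (vec.span {w}) = vec.span {B g *v w}" if "g \<in> G" "peval F w = 0" "w \<noteq> 0" for g w using B[OF that(1)] that by blast
    show "peval F (B g *v w) = 0" if "g \<in> G" "peval F w = 0" for g w using B[OF that(1)] that(2) by auto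
    show "B g *v x = B g *v x" if "g \<in> G" for g x by (rule refl)
    show fT: "form 1 (\<lambda>x. T x $ i)" for i unfolding T_def by (rule form_comp1[OF form_pr4 form_linear])
    show "form (1 * 3) (\<lambda>z. (M *v fc.param z) $ i)" for i by (rule form_comp[OF form_linear fc.form_param])
    show "form 2 (\<lambda>x. fc.q (T x))" by (rule form_comp1[OF fc.form_q fT])
    show "form 2 fc.q" by (rule fc.form_q)
    show "z0 \<noteq> 0" "fc.q z0 \<noteq> 0" using z0 q0 by auto
  next
    fix x assume x: "peval F x = 0" "x \<noteq> 0" "fc.q (T x) \<noteq> 0"
    have "fc.P (M' *v x) = 0" using FM[of "M' *v x"] x(1) s(1) by (simp add: MM)
    then have "M *v fc.param (T x) = fc.q (T x) *s x"
      unfolding T_def by (simp add: fc.param_pr4 vector_scalar_commute MM)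
    then show "T x \<noteq> 0 \<and> fc.q (T x) \<noteq> 0 \<and> (\<exists>\<mu>. \<mu> \<noteq> 0 \<and> M *v fc.param (T x) = \<mu> *s x)"
      using x(3) q0 by blast
  next
    fix z assume z: "z \<noteq> 0" "fc.q z \<noteq> 0"
    have Tz: "T (M *v fc.param z) = fc.q z *s z" unfolding T_def MM by (simp add: fc.param_def)
    have 1: "fc.q (T (M *v fc.param z)) \<noteq> 0" unfolding Tz fc.q_scale using z(2) by simp
    then have "T (M *v fc.param z) \<noteq> 0" using q0 by blast
    moreover have "T 0 = 0" by (simp add: T_def vec_eq_4)
    ultimately have "M *v fc.param z \<noteq> 0" by metis
    then show "peval F (M *v fc.param z) = 0 \<and> M *v fc.param z \<noteq> 0 \<and> fc.q (T (M *v fc.param z)) \<noteq> 0 \<and>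
        (\<exists>\<nu>. \<nu> \<noteq> 0 \<and> T (M *v fc.param z) = \<nu> *s z)"
      using 1 z(2) Tz by (auto simp: FM fc.P_param)
  qed
qed

end

section \<open>The Cremona transformation of a symmetric cubic\<close>

definition crem5 :: "'k::comm_ring_1 ^ 5 \<Rightarrow> 'k ^ 5" where
  "crem5 x = (\<chi> i. \<Prod>j\<in>UNIV - {i}. x $ j)"

lemma crem5_nth:
  "crem5 x $ 1 = x $ 2 * x $ 3 * x $ 4 * x $ 5" "crem5 x $ 2 = x $ 1 * x $ 3 * x $ 4 * x $ 5"
  "crem5 x $ 3 = x $ 1 * x $ 2 * x $ 4 * x $ 5" "crem5 x $ 4 = x $ 1 * x $ 2 * x $ 3 * x $ 5"
  "crem5 x $ 5 = x $ 1 * x $ 2 * x $ 3 * x $ 4"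
proof -
  have U: "UNIV - {1 :: 5} = {2, 3, 4, 5}" "UNIV - {2 :: 5} = {1, 3, 4, 5}" "UNIV - {3 :: 5} = {1, 2, 4, 5}"
    "UNIV - {4 :: 5} = {1, 2, 3, 5}" "UNIV - {5 :: 5} = {1, 2, 3, 4}"
    unfolding UNIV_5 by auto
  show "crem5 x $ 1 = x $ 2 * x $ 3 * x $ 4 * x $ 5" "crem5 x $ 2 = x $ 1 * x $ 3 * x $ 4 * x $ 5"
    "crem5 x $ 3 = x $ 1 * x $ 2 * x $ 4 * x $ 5" "crem5 x $ 4 = x $ 1 * x $ 2 * x $ 3 * x $ 5"
    "crem5 x $ 5 = x $ 1 * x $ 2 * x $ 3 * x $ 4"
    unfolding crem5_def by (simp_all add: U mult.assoc)
qed

lemma form_crem5: "form 4 (\<lambda>x. crem5 x $ i)"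
proof -
  have "form (\<Sum>j\<in>UNIV - {i}. 1) (\<lambda>x. \<Prod>j\<in>UNIV - {i}. x $ j)" by (intro form_prod form_proj) simp
  then show ?thesis by (simp add: crem5_def card_Diff_singleton)
qed

definition prod5 :: "'k::comm_ring_1 ^ 5 \<Rightarrow> 'k" where
  "prod5 x = x $ 1 * x $ 2 * x $ 3 * x $ 4 * x $ 5"

lemma form_prod5: "form 5 prod5"
proof -
  have "form (1 + 1 + 1 + 1 + 1) prod5" unfolding prod5_def by (intro form_mult form_proj)
  then show ?thesis by simp
qed

lemma prod5_scale: "prod5 (c *s x) = c ^ 5 * prod5 x"
  by (simp add: prod5_def eval_nat_numeral algebra_simps)

lemma crem5_scale: "crem5 (c *s x) = c ^ 4 *s crem5 x"
  by (simp add: vec_eq_5 crem5_nth eval_nat_numeral algebra_simps)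

lemma crem5_crem5: "crem5 (crem5 x) = prod5 x ^ 3 *s x"
  by (simp add: vec_eq_5 crem5_nth prod5_def eval_nat_numeral algebra_simps)

lemma prod5_crem5: "prod5 (crem5 x) = prod5 x ^ 4"
  by (simp add: crem5_nth prod5_def eval_nat_numeral algebra_simps)

text \<open>The Cremona map turns the cubic \<open>P = 0\<close> into the quadric \<open>Q = 0\<close>, on which \<open>\<eta>\<close> is a point fixed
  by all symmetries. If \<open>u = - 1\<close> then \<open>(1, 1, 1, -1, -1)\<close> is a sixth singular point of the cubic.\<close>

locale symmetric_cubic =
  fixes u :: "'k::{alg_closed_field,field_char_0}" and \<alpha> :: 'k
  assumes u: "3 * u\<^sup>2 + 6 * u + \<alpha> = 0" "u \<noteq> - 1"
begin

definition P :: "'k ^ 5 \<Rightarrow> 'k" where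
  "P x = \<alpha> * x $ 1 * x $ 2 * x $ 3 + (x $ 4 + x $ 5) * (x $ 1 * x $ 2 + x $ 1 * x $ 3 + x $ 2 * x $ 3)
     + x $ 4 * x $ 5 * (x $ 1 + x $ 2 + x $ 3)"

definition Q :: "'k ^ 5 \<Rightarrow> 'k" where
  "Q y = y $ 1 * y $ 2 + y $ 1 * y $ 3 + y $ 2 * y $ 3 + (y $ 4 + y $ 5) * (y $ 1 + y $ 2 + y $ 3) + \<alpha> * y $ 4 * y $ 5"

definition \<eta> :: "'k ^ 5" where "\<eta> = mk5 u u u 1 1"

text \<open>The polar form of the quadric \<open>Q\<close> between \<open>n z\<close> and
  \<open>\<eta>\<close>.\<close>

definition b :: "'k ^ 4 \<Rightarrow> 'k" where "b z = (2 * u + 2) * (z $ 1 + z $ 2 + z $ 3)"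

text \<open>Twice the projection from \<open>\<eta>\<close> onto the invariant hyperplane where the
  last two coordinates add up to zero; the factor avoids denominators.\<close>

definition T :: "'k ^ 5 \<Rightarrow> 'k ^ 4" where
  "T y = mk4 (2 * y $ 1 - u * (y $ 4 + y $ 5)) (2 * y $ 2 - u * (y $ 4 + y $ 5)) (2 * y $ 3 - u * (y $ 4 + y $ 5)) (y $ 4 - y $ 5)"

definition n :: "'k ^ 4 \<Rightarrow> 'k ^ 5" where "n z = mk5 (z $ 1) (z $ 2) (z $ 3) (z $ 4) (- z $ 4)"

definition J :: "'k ^ 4 \<Rightarrow> 'k ^ 5" where "J z = inverse 2 *s n z"

text \<open>The second intersection with the quadric \<open>Q = 0\<close> of the line through its point \<^term>\<open>\<eta>\<close>
  and the point \<^term>\<open>n z\<close> of the invariant hyperplane.\<close>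

definition Y :: "'k ^ 4 \<Rightarrow> 'k ^ 5" where "Y z = b z *s n z - Q (n z) *s \<eta>"

lemma Q_\<eta>: "Q \<eta> = 0"
proof -
  have "Q \<eta> = 3 * u\<^sup>2 + 6 * u + \<alpha>" by (simp add: Q_def \<eta>_def power2_eq_square algebra_simps)
  then show ?thesis using u(1) by simp
qed

lemma Q_crem5: "Q (crem5 x) = prod5 x * P x"
  by (simp add: Q_def P_def crem5_nth prod5_def algebra_simps)

lemma Q_scale: "Q (c *s y) = c\<^sup>2 * Q y"
  by (simp add: Q_def algebra_simps power2_eq_square)

lemma Q_line: "Q (s *s y + t *s \<eta>) = s\<^sup>2 * Q y + s * t * ((2 * u + 2) * (y $ 1 + y $ 2 + y $ 3) + (3 * u + \<alpha>) * (y $ 4 + y $ 5))"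
proof -
  have "Q (s *s y + t *s \<eta>) = s\<^sup>2 * Q y + s * t * ((2 * u + 2) * (y $ 1 + y $ 2 + y $ 3) + (3 * u + \<alpha>) * (y $ 4 + y $ 5)) + t\<^sup>2 * Q \<eta>"
    by (simp add: Q_def \<eta>_def algebra_simps power2_eq_square)
  then show ?thesis using Q_\<eta> by simp
qed

lemma T_J: "T (J z) = z"
  by (simp add: T_def J_def n_def vec_eq_4)

lemma T_\<eta>: "T \<eta> = 0"
  by (simp add: T_def \<eta>_def vec_eq_4)

lemma linear_T: "linear_map T" and linear_J: "linear_map J" and linear_n: "linear_map n"
  by (simp_all add: linear_map_def T_def J_def n_def vec_eq_4 vec_eq_5 algebra_simps)

lemma n_T: "n (T y) = 2 *s y - (y $ 4 + y $ 5) *s \<eta>"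
  by (simp add: n_def T_def \<eta>_def vec_eq_5 algebra_simps)

lemma J_T: "y = J (T y) + (inverse 2 * (y $ 4 + y $ 5)) *s \<eta>"
  unfolding J_def n_T by (simp add: vec_eq_5 algebra_simps \<eta>_def)

lemma T_n: "T (n z) = 2 *s z"
  by (simp add: T_def n_def vec_eq_4)

lemma b_scale: "b (c *s z) = c * b z"
  by (simp add: b_def algebra_simps)

lemma Q_Y: "Q (Y z) = 0"
proof -
  have "Y z = b z *s n z + (- Q (n z)) *s \<eta>" by (simp add: Y_def)
  then have "Q (Y z) = (b z)\<^sup>2 * Q (n z) + b z * (- Q (n z)) * b z"
    by (simp only: Q_line) (simp add: n_def b_def)
  then show ?thesis by (simp add: power2_eq_square)
qed

lemma T_Y: "T (Y z) = (2 * b z) *s z"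
proof -
  have "T (Y z) = b z *s T (n z) - Q (n z) *s T \<eta>"
    by (simp add: T_def Y_def vec_eq_4 algebra_simps)
  then show ?thesis by (simp add: T_n T_\<eta> vector_smult_assoc mult.commute)
qed

lemma Y_T:
  assumes "Q y = 0" shows "Y (T y) = (2 * b (T y)) *s y"
proof -
  define \<beta> where "\<beta> = (2 * u + 2) * (y $ 1 + y $ 2 + y $ 3) + (3 * u + \<alpha>) * (y $ 4 + y $ 5)"
  have "n (T y) = 2 *s y + (- (y $ 4 + y $ 5)) *s \<eta>" by (simp add: n_T)
  then have "Q (n (T y)) = 2\<^sup>2 * Q y + 2 * (- (y $ 4 + y $ 5)) * \<beta>" by (simp only: Q_line \<beta>_def)
  then have Qn: "Q (n (T y)) = - 2 * (y $ 4 + y $ 5) * \<beta>" using assms by simp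
  \<comment> \<open>Moving \<open>y\<close> along \<open>\<eta>\<close> changes its polar value with
    \<open>\<eta>\<close> by a multiple of \<open>Q \<eta>\<close>, which is zero by the choice of
    \<open>u\<close>.\<close>
  have "b (T y) = 2 * \<beta> - (y $ 4 + y $ 5) * (2 * (3 * u\<^sup>2 + 6 * u + \<alpha>))"
    by (simp add: b_def T_def \<beta>_def power2_eq_square algebra_simps)
  then have bT: "b (T y) = 2 * \<beta>" using u(1) by simp
  show ?thesis unfolding Y_def Qn unfolding bT n_T by (simp add: vec_eq_5 algebra_simps)
qed

lemma form_T: "(\<And>i. form d (\<lambda>x. f x $ i)) \<Longrightarrow> form d (\<lambda>x. T (f x) $ i)"
  unfolding T_def by (intro form_mk4 form_diff form_cmult form_add)

lemma form_n: "form 1 (\<lambda>z. n z $ i)"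
  unfolding n_def by (intro form_mk5 form_uminus form_proj)

lemma form_b: "form 1 b"
  unfolding b_def by (intro form_cmult form_add form_proj)

lemma form_Q: "form 2 Q"
proof -
  have "form (1 + 1) Q" unfolding Q_def
    by (intro form_add form_mult[of 1 _ 1] form_cmult form_proj)
  then show ?thesis by simp
qed

lemma form_Y: "form 2 (\<lambda>z. Y z $ i)"
proof -
  have 1: "form (1 + 1) (\<lambda>z. b z * n z $ i)" by (rule form_mult[OF form_b form_n])
  have 2: "form 2 (\<lambda>z. Q (n z))" by (rule form_comp1[OF form_Q form_n])
  have "form 2 (\<lambda>z. b z * n z $ i - \<eta> $ i * Q (n z))" using 1 by (intro form_diff form_cmult 2) simp
  then show ?thesis by (rule form_cong) (auto simp: Y_def)
qed

lemma generic_z: "\<exists>z. z \<noteq> 0 \<and> b z * prod5 (Y z) \<noteq> 0"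
proof -
  have u2: "2 * u + 2 \<noteq> 0"
  proof -
    have "u + 1 \<noteq> 0" using u(2) by (simp add: add_eq_0_iff2)
    moreover have "2 * u + 2 = 2 * (u + 1)" by (simp add: algebra_simps)
    ultimately show ?thesis by (metis mult_eq_0_iff zero_neq_numeral)
  qed
  have "\<exists>z. \<forall>i\<in>(UNIV :: 5 set). Y z $ i \<noteq> 0"
  proof (rule polyfun_prod_eq_0)
    show "polyfun (\<lambda>z. Y z $ i)" for i by (rule form_imp_polyfun[OF form_Y])
    fix i :: 5
    \<comment> \<open>At the first three unit vectors \<open>Q (n z)\<close> is zero and
      \<open>Y z\<close> is \<open>b z *s n z\<close>, nonzero because
      \<open>u \<noteq> - 1\<close>. At \<open>mk4 1 1 0 0\<close> the value of \<open>Q\<close> is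
      one, and the last two coordinates come from \<open>\<eta>\<close>.\<close>
    have 1: "Y (mk4 1 0 0 0) $ 1 \<noteq> 0" "Y (mk4 0 1 0 0) $ 2 \<noteq> 0" "Y (mk4 0 0 1 0) $ 3 \<noteq> 0"
      using u2 by (simp_all add: Y_def Q_def n_def b_def \<eta>_def)
    have 2: "Y (mk4 1 1 0 0) $ 4 \<noteq> 0" "Y (mk4 1 1 0 0) $ 5 \<noteq> 0"
      by (simp_all add: Y_def Q_def n_def b_def \<eta>_def)
    show "\<exists>z. Y z $ i \<noteq> 0" using exhaust_5[of i] 1 2 by metis
  qed simp
  then obtain z1 where z1: "\<And>i. Y z1 $ i \<noteq> 0" by blast
  have "polyfun (\<lambda>z. prod5 (Y z))" by (rule form_imp_polyfun[OF form_comp[OF form_prod5 form_Y]])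
  moreover have "prod5 (Y z1) \<noteq> 0" using z1 by (simp add: prod5_def)
  moreover have "b (mk4 1 0 0 0) \<noteq> 0" using u2 by (simp add: b_def)
  ultimately obtain z where z: "b z * prod5 (Y z) \<noteq> 0"
    using polyfun_mult_eq_0[OF form_imp_polyfun[OF form_b]] by blast
  then have "z \<noteq> 0" by (auto simp: b_def)
  then show ?thesis using z by blast
qed

lemma T_crem5:
  assumes x: "P x = 0" "prod5 x \<noteq> 0" "b (T (crem5 x)) \<noteq> 0"
  shows "T (crem5 x) \<noteq> 0" "b (T (crem5 x)) * prod5 (Y (T (crem5 x))) \<noteq> 0"
    "\<exists>\<mu>. \<mu> \<noteq> 0 \<and> crem5 (Y (T (crem5 x))) = \<mu> *s x"
proof -
  have "Q (crem5 x) = 0" using x(1) by (simp add: Q_crem5)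
  note Y = Y_T[OF this]
  show "T (crem5 x) \<noteq> 0" using x(3) by (auto simp: b_def)
  show "b (T (crem5 x)) * prod5 (Y (T (crem5 x))) \<noteq> 0" unfolding Y prod5_scale prod5_crem5 using x by simp
  have "crem5 (Y (T (crem5 x))) = ((2 * b (T (crem5 x))) ^ 4 * prod5 x ^ 3) *s x"
    unfolding Y crem5_scale crem5_crem5 by (simp add: vector_smult_assoc)
  then show "\<exists>\<mu>. \<mu> \<noteq> 0 \<and> crem5 (Y (T (crem5 x))) = \<mu> *s x" using x(2,3)
    by (intro exI[of _ "(2 * b (T (crem5 x))) ^ 4 * prod5 x ^ 3"] conjI) auto
qed

lemma crem5_Y:
  assumes z: "b z * prod5 (Y z) \<noteq> 0"
  defines "x \<equiv> crem5 (Y z)"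
  shows "P x = 0" "prod5 x \<noteq> 0" "\<exists>\<nu>. \<nu> \<noteq> 0 \<and> T (crem5 x) = \<nu> *s z" "b (T (crem5 x)) \<noteq> 0"
proof -
  have p: "prod5 (Y z) \<noteq> 0" "b z \<noteq> 0" using z by auto
  show p': "prod5 x \<noteq> 0" unfolding x_def prod5_crem5 using p by simp
  have "prod5 x * P x = Q (prod5 (Y z) ^ 3 *s Y z)" unfolding Q_crem5[symmetric] x_def crem5_crem5 ..
  then show "P x = 0" using p' by (simp add: Q_scale Q_Y)
  have "T (crem5 x) = prod5 (Y z) ^ 3 *s T (Y z)"
    unfolding x_def crem5_crem5 using linear_T by (simp add: linear_map_def)
  then have e: "T (crem5 x) = (prod5 (Y z) ^ 3 * (2 * b z)) *s z" by (simp add: T_Y vector_smult_assoc)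
  show "\<exists>\<nu>. \<nu> \<noteq> 0 \<and> T (crem5 x) = \<nu> *s z" using e p
    by (intro exI[of _ "prod5 (Y z) ^ 3 * (2 * b z)"] conjI) auto
  show "b (T (crem5 x)) \<noteq> 0" unfolding e b_scale using p by simp
qed

end

section \<open>Orbits of length three and two\<close>

text \<open>The quotient \<open>\<rho> = t / r\<close> is a cube root of unity. For a primitive one
  \<open>node_disc\<close> would vanish through its factor \<open>1 + \<rho> + \<rho>^2\<close>,
  against nondegeneracy of the node.\<close>

lemma cyclic_coefficients_equal:
  fixes p :: "'k::field_char_0"
  assumes rel: "r * w = t * p" "r * q = t * w" "r * p = t * q" and nz: "r \<noteq> 0" "p \<noteq> 0"
    and D: "node_disc (m * p) (m * q) (m * w) \<noteq> 0"
  shows "q = p \<and> w = p"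
proof -
  define \<rho> where "\<rho> = t / r"
  have w: "w = \<rho> * p" and q: "q = \<rho> * w" and p: "p = \<rho> * q"
    using rel nz(1) by (simp_all add: \<rho>_def field_simps)
  have q2: "q = \<rho>\<^sup>2 * p" unfolding q w by (simp add: power2_eq_square)
  have "(\<rho> - 1) * (1 + \<rho> + \<rho>\<^sup>2) * p = \<rho> * (\<rho>\<^sup>2 * p) - p" by (simp add: algebra_simps power2_eq_square)
  also have "\<dots> = 0" using p unfolding q2 by simp
  finally have "\<rho> = 1 \<or> 1 + \<rho> + \<rho>\<^sup>2 = 0" using nz(2) by auto
  moreover have "node_disc (m * p) (m * q) (m * w) = (m * p)\<^sup>2 * (1 + \<rho> + \<rho>\<^sup>2) * (1 - 3 * \<rho> + \<rho>\<^sup>2)"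
    unfolding q2 w node_disc_def by (simp add: algebra_simps power2_eq_square)
  ultimately have "\<rho> = 1" using D by auto
  then show ?thesis using w q by simp
qed

context five_nodal_cubic
begin

text \<open>Polarization expresses \<open>S\<close> through the cubic at sums of the arguments, so
  scaling the cubic by \<open>t\<close> scales \<open>S\<close> by \<open>t\<close>.\<close>

lemma S_equivariant:
  assumes "\<And>x. peval F (B *v x) = t * peval F x"
  shows "S (B *v x) (B *v y) (B *v z) = t * S x y z"
proof -
  have pol: "6 * S x y z = S (x + y + z) (x + y + z) (x + y + z) - S (x + y) (x + y) (x + y) - S (x + z) (x + z) (x + z)
      - S (y + z) (y + z) (y + z) + S x x x + S y y y + S z z z" for x y z
  proof -
    have e: "S x z y = S x y z" "S y x z = S x y z" "S y z x = S x y z" "S z x y = S x y z" "S z y x = S x y z"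
      using S12 S23 by metis+
    show ?thesis unfolding S_add S_add2 S_add3 e by (simp add: algebra_simps)
  qed
  have eq: "S (B *v x) (B *v x) (B *v x) = t * S x x x" for x using assms[of x] by (simp add: F_S)
  have "6 * S (B *v x) (B *v y) (B *v z) = t * (6 * S x y z)"
    unfolding pol[of "B *v x"] pol[of x] unfolding matrix_vector_right_distrib[symmetric] eq
    by (simp only: distrib_left right_diff_distrib)
  then show ?thesis by simp
qed

lemma frame_span_inj:
  assumes v: "frame v" and eq: "vec.span {v i} = vec.span {v j}"
  shows "i = j"
proof -
  obtain c where c: "c \<noteq> 0" "v i = c *s v j" using span_eq_imp_scale[OF eq frame_nonzero[OF v]] by blast
  have "mat_of v *v axis i 1 = mat_of v *v (c *s axis j 1)" by (simp add: mat_of_axis vector_scalar_commute c(2))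
  from arg_cong[OF this, of "\<lambda>x. matrix_inv (mat_of v) *v x"] have "axis i 1 = c *s axis j (1 :: 'k)"
    unfolding frame_inv(2)[OF v] .
  from arg_cong[OF this, of "\<lambda>x. x $ i"] show "i = j" by (auto simp: axis_def split: if_splits)
qed

lemma Aut_frame:
  assumes g: "g \<in> Aut (hypersurface F)" and v: "frame v" and \<sigma>: "\<And>i. g (vec.span {v i}) = vec.span {v (\<sigma> i)}"
  shows "\<exists>A t \<tau>. inj \<sigma> \<and> invertible A \<and> t \<noteq> 0 \<and> (\<forall>i. \<tau> i \<noteq> 0 \<and> A *v v i = \<tau> i *s v (\<sigma> i)) \<and>
    (\<forall>w. peval F w = 0 \<longrightarrow> w \<noteq> 0 \<longrightarrow> g (vec.span {w}) = vec.span {A *v w}) \<and> (\<forall>x. peval F (A *v x) = t * peval F x)"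
proof -
  interpret a: node_coeffs "\<lambda>i j k. S (v i) (v j) (v k)" by (rule frame_node_coeffs[OF v nodes])
  obtain A t where A: "invertible A" "\<And>w. peval F w = 0 \<Longrightarrow> w \<noteq> 0 \<Longrightarrow> g (vec.span {w}) = vec.span {A *v w}"
    "\<And>x. peval F (A *v x) = t * peval F x" using Aut_linear[OF g] by blast
  have "\<exists>c. c \<noteq> 0 \<and> A *v v i = c *s v (\<sigma> i)" for i
  proof -
    have "peval F (v i) = 0" "v i \<noteq> 0" using frame_S[OF v] frame_nonzero[OF v] by (simp_all add: F_S)
    from A(2)[OF this] \<sigma>[of i] have "vec.span {A *v v i} = vec.span {v (\<sigma> i)}" by simp
    then show ?thesis using span_eq_imp_scale[OF _ invertible_nonzero[OF A(1) frame_nonzero[OF v]]] by blast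
  qed
  then have "\<forall>i. \<exists>c. c \<noteq> 0 \<and> A *v v i = c *s v (\<sigma> i)" by blast
  from choice[OF this] obtain \<tau> where \<tau>: "\<forall>i. \<tau> i \<noteq> 0 \<and> A *v v i = \<tau> i *s v (\<sigma> i)" by (rule exE)
  have inj: "\<sigma> i = \<sigma> j \<longleftrightarrow> i = j" for i j
  proof
    assume "\<sigma> i = \<sigma> j"
    then have "A *v (\<tau> j *s v i) = A *v (\<tau> i *s v j)" using \<tau> by (simp add: vector_scalar_commute vector_smult_assoc mult.commute)
    from invertible_inj[OF A(1) this] have "vec.span {\<tau> j *s v i} = vec.span {\<tau> i *s v j}" by simp
    then have "vec.span {v i} = vec.span {v j}" using \<tau> span_scale by metis
    then show "i = j" by (rule frame_span_inj[OF v])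
  qed simp
  \<comment> \<open>Otherwise the coefficient of the permuted triple of nodes would vanish, against
    \<open>a_nonzero\<close>.\<close>
  have "t \<noteq> 0"
  proof
    assume t: "t = 0"
    have d: "distinct [\<sigma> 1, \<sigma> 2, \<sigma> 3, \<sigma> 4, \<sigma> 5]" by (simp add: inj)
    have "S (A *v v 1) (A *v v 2) (A *v v 3) = 0" using S_equivariant[OF A(3)] t by simp
    then have "\<tau> 1 * \<tau> 2 * \<tau> 3 * S (v (\<sigma> 1)) (v (\<sigma> 2)) (v (\<sigma> 3)) = 0" using \<tau> by (simp add: S_linear)
    then show False using \<tau> a.a_nonzero[OF d] by simp
  qed
  moreover have "inj \<sigma>" using inj by (simp add: inj_def)
  ultimately show ?thesis using A \<tau> by (intro exI[of _ A] exI[of _ t] exI[of _ \<tau>] conjI allI impI) simp_all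
qed

text \<open>A first rescaling equalizes the coefficients of the triples containing both 4 and 5,
  which forces the lift of the 3-cycle to scale the first three vectors equally. Its relations then
  equalize the coefficients with exactly one of 4 and 5, and a second rescaling matches the
  groups.\<close>

lemma symmetric_frame:
  assumes c: "c \<in> Aut (hypersurface F)" and v0: "frame v0"
    and cyc: "c (vec.span {v0 1}) = vec.span {v0 2}" "c (vec.span {v0 2}) = vec.span {v0 3}"
      "c (vec.span {v0 3}) = vec.span {v0 1}" "c (vec.span {v0 4}) = vec.span {v0 4}" "c (vec.span {v0 5}) = vec.span {v0 5}"
  shows "\<exists>v K \<alpha>. frame v \<and> (\<forall>i. vec.span {v i} = vec.span {v0 i}) \<and> K \<noteq> 0 \<and> \<alpha> \<noteq> 3 \<and>
    S (v 1) (v 2) (v 3) = \<alpha> * K \<and> S (v 1) (v 2) (v 4) = K \<and> S (v 1) (v 3) (v 4) = K \<and> S (v 2) (v 3) (v 4) = K \<and>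
    S (v 1) (v 2) (v 5) = K \<and> S (v 1) (v 3) (v 5) = K \<and> S (v 2) (v 3) (v 5) = K \<and>
    S (v 1) (v 4) (v 5) = K \<and> S (v 2) (v 4) (v 5) = K \<and> S (v 3) (v 4) (v 5) = K"
proof -
  define a0 where "a0 i = S (v0 i) (v0 4) (v0 5)" for i
  interpret n0: node_coeffs "\<lambda>i j k. S (v0 i) (v0 j) (v0 k)" by (rule frame_node_coeffs[OF v0 nodes])
  have a0: "a0 1 \<noteq> 0" "a0 2 \<noteq> 0" "a0 3 \<noteq> 0"
    using n0.a_nonzero[of 1 4 5 2 3] n0.a_nonzero[of 2 4 5 1 3] n0.a_nonzero[of 3 4 5 1 2] by (simp_all add: a0_def)
  define s1 where "s1 i = (if i = 1 then a0 2 * a0 3 else if i = 2 then a0 1 * a0 3 else if i = 3 then a0 1 * a0 2 else 1)" for i :: 5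
  define v1 where "v1 i = s1 i *s v0 i" for i
  have s1: "s1 i \<noteq> 0" for i using a0 by (simp add: s1_def)
  have v1: "frame v1" unfolding v1_def by (rule frame_scale[OF v0 s1])
  have sp1: "vec.span {v1 i} = vec.span {v0 i}" for i unfolding v1_def by (rule span_scale[OF s1])
  define m where "m = a0 1 * a0 2 * a0 3"
  have m0: "m \<noteq> 0" using a0 by (simp add: m_def)
  have m: "S (v1 1) (v1 4) (v1 5) = m" "S (v1 2) (v1 4) (v1 5) = m" "S (v1 3) (v1 4) (v1 5) = m"
    by (simp_all add: v1_def S_linear s1_def m_def a0_def[symmetric])
  interpret n1: node_coeffs "\<lambda>i j k. S (v1 i) (v1 j) (v1 k)" by (rule frame_node_coeffs[OF v1 nodes])
  define \<sigma> where "\<sigma> i = (if i = 1 then 2 else if i = 2 then 3 else if i = 3 then 1 else i)" for i :: 5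
  have \<sigma>s: "\<sigma> 1 = 2" "\<sigma> 2 = 3" "\<sigma> 3 = 1" "\<sigma> 4 = 4" "\<sigma> 5 = 5" by (simp_all add: \<sigma>_def)
  have "c (vec.span {v1 i}) = vec.span {v1 (\<sigma> i)}" for i
    using exhaust_5[of i] by (elim disjE) (simp_all only: sp1 \<sigma>s cyc)
  from Aut_frame[OF c v1 this] obtain A t \<tau> where H: "t \<noteq> 0" "\<forall>i. \<tau> i \<noteq> 0 \<and> A *v v1 i = \<tau> i *s v1 (\<sigma> i)"
    and A: "\<forall>x. peval F (A *v x) = t * peval F x" by (elim exE conjE)
  note t = H(1) and A = spec[OF A]
  have \<tau>: "\<tau> i \<noteq> 0" "A *v v1 i = \<tau> i *s v1 (\<sigma> i)" for i using H(2) by simp_all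
  have rel: "\<tau> i * \<tau> j * \<tau> k * S (v1 (\<sigma> i)) (v1 (\<sigma> j)) (v1 (\<sigma> k)) = t * S (v1 i) (v1 j) (v1 k)" for i j k
    using S_equivariant[OF A, of "v1 i" "v1 j" "v1 k"] by (simp add: \<tau>(2) S_linear mult_ac)
  have s45: "\<tau> 1 * \<tau> 4 * \<tau> 5 = t" "\<tau> 2 * \<tau> 4 * \<tau> 5 = t" "\<tau> 3 * \<tau> 4 * \<tau> 5 = t"
    using rel[of 1 4 5] rel[of 2 4 5] rel[of 3 4 5] m m0 by (simp_all add: \<sigma>s)
  have "\<tau> 1 * (\<tau> 4 * \<tau> 5) = \<tau> 2 * (\<tau> 4 * \<tau> 5)" "\<tau> 3 * (\<tau> 4 * \<tau> 5) = \<tau> 2 * (\<tau> 4 * \<tau> 5)"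
    using s45 by (simp_all only: mult.assoc)
  then have \<tau>123: "\<tau> 1 = \<tau> 2" "\<tau> 3 = \<tau> 2" using \<tau>(1) by simp_all
  have eq: "S (v1 1) (v1 3) (v1 k) = S (v1 1) (v1 2) (v1 k) \<and> S (v1 2) (v1 3) (v1 k) = S (v1 1) (v1 2) (v1 k)" if k: "k = 4 \<or> k = 5" for k
  proof (rule cyclic_coefficients_equal)
    have \<sigma>k: "\<sigma> k = k" using k \<sigma>s by auto
    show "\<tau> 2 * \<tau> 2 * \<tau> k * S (v1 2) (v1 3) (v1 k) = t * S (v1 1) (v1 2) (v1 k)"
      using rel[of 1 2 k] by (simp add: \<sigma>s \<sigma>k \<tau>123)
    show "\<tau> 2 * \<tau> 2 * \<tau> k * S (v1 1) (v1 3) (v1 k) = t * S (v1 2) (v1 3) (v1 k)"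
      using rel[of 2 3 k] by (simp add: \<sigma>s \<sigma>k \<tau>123 S12[of "v1 3" "v1 1"])
    show "\<tau> 2 * \<tau> 2 * \<tau> k * S (v1 1) (v1 2) (v1 k) = t * S (v1 1) (v1 3) (v1 k)"
      using rel[of 1 3 k] by (simp add: \<sigma>s \<sigma>k \<tau>123 S12[of "v1 2" "v1 1"])
    show "\<tau> 2 * \<tau> 2 * \<tau> k \<noteq> 0" using \<tau>(1) by simp
    show "S (v1 1) (v1 2) (v1 k) \<noteq> 0" using k n1.a_nonzero[of 1 2 4 3 5] n1.a_nonzero[of 1 2 5 3 4] by auto
    define l where "l = (if k = 4 then 5 else 4 :: 5)"
    have d: "distinct [k, 1, 2, 3, l]" using k by (auto simp: l_def)
    have ml: "S (v1 k) (v1 i) (v1 l) = S (v1 i) (v1 4) (v1 5)" for i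
      using k by (elim disjE) (simp_all add: l_def S12[of "v1 4" "v1 i"] S12[of "v1 5" "v1 i"] S23[of "v1 i" "v1 5" "v1 4"])
    have kij: "S (v1 k) (v1 i) (v1 j) = S (v1 i) (v1 j) (v1 k)" for i j
      by (simp only: S12[of "v1 k" "v1 i"] S23[of "v1 i" "v1 k" "v1 j"])
    have klk: "S (v1 k) (v1 l) (v1 i) = S (v1 k) (v1 i) (v1 l)" for i by (rule S23)
    show "node_disc (m * S (v1 1) (v1 2) (v1 k)) (m * S (v1 1) (v1 3) (v1 k)) (m * S (v1 2) (v1 3) (v1 k)) \<noteq> 0"
      using n1.node_disc_nonzero[OF d] unfolding ml m unfolding kij by (simp add: mult.commute)
  qed
  define p4 where "p4 = S (v1 1) (v1 2) (v1 4)"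
  define p5 where "p5 = S (v1 1) (v1 2) (v1 5)"
  have p0: "p4 \<noteq> 0" "p5 \<noteq> 0" using n1.a_nonzero[of 1 2 4 3 5] n1.a_nonzero[of 1 2 5 3 4] by (simp_all add: p4_def p5_def)
  have ps: "S (v1 1) (v1 2) (v1 4) = p4" "S (v1 1) (v1 3) (v1 4) = p4" "S (v1 2) (v1 3) (v1 4) = p4"
    "S (v1 1) (v1 2) (v1 5) = p5" "S (v1 1) (v1 3) (v1 5) = p5" "S (v1 2) (v1 3) (v1 5) = p5"
    using eq by (simp_all add: p4_def p5_def)
  define s2 where "s2 i = (if i = 4 then p5 else if i = 5 then p4 else m)" for i :: 5
  have s2s: "s2 1 = m" "s2 2 = m" "s2 3 = m" "s2 4 = p5" "s2 5 = p4" by (simp_all add: s2_def)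
  define v where "v i = s2 i *s v1 i" for i
  have s2: "s2 i \<noteq> 0" for i using p0 m0 by (simp add: s2_def)
  have v: "frame v" unfolding v_def by (rule frame_scale[OF v1 s2])
  have sp: "vec.span {v i} = vec.span {v0 i}" for i unfolding v_def span_scale[OF s2] by (rule sp1)
  define K where "K = m * m * p4 * p5"
  have K0: "K \<noteq> 0" using m0 p0 by (simp add: K_def)
  have Ks: "S (v 1) (v 2) (v 4) = K" "S (v 1) (v 3) (v 4) = K" "S (v 2) (v 3) (v 4) = K"
    "S (v 1) (v 2) (v 5) = K" "S (v 1) (v 3) (v 5) = K" "S (v 2) (v 3) (v 5) = K"
    "S (v 1) (v 4) (v 5) = K" "S (v 2) (v 4) (v 5) = K" "S (v 3) (v 4) (v 5) = K"
    unfolding v_def S_linear s2s ps m K_def by (simp_all add: mult_ac)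
  define \<alpha> where "\<alpha> = S (v 1) (v 2) (v 3) / K"
  have \<alpha>: "S (v 1) (v 2) (v 3) = \<alpha> * K" using K0 by (simp add: \<alpha>_def)
  interpret n: node_coeffs "\<lambda>i j k. S (v i) (v j) (v k)" by (rule frame_node_coeffs[OF v nodes])
  \<comment> \<open>For \<open>\<alpha> = 3\<close> the polynomial
    \<open>3 u^2 + 6 u + \<alpha>\<close> has the double root \<open>- 1\<close>; the point with
    coordinates 1, 1, 1, -1, -1 would be singular.\<close>
  have "\<alpha> \<noteq> 3"
  proof
    assume 3: "\<alpha> = 3"
    have d: "distinct [1, 2, 3, 4, 5 :: 5]" by simp
    show False
      by (rule n.no_sixth_5[OF d, where ?x1.0 = 1 and ?x2.0 = 1 and ?x3.0 = 1 and ?x4.0 = "- 1" and ?x5.0 = "- 1"])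
        (simp_all add: Ks \<alpha> 3)
  qed
  then show ?thesis using v sp K0 \<alpha> Ks by blast
qed

end

lemma crem5_permute:
  assumes "bij \<pi>"
  shows "crem5 (\<chi> j. x $ \<pi> j) = (\<chi> j. crem5 x $ \<pi> j)"
proof -
  have "(\<Prod>j\<in>UNIV - {i}. x $ \<pi> j) = (\<Prod>j\<in>UNIV - {\<pi> i}. x $ j)" for i
    by (rule prod.reindex_bij_betw)
      (use assms in \<open>auto simp: bij_betw_def inj_on_def intro: inj_onI\<close>)
  then show ?thesis by (simp add: crem5_def Finite_Cartesian_Product.vec_eq_iff)
qed

context five_nodal_cubic
begin

lemma linearizable_of_3_2:
  assumes G: "subgroup G (BijGroup (hypersurface F))" "G \<subseteq> Aut (hypersurface F)" and v0: "frame v0"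
    and orb3: "\<And>g i. g \<in> G \<Longrightarrow> i \<in> {1, 2, 3} \<Longrightarrow> \<exists>j\<in>{1, 2, 3}. g (vec.span {v0 i}) = vec.span {v0 j}"
    and orb2: "\<And>g i. g \<in> G \<Longrightarrow> i \<in> {4, 5} \<Longrightarrow> \<exists>j\<in>{4, 5}. g (vec.span {v0 i}) = vec.span {v0 j}"
    and c: "c \<in> G" and cyc: "c (vec.span {v0 1}) = vec.span {v0 2}" "c (vec.span {v0 2}) = vec.span {v0 3}"
      "c (vec.span {v0 3}) = vec.span {v0 1}" "c (vec.span {v0 4}) = vec.span {v0 4}" "c (vec.span {v0 5}) = vec.span {v0 5}"
  shows "linearizable G (hypersurface F)"
proof -
  from symmetric_frame[OF subsetD[OF G(2) c] v0 cyc] obtain v K \<alpha> where v: "frame v"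
    and sp: "\<forall>i. vec.span {v i} = vec.span {v0 i}" and K0: "K \<noteq> 0" and \<alpha>: "\<alpha> \<noteq> 3"
    and Ks: "S (v 1) (v 2) (v 3) = \<alpha> * K" "S (v 1) (v 2) (v 4) = K" "S (v 1) (v 3) (v 4) = K" "S (v 2) (v 3) (v 4) = K"
     "S (v 1) (v 2) (v 5) = K" "S (v 1) (v 3) (v 5) = K" "S (v 2) (v 3) (v 5) = K"
     "S (v 1) (v 4) (v 5) = K" "S (v 2) (v 4) (v 5) = K" "S (v 3) (v 4) (v 5) = K" by (elim exE conjE)
  interpret a: node_coeffs "\<lambda>i j k. S (v i) (v j) (v k)" by (rule frame_node_coeffs[OF v nodes])
  define M where "M = mat_of v"
  define M' where "M' = matrix_inv M"
  have MM: "M *v (M' *v x) = x" "M' *v (M *v x) = x" for x using frame_inv[OF v] by (simp_all add: M_def M'_def)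
  have M0: "M *v x \<noteq> 0" if "x \<noteq> 0" for x using MM(2)[of x] that by auto
  \<comment> \<open>Completing the square gives
    \<open>3 u^2 + 6 u + \<alpha> = 3 (u + 1)^2 - 3 + \<alpha>\<close>, so \<open>u = w - 1\<close>
    is a root.\<close>
  obtain w where w: "w ^ 2 = 1 - \<alpha> / 3" using sqrt_exists by blast
  interpret sc: symmetric_cubic "w - 1" \<alpha>
  proof
    have "3 * (w - 1)\<^sup>2 + 6 * (w - 1) + \<alpha> = 3 * w\<^sup>2 - 3 + \<alpha>" by (simp add: power2_eq_square algebra_simps)
    then show "3 * (w - 1)\<^sup>2 + 6 * (w - 1) + \<alpha> = 0" unfolding w by simp
    show "w - 1 \<noteq> - 1" using w \<alpha> by auto
  qed
  have FM: "peval F (M *v x) = 6 * K * sc.P x" for x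
    unfolding F_S M_def S_mat_of a.cubic_sum Ks sc.P_def by (simp add: algebra_simps)
  have K_ab: "S (v a) (v b) (v d) = K" if "a \<in> {1, 2, 3}" "b \<in> {1, 2, 3}" "a \<noteq> b" "d \<in> {4, 5}" for a b d
  proof -
    have e: "S (v 2) (v 1) (v d) = S (v 1) (v 2) (v d)" "S (v 3) (v 1) (v d) = S (v 1) (v 3) (v d)"
      "S (v 3) (v 2) (v d) = S (v 2) (v 3) (v d)" by (rule S12)+
    have "S (v 1) (v 2) (v d) = K" "S (v 1) (v 3) (v d) = K" "S (v 2) (v 3) (v d) = K" using that(4) Ks by auto
    then show ?thesis using that(1-3) e by auto
  qed
  have K_de: "S (v a) (v d) (v e) = K" if "a \<in> {1, 2, 3}" "d \<in> {4, 5}" "e \<in> {4, 5}" "d \<noteq> e" for a d e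
  proof -
    have e: "S (v a) (v 5) (v 4) = S (v a) (v 4) (v 5)" by (rule S23)
    have "S (v a) (v 4) (v 5) = K" using that(1) Ks by auto
    then show ?thesis using that(2-4) e by auto
  qed
  have "\<forall>g\<in>G. \<exists>B. invertible B \<and> B *v (M *v sc.\<eta>) = M *v sc.\<eta> \<and>
    (\<forall>w. peval F w = 0 \<longrightarrow> w \<noteq> 0 \<longrightarrow> g (vec.span {w}) = vec.span {B *v w}) \<and>
    (\<forall>w. peval F w = 0 \<longrightarrow> peval F (B *v w) = 0) \<and> (\<forall>x. M *v crem5 (M' *v (B *v x)) = B *v (M *v crem5 (M' *v x)))"
  proof
    fix g assume g: "g \<in> G"
    have "\<forall>i. \<exists>j. g (vec.span {v i}) = vec.span {v j} \<and> (i \<in> {1, 2, 3} \<longrightarrow> j \<in> {1, 2, 3}) \<and> (i \<in> {4, 5} \<longrightarrow> j \<in> {4, 5})"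
    proof
      fix i :: 5
      have "i \<in> {1, 2, 3} \<and> i \<notin> {4, 5} \<or> i \<in> {4, 5} \<and> i \<notin> {1, 2, 3}" using exhaust_5[of i] by auto
      then show "\<exists>j. g (vec.span {v i}) = vec.span {v j} \<and> (i \<in> {1, 2, 3} \<longrightarrow> j \<in> {1, 2, 3}) \<and> (i \<in> {4, 5} \<longrightarrow> j \<in> {4, 5})"
        using orb3[OF g, of i] orb2[OF g, of i] unfolding spec[OF sp] by blast
    qed
    from choice[OF this] obtain \<sigma> where \<sigma>: "\<forall>i. g (vec.span {v i}) = vec.span {v (\<sigma> i)} \<and>
      (i \<in> {1, 2, 3} \<longrightarrow> \<sigma> i \<in> {1, 2, 3}) \<and> (i \<in> {4, 5} \<longrightarrow> \<sigma> i \<in> {4, 5})" by (rule exE)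
    have \<sigma>1: "g (vec.span {v i}) = vec.span {v (\<sigma> i)}" for i by (rule conjunct1[OF spec[OF \<sigma>]])
    note \<sigma>3 = mp[OF conjunct1[OF conjunct2[OF spec[OF \<sigma>]]]] mp[OF conjunct2[OF conjunct2[OF spec[OF \<sigma>]]]]
    have \<sigma>2: "\<sigma> 1 \<in> {1, 2, 3}" "\<sigma> 2 \<in> {1, 2, 3}" "\<sigma> 3 \<in> {1, 2, 3}" "\<sigma> 4 \<in> {4, 5}" "\<sigma> 5 \<in> {4, 5}"
      by (rule \<sigma>3, simp)+
    from Aut_frame[OF subsetD[OF G(2) g] v \<sigma>1] obtain A t \<tau> where inj: "inj \<sigma>" and A: "invertible A"
      and t: "t \<noteq> 0" and H: "\<forall>i. \<tau> i \<noteq> 0 \<and> A *v v i = \<tau> i *s v (\<sigma> i)"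
      and gA: "\<forall>w. peval F w = 0 \<longrightarrow> w \<noteq> 0 \<longrightarrow> g (vec.span {w}) = vec.span {A *v w}"
      and FA: "\<forall>x. peval F (A *v x) = t * peval F x" by (elim exE conjE)
    have \<tau>: "\<tau> i \<noteq> 0" "A *v v i = \<tau> i *s v (\<sigma> i)" for i using H by simp_all
    have ne: "\<sigma> i \<noteq> \<sigma> j" if "i \<noteq> j" for i j using inj that by (simp add: inj_eq)
    have rel: "\<tau> i * \<tau> j * \<tau> k * S (v (\<sigma> i)) (v (\<sigma> j)) (v (\<sigma> k)) = t * S (v i) (v j) (v k)" for i j k
      using S_equivariant[OF spec[OF FA], of "v i" "v j" "v k"] by (simp add: \<tau>(2) S_linear mult_ac)
    \<comment> \<open>All triples except the first three nodes have coefficient \<open>K\<close>.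
      Comparing five of them before and after the permutation makes all \<open>\<tau> i\<close>
      equal, so a multiple of the lift merely permutes the frame.\<close>
    have "\<tau> 1 * \<tau> 4 * \<tau> 5 * K = t * K" using rel[of 1 4 5] unfolding K_de[OF \<sigma>2(1,4,5) ne[of 4 5, OF distinct_5(10)]] Ks .
    moreover have "\<tau> 2 * \<tau> 4 * \<tau> 5 * K = t * K" using rel[of 2 4 5] unfolding K_de[OF \<sigma>2(2,4,5) ne[of 4 5, OF distinct_5(10)]] Ks .
    moreover have "\<tau> 3 * \<tau> 4 * \<tau> 5 * K = t * K" using rel[of 3 4 5] unfolding K_de[OF \<sigma>2(3,4,5) ne[of 4 5, OF distinct_5(10)]] Ks .
    moreover have "\<tau> 1 * \<tau> 2 * \<tau> 4 * K = t * K" using rel[of 1 2 4] unfolding K_ab[OF \<sigma>2(1,2) ne[of 1 2, OF distinct_5(1)] \<sigma>2(4)] Ks .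
    moreover have "\<tau> 1 * \<tau> 2 * \<tau> 5 * K = t * K" using rel[of 1 2 5] unfolding K_ab[OF \<sigma>2(1,2) ne[of 1 2, OF distinct_5(1)] \<sigma>2(5)] Ks .
    ultimately have e: "\<tau> 1 * (\<tau> 4 * \<tau> 5) = t" "\<tau> 2 * (\<tau> 4 * \<tau> 5) = t" "\<tau> 3 * (\<tau> 4 * \<tau> 5) = t"
      "(\<tau> 1 * \<tau> 2) * \<tau> 4 = t" "(\<tau> 1 * \<tau> 2) * \<tau> 5 = t" using K0 by (simp_all add: mult.assoc)
    have t1: "\<tau> 2 = \<tau> 1" "\<tau> 3 = \<tau> 1" using e(1-3) \<tau>(1) by (metis mult_right_cancel mult_eq_0_iff)+
    have t2: "\<tau> 5 = \<tau> 4" using e(4,5) \<tau>(1) by (metis mult_left_cancel mult_eq_0_iff)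
    have t3: "\<tau> 4 = \<tau> 1"
    proof -
      have "(\<tau> 1 * \<tau> 4) * \<tau> 4 = (\<tau> 1 * \<tau> 4) * \<tau> 1" using e(1,4) unfolding t1 t2 by (simp add: mult_ac)
      then show ?thesis using \<tau>(1) by simp
    qed
    have \<tau>c: "\<tau> i = \<tau> 1" for i using exhaust_5[of i] by (elim disjE) (simp_all only: t1 t2 t3)
    define B where "B = scale_matrix (inverse (\<tau> 1)) A"
    have Bx: "B *v x = inverse (\<tau> 1) *s (A *v x)" for x by (simp add: B_def scale_matrix_mult)
    have Bv: "B *v v i = v (\<sigma> i)" for i unfolding Bx \<tau>(2) \<tau>c[of i] using \<tau>(1)[of 1] by (simp add: vector_smult_assoc)
    have bij: "bij \<sigma>" by (rule bijI[OF inj finite_UNIV_inj_surj[OF finite inj]])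
    define \<rho> where "\<rho> = inv_into UNIV \<sigma>"
    have \<rho>: "bij \<rho>" "\<And>i. \<rho> (\<sigma> i) = i" "\<And>j. \<sigma> (\<rho> j) = j"
      using bij by (simp_all add: \<rho>_def bij_imp_bij_inv bij_is_inj bij_is_surj surj_f_inv_f)
    \<comment> \<open>Permuting the basis vectors by \<open>\<sigma>\<close> permutes the
      coordinates by its inverse \<open>\<rho>\<close>.\<close>
    have BM: "B *v (M *v x) = M *v (\<chi> j. x $ \<rho> j)" for x
    proof -
      have "B *v (M *v x) = (\<Sum>i\<in>UNIV. x $ i *s v (\<sigma> i))"
        unfolding M_def mat_of_mult linear_map_sum[OF linear_map_matrix_mult] Bv ..
      also have "\<dots> = (\<Sum>i\<in>UNIV. x $ \<rho> (\<sigma> i) *s v (\<sigma> i))" by (simp add: \<rho>(2))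
      also have "\<dots> = (\<Sum>j\<in>UNIV. x $ \<rho> j *s v j)" by (rule sum.reindex_bij_betw[OF bij])
      finally show ?thesis by (simp add: M_def mat_of_mult)
    qed
    have \<eta>\<sigma>: "sc.\<eta> $ \<sigma> i = sc.\<eta> $ i" for i
      using exhaust_5[of i] \<sigma>2 by (elim disjE) (auto simp: sc.\<eta>_def)
    have \<eta>\<rho>: "sc.\<eta> $ \<rho> j = sc.\<eta> $ j" for j using \<eta>\<sigma>[of "\<rho> j"] by (simp add: \<rho>(3))
    show "\<exists>B. invertible B \<and> B *v (M *v sc.\<eta>) = M *v sc.\<eta> \<and>
      (\<forall>w. peval F w = 0 \<longrightarrow> w \<noteq> 0 \<longrightarrow> g (vec.span {w}) = vec.span {B *v w}) \<and>
      (\<forall>w. peval F w = 0 \<longrightarrow> peval F (B *v w) = 0) \<and> (\<forall>x. M *v crem5 (M' *v (B *v x)) = B *v (M *v crem5 (M' *v x)))"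
    proof (intro exI[of _ B] conjI allI impI)
      show "invertible B" unfolding invertible_iff_kernel
      proof (intro allI impI)
        fix x assume "B *v x = 0"
        then have "A *v x = 0" using \<tau>(1) by (simp add: Bx)
        then show "x = 0" using invertible_nonzero[OF A] by blast
      qed
      show "B *v (M *v sc.\<eta>) = M *v sc.\<eta>" unfolding BM \<eta>\<rho> by simp
      show "g (vec.span {w}) = vec.span {B *v w}" if "peval F w = 0" "w \<noteq> 0" for w
      proof -
        have "vec.span {B *v w} = vec.span {A *v w}" unfolding Bx by (rule span_scale) (simp add: \<tau>(1))
        then show ?thesis using gA that by simp
      qed
      show "peval F (B *v w) = 0" if "peval F w = 0" for w
      proof -
        have "peval F (A *v w) = 0" using FA that by simp
        then show ?thesis by (simp add: Bx F_S S_linear)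
      qed
      show "M *v crem5 (M' *v (B *v x)) = B *v (M *v crem5 (M' *v x))" for x
      proof -
        obtain y where y: "x = M *v y" using MM(1)[of x, symmetric] by blast
        show ?thesis unfolding y by (simp only: BM MM crem5_permute[OF \<rho>(1)])
      qed
    qed
  qed
  from bchoice[OF this] obtain B where "\<forall>g\<in>G. invertible (B g) \<and> B g *v (M *v sc.\<eta>) = M *v sc.\<eta> \<and>
    (\<forall>w. peval F w = 0 \<longrightarrow> w \<noteq> 0 \<longrightarrow> g (vec.span {w}) = vec.span {B g *v w}) \<and>
    (\<forall>w. peval F w = 0 \<longrightarrow> peval F (B g *v w) = 0) \<and> (\<forall>x. M *v crem5 (M' *v (B g *v x)) = B g *v (M *v crem5 (M' *v x)))"
    by (rule exE)
  note B = bspec[OF this]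
  define T where "T x = sc.T (M' *v x)" for x
  define J where "J z = M *v sc.J z" for z
  define \<kappa> where "\<kappa> x = M *v crem5 (M' *v x)" for x
  have T\<kappa>: "T (\<kappa> x) = sc.T (crem5 (M' *v x))" for x by (simp add: T_def \<kappa>_def MM)
  have \<eta>0: "sc.\<eta> \<noteq> 0" by (simp add: sc.\<eta>_def vec_eq_5)
  obtain z0 where z0: "z0 \<noteq> 0" "sc.b z0 * prod5 (sc.Y z0) \<noteq> 0" using sc.generic_z by blast
  show ?thesis
  proof (rule linearizable_of_projection[where T = T and J = J and \<eta> = "M *v sc.\<eta>" and B = B and \<kappa> = \<kappa>
        and gv = "\<lambda>z. M *v crem5 (sc.Y z)" and H = "\<lambda>x. prod5 (M' *v x) * sc.b (T (\<kappa> x))"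
        and K = "\<lambda>z. sc.b z * prod5 (sc.Y z)" and d = 4 and ?z0.0 = z0, OF G(1)])
    show "linear_map T" unfolding T_def by (rule linear_map_comp[OF sc.linear_T linear_map_matrix_mult])
    show "linear_map J" unfolding J_def by (rule linear_map_comp[OF linear_map_matrix_mult sc.linear_J])
    show "T (J z) = z" for z by (simp add: T_def J_def MM sc.T_J)
    show "\<exists>s. y = J (T y) + s *s (M *v sc.\<eta>)" for y
    proof -
      define s where "s = inverse 2 * ((M' *v y) $ 4 + (M' *v y) $ 5)"
      have "M *v (M' *v y) = M *v (sc.J (sc.T (M' *v y)) + s *s sc.\<eta>)"
        using sc.J_T[of "M' *v y", folded s_def] by (rule arg_cong)
      then have "y = J (T y) + s *s (M *v sc.\<eta>)"
        by (simp only: MM matrix_vector_right_distrib vector_scalar_commute T_def J_def)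
      then show ?thesis by (rule exI)
    qed
    show "T (M *v sc.\<eta>) = 0" by (simp add: T_def MM sc.T_\<eta>)
    show "M *v sc.\<eta> \<noteq> 0" by (rule M0[OF \<eta>0])
    show "invertible (B g)" "B g *v (M *v sc.\<eta>) = M *v sc.\<eta>" if "g \<in> G" for g using B[OF that] by simp_all
    show "g (vec.span {w}) = vec.span {B g *v w}" if "g \<in> G" "peval F w = 0" "w \<noteq> 0" for g w using B[OF that(1)] that(2,3) by simp
    show "peval F (B g *v w) = 0" if "g \<in> G" "peval F w = 0" for g w using B[OF that(1)] that(2) by simp
    show "\<kappa> (B g *v x) = B g *v \<kappa> x" if "g \<in> G" for g x using B[OF that] by (simp add: \<kappa>_def)
    have fM: "form 4 (\<lambda>x. crem5 (M' *v x) $ i)" for i by (rule form_comp1[OF form_crem5 form_linear])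
    show fT: "form 4 (\<lambda>x. T (\<kappa> x) $ i)" for i unfolding T\<kappa> by (rule sc.form_T[OF fM])
    show "form (1 * (4 * 2)) (\<lambda>z. (M *v crem5 (sc.Y z)) $ i)" for i
      by (rule form_comp[OF form_linear form_comp[OF form_crem5 sc.form_Y]])
    show "form (5 + 1 * 4) (\<lambda>x. prod5 (M' *v x) * sc.b (T (\<kappa> x)))"
      by (rule form_mult[OF form_comp1[OF form_prod5 form_linear] form_comp[OF sc.form_b fT]])
    show "form (1 + 5 * 2) (\<lambda>z. sc.b z * prod5 (sc.Y z))"
      by (rule form_mult[OF sc.form_b form_comp[OF form_prod5 sc.form_Y]])
    show "z0 \<noteq> 0" "sc.b z0 * prod5 (sc.Y z0) \<noteq> 0" by (rule z0)+
  next
    fix x assume x: "peval F x = 0" "x \<noteq> 0" "prod5 (M' *v x) * sc.b (T (\<kappa> x)) \<noteq> 0"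
    have "sc.P (M' *v x) = 0" using FM[of "M' *v x"] x(1) K0 by (simp add: MM)
    moreover have "prod5 (M' *v x) \<noteq> 0" "sc.b (sc.T (crem5 (M' *v x))) \<noteq> 0" using x(3) by (auto simp: T\<kappa>)
    ultimately have 1: "sc.T (crem5 (M' *v x)) \<noteq> 0"
        "sc.b (sc.T (crem5 (M' *v x))) * prod5 (sc.Y (sc.T (crem5 (M' *v x)))) \<noteq> 0"
        "\<exists>\<mu>. \<mu> \<noteq> 0 \<and> crem5 (sc.Y (sc.T (crem5 (M' *v x)))) = \<mu> *s (M' *v x)"
      using sc.T_crem5 by blast+
    then obtain \<mu> where \<mu>: "\<mu> \<noteq> 0" "crem5 (sc.Y (sc.T (crem5 (M' *v x)))) = \<mu> *s (M' *v x)" by blast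
    have "M *v crem5 (sc.Y (T (\<kappa> x))) = \<mu> *s x" unfolding T\<kappa> \<mu>(2) by (simp add: vector_scalar_commute MM)
    then show "T (\<kappa> x) \<noteq> 0 \<and> sc.b (T (\<kappa> x)) * prod5 (sc.Y (T (\<kappa> x))) \<noteq> 0 \<and>
        (\<exists>\<mu>. \<mu> \<noteq> 0 \<and> M *v crem5 (sc.Y (T (\<kappa> x))) = \<mu> *s x)"
      using 1(1,2) \<mu>(1) unfolding T\<kappa> by blast
  next
    fix z assume z: "sc.b z * prod5 (sc.Y z) \<noteq> 0"
    let ?x = "crem5 (sc.Y z)"
    have "?x \<noteq> 0" using sc.crem5_Y(2)[OF z] by (auto simp: prod5_def)
    then have "M *v ?x \<noteq> 0" by (rule M0)
    moreover have "peval F (M *v ?x) = 0" by (simp add: FM sc.crem5_Y(1)[OF z])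
    moreover have "prod5 ?x * sc.b (sc.T (crem5 ?x)) \<noteq> 0" using sc.crem5_Y(2,4)[OF z] by simp
    moreover have "\<exists>\<nu>. \<nu> \<noteq> 0 \<and> sc.T (crem5 ?x) = \<nu> *s z" by (rule sc.crem5_Y(3)[OF z])
    ultimately show "peval F (M *v ?x) = 0 \<and> M *v ?x \<noteq> 0 \<and> prod5 (M' *v (M *v ?x)) * sc.b (T (\<kappa> (M *v ?x))) \<noteq> 0 \<and>
        (\<exists>\<nu>. \<nu> \<noteq> 0 \<and> T (\<kappa> (M *v ?x)) = \<nu> *s z)"
      unfolding T\<kappa> MM by blast
  qed
qed

end

section \<open>Orbits on the nodes\<close>

definition list5 :: "'a \<Rightarrow> 'a \<Rightarrow> 'a \<Rightarrow> 'a \<Rightarrow> 'a \<Rightarrow> 5 \<Rightarrow> 'a" where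
  "list5 a b c d e i = (if i = 1 then a else if i = 2 then b else if i = 3 then c else if i = 4 then d else e)"

lemma list5_nth [simp]:
  "list5 a b c d e 1 = a" "list5 a b c d e 2 = b" "list5 a b c d e 3 = c" "list5 a b c d e 4 = d" "list5 a b c d e 5 = e"
  by (simp_all add: list5_def)

lemma bij_list5:
  fixes a :: 5
  assumes "distinct [a, b, c, d, e]" shows "bij (list5 a b c d e)"
proof -
  have "inj (list5 a b c d e)"
  proof (rule injI)
    fix i j :: 5 assume eq: "list5 a b c d e i = list5 a b c d e j"
    show "i = j" using exhaust_5[of i] exhaust_5[of j] eq assms by (elim disjE) simp_all
  qed
  from bijI[OF this finite_UNIV_inj_surj[OF finite this]] show ?thesis .
qed

text \<open>The relation has at least two classes and none is a singleton; 3 + 2 is the only such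
  partition of five. Reflexivity follows from \<open>no_fixed\<close>, symmetry and
  transitivity.\<close>

lemma five_points_3_2:
  fixes R :: "5 \<Rightarrow> 5 \<Rightarrow> bool"
  assumes sym: "\<And>i j. R i j \<Longrightarrow> R j i" and trans: "\<And>i j k. R i j \<Longrightarrow> R j k \<Longrightarrow> R i k"
    and intrans: "\<not> R i0 j0" and no_fixed: "\<And>i. \<exists>j. j \<noteq> i \<and> R i j"
  shows "\<exists>\<pi> :: 5 \<Rightarrow> 5. bij \<pi> \<and> R (\<pi> 1) (\<pi> 2) \<and> R (\<pi> 2) (\<pi> 3) \<and> R (\<pi> 4) (\<pi> 5) \<and> \<not> R (\<pi> 1) (\<pi> 4)"
proof -
  \<comment> \<open>Pairs from two different classes use up four points; the fifth point
    \<open>e\<close> must join one of them.\<close>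
  obtain a where a: "a \<noteq> i0" "R i0 a" using no_fixed by blast
  obtain b where b: "b \<noteq> j0" "R j0 b" using no_fixed by blast
  have "R i0 i0" by (rule trans[OF a(2) sym[OF a(2)]])
  then have "i0 \<noteq> j0" using intrans by metis
  moreover have "i0 \<noteq> b" using intrans sym[OF b(2)] by metis
  moreover have "a \<noteq> j0" using intrans a(2) by metis
  moreover have "a \<noteq> b" using intrans trans[OF a(2), of j0] sym[OF b(2)] by metis
  ultimately have d4: "distinct [i0, a, j0, b]" using a(1) b(1) by auto
  have "card {i0, a, j0, b} < card (UNIV :: 5 set)" using card_length[of "[i0, a, j0, b]"] by simp
  then have "{i0, a, j0, b} \<noteq> UNIV" by (metis less_irrefl)
  then obtain e where e: "e \<notin> {i0, a, j0, b}" by blast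
  have d: "distinct [i0, a, j0, b, e]" using d4 e by auto
  have U: "UNIV = {i0, a, j0, b, e}" by (rule UNIV_5_distinct[OF d])
  obtain f where f: "f \<noteq> e" "R e f" using no_fixed by blast
  have "f = i0 \<or> f = a \<or> f = j0 \<or> f = b" using U f(1) by blast
  then consider "R e i0" | "R e j0"
  proof (elim disjE)
    assume "f = a"
    then have "R e i0" using trans[OF f(2), of i0] sym[OF a(2)] by simp
    then show ?thesis by (rule that(1))
  next
    assume "f = b"
    then have "R e j0" using trans[OF f(2), of j0] sym[OF b(2)] by simp
    then show ?thesis by (rule that(2))
  qed (use f(2) that in simp_all)
  then show ?thesis
  proof cases
    case 1
    have "bij (list5 i0 a e j0 b)" by (rule bij_list5) (use d in auto)
    moreover have "R a e" by (rule trans[OF sym[OF a(2)] sym[OF 1]])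
    ultimately have "bij (list5 i0 a e j0 b) \<and> R i0 a \<and> R a e \<and> R j0 b \<and> \<not> R i0 j0" using a(2) b(2) intrans by simp
    then have *: "bij (list5 i0 a e j0 b) \<and> R (list5 i0 a e j0 b 1) (list5 i0 a e j0 b 2) \<and> R (list5 i0 a e j0 b 2) (list5 i0 a e j0 b 3)
        \<and> R (list5 i0 a e j0 b 4) (list5 i0 a e j0 b 5) \<and> \<not> R (list5 i0 a e j0 b 1) (list5 i0 a e j0 b 4)" by simp
    show ?thesis by (rule exI[of _ "list5 i0 a e j0 b"]) (rule *)
  next
    case 2
    have "bij (list5 j0 b e i0 a)" by (rule bij_list5) (use d in auto)
    moreover have "R b e" by (rule trans[OF sym[OF b(2)] sym[OF 2]])
    moreover have "\<not> R j0 i0" using intrans sym[of j0 i0] by blast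
    ultimately have "bij (list5 j0 b e i0 a) \<and> R j0 b \<and> R b e \<and> R i0 a \<and> \<not> R j0 i0" using a(2) b(2) by simp
    then have *: "bij (list5 j0 b e i0 a) \<and> R (list5 j0 b e i0 a 1) (list5 j0 b e i0 a 2) \<and> R (list5 j0 b e i0 a 2) (list5 j0 b e i0 a 3)
        \<and> R (list5 j0 b e i0 a 4) (list5 j0 b e i0 a 5) \<and> \<not> R (list5 j0 b e i0 a 1) (list5 j0 b e i0 a 4)" by simp
    show ?thesis by (rule exI[of _ "list5 j0 b e i0 a"]) (rule *)
  qed
qed

text \<open>A transitive permutation group of three points contains a 3-cycle; its fourth power is the
  identity on the two remaining points.\<close>

lemma three_cycle:
  fixes Ps :: "(5 \<Rightarrow> 5) set"
  assumes comp: "\<And>\<sigma> \<rho>. \<sigma> \<in> Ps \<Longrightarrow> \<rho> \<in> Ps \<Longrightarrow> (\<lambda>i. \<sigma> (\<rho> i)) \<in> Ps"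
    and inj: "\<And>\<sigma>. \<sigma> \<in> Ps \<Longrightarrow> inj \<sigma>"
    and orb3: "\<And>\<sigma> i. \<sigma> \<in> Ps \<Longrightarrow> i \<in> {1, 2, 3} \<Longrightarrow> \<sigma> i \<in> {1, 2, 3}"
    and orb2: "\<And>\<sigma> i. \<sigma> \<in> Ps \<Longrightarrow> i \<in> {4, 5} \<Longrightarrow> \<sigma> i \<in> {4, 5}"
    and \<sigma>: "\<sigma> \<in> Ps" "\<sigma> 1 = 2" and \<rho>: "\<rho> \<in> Ps" "\<rho> 2 = 3"
  shows "\<exists>c\<in>Ps. c 1 = 2 \<and> c 2 = 3 \<and> c 3 = 1 \<and> c 4 = 4 \<and> c 5 = 5"
proof -
  have ne: "\<tau> 1 \<noteq> \<tau> 2" "\<tau> 1 \<noteq> \<tau> 3" "\<tau> 2 \<noteq> \<tau> 3" "\<tau> 4 \<noteq> \<tau> 5" if "\<tau> \<in> Ps" for \<tau>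
    using inj[OF that] distinct_5 by (simp_all add: inj_eq)
  have in3: "\<tau> 1 = 1 \<or> \<tau> 1 = 2 \<or> \<tau> 1 = 3" "\<tau> 2 = 1 \<or> \<tau> 2 = 2 \<or> \<tau> 2 = 3" "\<tau> 3 = 1 \<or> \<tau> 3 = 2 \<or> \<tau> 3 = 3" if "\<tau> \<in> Ps" for \<tau>
    using orb3[OF that, of 1] orb3[OF that, of 2] orb3[OF that, of 3] by simp_all
  have in2: "\<tau> 4 = 4 \<and> \<tau> 5 = 5 \<or> \<tau> 4 = 5 \<and> \<tau> 5 = 4" if "\<tau> \<in> Ps" for \<tau>
    using orb2[OF that, of 4] orb2[OF that, of 5] ne(4)[OF that] by auto
  have c: ?thesis if f: "f \<in> Ps" "f 1 = 2 \<and> f 2 = 3 \<and> f 3 = 1 \<or> f 1 = 3 \<and> f 3 = 2 \<and> f 2 = 1" for f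
  proof -
    \<comment> \<open>Squaring undoes a possible exchange of 4 and 5 and reverses the cycle on 1, 2,
      3; squaring again restores its direction.\<close>
    define f2 where "f2 i = f (f i)" for i
    define f4 where "f4 i = f2 (f2 i)" for i
    have f2: "f2 \<in> Ps" using comp[OF f(1) f(1)] unfolding f2_def .
    have f4: "f4 \<in> Ps" using comp[OF f2 f2] unfolding f4_def .
    have f45: "f2 4 = 4" "f2 5 = 5" using in2[OF f(1)] by (auto simp: f2_def)
    from f(2) show ?thesis
    proof
      assume "f 1 = 2 \<and> f 2 = 3 \<and> f 3 = 1"
      then show ?thesis using f4 f45 by (intro bexI[of _ f4]) (auto simp: f4_def f2_def[of 1] f2_def[of 2] f2_def[of 3])
    next
      assume "f 1 = 3 \<and> f 3 = 2 \<and> f 2 = 1"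
      then show ?thesis using f2 f45 by (intro bexI[of _ f2]) (auto simp: f2_def[of 1] f2_def[of 2] f2_def[of 3])
    qed
  qed
  have "\<sigma> 2 = 3 \<and> \<sigma> 3 = 1 \<or> \<sigma> 2 = 1 \<and> \<sigma> 3 = 3" using in3(2,3)[OF \<sigma>(1)] ne(1-3)[OF \<sigma>(1)] \<sigma>(2) by auto
  moreover have "\<rho> 1 = 2 \<and> \<rho> 3 = 1 \<or> \<rho> 1 = 1 \<and> \<rho> 3 = 2" using in3(1,3)[OF \<rho>(1)] ne(1-3)[OF \<rho>(1)] \<rho>(2) by auto
  \<comment> \<open>Both elements are transpositions on 1, 2, 3, and their product is a
    3-cycle.\<close>
  moreover have "?thesis" if "\<sigma> 2 = 1" "\<sigma> 3 = 3" "\<rho> 1 = 1" "\<rho> 3 = 2"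
    using c[OF comp[OF \<rho>(1) \<sigma>(1)]] that \<sigma>(2) \<rho>(2) by simp
  ultimately show ?thesis using c[OF \<sigma>(1)] c[OF \<rho>(1)] \<sigma>(2) \<rho>(2) by blast
qed

context five_nodal_cubic
begin

lemma Aut_Sing:
  assumes "g \<in> Aut (hypersurface F)" and p: "p \<in> Sing F"
  shows "g p \<in> Sing F"
proof -
  from Aut_linear[OF assms(1)] obtain A t where A: "invertible A"
    and gA: "\<forall>w. peval F w = 0 \<longrightarrow> w \<noteq> 0 \<longrightarrow> g (vec.span {w}) = vec.span {A *v w}"
    and FA: "\<forall>x. peval F (A *v x) = t * peval F x" by (elim exE conjE)
  obtain u where u: "u \<noteq> 0" "p = vec.span {u}" "\<And>w. S u u w = 0" using Sing_obtain[OF p] by blast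
  have "S (A *v u) (A *v u) z = 0" for z
  proof -
    have "z = A *v (matrix_inv A *v z)" by (simp add: matrix_vector_mul_assoc matrix_inv_both[OF A])
    then show ?thesis using S_equivariant[OF spec[OF FA], of u u "matrix_inv A *v z"] u(3) by simp
  qed
  then have "vec.span {A *v u} \<in> Sing F" using span_in_Sing_iff[OF invertible_nonzero[OF A u(1)]] by blast
  moreover have "g p = vec.span {A *v u}" using gA u(1,3) unfolding u(2) by (simp add: F_S)
  ultimately show ?thesis by simp
qed

text \<open>The orbit relation \<open>R\<close> on the indices of the nodes is symmetric and
  transitive because \<open>G\<close> is a group. A singleton orbit is a fixed node; without one,
  \<open>five_points_3_2\<close> applies. Group laws are used pointwise on the cubic, since elements
  of \<open>BijGroup\<close> are extensional functions.\<close>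

lemma linearizable_of_intransitive:
  assumes G: "subgroup G (BijGroup (hypersurface F))" "G \<subseteq> Aut (hypersurface F)"
    and intrans: "\<not> acts_transitively_on G (Sing F)"
  shows "linearizable G (hypersurface F)"
proof -
  let ?X = "hypersurface F"
  have GX: "g \<in> Bij ?X" if "g \<in> G" for g using that subgroup.subset[OF G(1)] by (auto simp: BijGroup_def)
  have id: "\<exists>k\<in>G. \<forall>p\<in>?X. k p = p"
    using subgroup.one_closed[OF G(1)] by (intro bexI) (auto simp: BijGroup_def)
  have comp: "\<exists>k\<in>G. \<forall>p\<in>?X. k p = g (h p)" if "g \<in> G" "h \<in> G" for g h
    using subgroup.m_closed[OF G(1) that] GX[OF that(1)] GX[OF that(2)] by (intro bexI) (auto simp: BijGroup_def compose_def)
  have inverse: "\<exists>k\<in>G. \<forall>p\<in>?X. k (g p) = p" if "g \<in> G" for g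
  proof -
    have k: "inv\<^bsub>BijGroup ?X\<^esub> g \<in> G" by (rule subgroup.m_inv_closed[OF G(1) that])
    have "bij_betw g ?X ?X" using GX[OF that] by (simp add: Bij_def)
    then have "(inv\<^bsub>BijGroup ?X\<^esub> g) (g p) = p" if "p \<in> ?X" for p
      using that bij_betwE bij_betw_inv_into_left[of g ?X ?X p] by (fastforce simp: inv_BijGroup[OF GX[OF \<open>g \<in> G\<close>]])
    then show ?thesis using k by blast
  qed
  have SX: "Sing F \<subseteq> ?X" by (auto simp: Sing_def)
  obtain v where v: "frame v" using frame_exists[OF card_Sing position] by blast
  define R where "R i j \<longleftrightarrow> (\<exists>g\<in>G. g (vec.span {v i}) = vec.span {v j})" for i j
  have vX: "vec.span {v i} \<in> ?X" for i using frame_Sing[OF v] SX by blast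
  have R_sym: "R j i" if "R i j" for i j
  proof -
    obtain g where g: "g \<in> G" "g (vec.span {v i}) = vec.span {v j}" using \<open>R i j\<close> unfolding R_def by blast
    obtain k where k: "k \<in> G" "\<forall>p\<in>?X. k (g p) = p" using inverse[OF g(1)] by blast
    have "k (vec.span {v j}) = vec.span {v i}" using bspec[OF k(2) vX[of i]] unfolding g(2) .
    then show ?thesis unfolding R_def using k(1) by blast
  qed
  have R_trans: "R i k" if "R i j" "R j k" for i j k
  proof -
    obtain h where h: "h \<in> G" "h (vec.span {v i}) = vec.span {v j}" using \<open>R i j\<close> unfolding R_def by blast
    obtain g where g: "g \<in> G" "g (vec.span {v j}) = vec.span {v k}" using \<open>R j k\<close> unfolding R_def by blast
    obtain l where l: "l \<in> G" "\<forall>p\<in>?X. l p = g (h p)" using comp[OF g(1) h(1)] by blast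
    have "l (vec.span {v i}) = vec.span {v k}" using bspec[OF l(2) vX[of i]] unfolding h(2) g(2) .
    then show ?thesis unfolding R_def using l(1) by blast
  qed
  have R_ex: "\<exists>j. g (vec.span {v i}) = vec.span {v j} \<and> R i j" if "g \<in> G" for g i
  proof -
    have "g (vec.span {v i}) \<in> Sing F" using Aut_Sing frame_Sing[OF v] G(2) that by blast
    then obtain j where j: "g (vec.span {v i}) = vec.span {v j}" using v unfolding frame_def by blast
    then show ?thesis unfolding R_def using that by blast
  qed
  show ?thesis
  proof (cases "\<exists>i. \<forall>j. R i j \<longrightarrow> j = i")
    case True
    then obtain i where i: "\<And>j. R i j \<Longrightarrow> j = i" by blast
    \<comment> \<open>Moves the fixed node to the last position, the centre of the projection in the
      normal form.\<close>
    define \<pi> where "\<pi> = Transposition.transpose 5 i"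
    have v': "frame (\<lambda>j. v (\<pi> j))" by (rule frame_perm[OF v]) (simp add: \<pi>_def)
    show ?thesis
    proof (rule linearizable_of_fixed_node[OF G v'])
      fix g assume "g \<in> G"
      from R_ex[OF this, of i] i show "g (vec.span {v (\<pi> 5)}) = vec.span {v (\<pi> 5)}" by (auto simp: \<pi>_def)
    qed
  next
    case False
    have "\<exists>p\<in>Sing F. \<exists>q\<in>Sing F. \<not> (\<exists>g\<in>G. g p = q)"
      using intrans unfolding acts_transitively_on_def by (simp only: ball_simps)
    then obtain p q where pq: "p \<in> Sing F" "q \<in> Sing F" "\<not> (\<exists>g\<in>G. g p = q)" by (elim bexE)
    have rng: "Sing F = range (\<lambda>i. vec.span {v i})" using v unfolding frame_def by (rule conjunct1)
    obtain i0 where i0: "p = vec.span {v i0}" using pq(1) unfolding rng by (elim rangeE)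
    obtain j0 where j0: "q = vec.span {v j0}" using pq(2) unfolding rng by (elim rangeE)
    have ij: "\<not> R i0 j0" using pq(3) unfolding R_def i0 j0 .
    have nf: "\<exists>j. j \<noteq> i \<and> R i j" for i using False by blast
    have "\<exists>\<pi> :: 5 \<Rightarrow> 5. bij \<pi> \<and> R (\<pi> 1) (\<pi> 2) \<and> R (\<pi> 2) (\<pi> 3) \<and> R (\<pi> 4) (\<pi> 5) \<and> \<not> R (\<pi> 1) (\<pi> 4)"
      by (rule five_points_3_2[of R, OF _ _ ij nf]) (erule R_sym, erule (1) R_trans)
    then obtain \<pi> :: "5 \<Rightarrow> 5" where \<pi>: "bij \<pi>" and R12: "R (\<pi> 1) (\<pi> 2)" and R23: "R (\<pi> 2) (\<pi> 3)"
      and R45: "R (\<pi> 4) (\<pi> 5)" and R14: "\<not> R (\<pi> 1) (\<pi> 4)" by (elim exE conjE)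
    define v' where "v' j = v (\<pi> j)" for j
    have v': "frame v'" unfolding v'_def by (rule frame_perm[OF v \<pi>])
    have R_ex': "\<exists>j. g (vec.span {v' i}) = vec.span {v' j} \<and> R (\<pi> i) (\<pi> j)" if "g \<in> G" for g i
    proof -
      from R_ex[OF that, of "\<pi> i"] obtain j where j: "g (vec.span {v (\<pi> i)}) = vec.span {v j}" "R (\<pi> i) j" by (elim exE conjE)
      have jj: "\<pi> (inv_into UNIV \<pi> j) = j" using \<pi> by (simp add: bij_is_surj surj_f_inv_f)
      show ?thesis unfolding v'_def by (rule exI[of _ "inv_into UNIV \<pi> j"]) (simp only: jj j simp_thms)
    qed
    have R1: "R (\<pi> 1) (\<pi> i)" if "i \<in> {1, 2, 3}" for i
      using that R12 R_trans[OF R12 R23] R_trans[OF R12 R_sym[OF R12]] by auto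
    have R4: "R (\<pi> 4) (\<pi> i)" if "i \<in> {4, 5}" for i
      using that R45 R_trans[OF R45 R_sym[OF R45]] by auto
    have sep: "\<not> R (\<pi> i) (\<pi> j)" "\<not> R (\<pi> j) (\<pi> i)" if "i \<in> {1, 2, 3}" "j \<in> {4, 5}" for i j
    proof -
      show 1: "\<not> R (\<pi> i) (\<pi> j)"
      proof
        assume "R (\<pi> i) (\<pi> j)"
        from R_trans[OF R_trans[OF R1[OF that(1)] this] R_sym[OF R4[OF that(2)]]] show False using R14 by blast
      qed
      show "\<not> R (\<pi> j) (\<pi> i)" using 1 R_sym by blast
    qed
    have split: "P" if "j \<in> {1, 2, 3} \<Longrightarrow> P" "j \<in> {4, 5} \<Longrightarrow> P" for j :: 5 and P
      using exhaust_5[of j] that by (elim disjE) simp_all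
    have orb3: "\<exists>j\<in>{1, 2, 3}. g (vec.span {v' i}) = vec.span {v' j}" if g: "g \<in> G" and i: "i \<in> {1, 2, 3}" for g i
    proof -
      obtain j where j: "g (vec.span {v' i}) = vec.span {v' j}" "R (\<pi> i) (\<pi> j)" using R_ex'[OF g, of i] by (elim exE conjE)
      have "j \<in> {1, 2, 3}" by (rule split[of j]) (use sep(1)[OF i, of j] j(2) in simp_all)
      then show ?thesis by (rule bexI[rotated]) (rule j(1))
    qed
    have orb2: "\<exists>j\<in>{4, 5}. g (vec.span {v' i}) = vec.span {v' j}" if g: "g \<in> G" and i: "i \<in> {4, 5}" for g i
    proof -
      obtain j where j: "g (vec.span {v' i}) = vec.span {v' j}" "R (\<pi> i) (\<pi> j)" using R_ex'[OF g, of i] by (elim exE conjE)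
      have "j \<in> {4, 5}" by (rule split[of j]) (use sep(2)[OF _ i, of j] j(2) in simp_all)
      then show ?thesis by (rule bexI[rotated]) (rule j(1))
    qed
    \<comment> \<open>The permutations of the five indices induced by \<open>G\<close>; finding a
      3-cycle becomes a purely combinatorial question.\<close>
    define Ps where "Ps = {\<sigma>. \<exists>g\<in>G. \<forall>i. g (vec.span {v' i}) = vec.span {v' (\<sigma> i)}}"
    have Ps_ex: "\<exists>\<sigma>\<in>Ps. \<forall>i. g (vec.span {v' i}) = vec.span {v' (\<sigma> i)}" if "g \<in> G" for g
    proof -
      have "\<forall>i. \<exists>j. g (vec.span {v' i}) = vec.span {v' j}" using R_ex'[OF that] by blast
      from choice[OF this] obtain \<sigma> where "\<forall>i. g (vec.span {v' i}) = vec.span {v' (\<sigma> i)}" by (rule exE)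
      then show ?thesis unfolding Ps_def using that by blast
    qed
    have v'X: "vec.span {v' i} \<in> ?X" for i unfolding v'_def by (rule vX)
    have Ps_eq: "\<sigma> i = j" if "\<forall>i. g (vec.span {v' i}) = vec.span {v' (\<sigma> i)}" "g (vec.span {v' i}) = vec.span {v' j}" for g \<sigma> i j
      by (rule frame_span_inj[OF v']) (simp only: that(2)[symmetric] spec[OF that(1)])
    have "\<exists>c\<in>Ps. c 1 = 2 \<and> c 2 = 3 \<and> c 3 = 1 \<and> c 4 = 4 \<and> c 5 = 5"
    proof -
      obtain g where g: "g \<in> G" "g (vec.span {v' 1}) = vec.span {v' 2}" using R12 unfolding R_def v'_def by blast
      obtain h where h: "h \<in> G" "h (vec.span {v' 2}) = vec.span {v' 3}" using R23 unfolding R_def v'_def by blast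
      obtain \<sigma> where \<sigma>: "\<sigma> \<in> Ps" "\<forall>i. g (vec.span {v' i}) = vec.span {v' (\<sigma> i)}" using Ps_ex[OF g(1)] by (elim bexE)
      obtain \<rho> where \<rho>: "\<rho> \<in> Ps" "\<forall>i. h (vec.span {v' i}) = vec.span {v' (\<rho> i)}" using Ps_ex[OF h(1)] by (elim bexE)
      show ?thesis
      proof (rule three_cycle[OF _ _ _ _ \<sigma>(1) Ps_eq[OF \<sigma>(2) g(2)] \<rho>(1) Ps_eq[OF \<rho>(2) h(2)]])
        fix \<sigma> assume "\<sigma> \<in> Ps"
        then obtain g where g: "g \<in> G" "\<forall>i. g (vec.span {v' i}) = vec.span {v' (\<sigma> i)}" unfolding Ps_def by blast
        from Aut_frame[OF subsetD[OF G(2) g(1)] v' spec[OF g(2)]] show "inj \<sigma>" by (elim exE conjE)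
        show "\<sigma> i \<in> {1, 2, 3}" if i: "i \<in> {1, 2, 3}" for i
        proof -
          obtain j where j: "j \<in> {1, 2, 3}" "g (vec.span {v' i}) = vec.span {v' j}" using orb3[OF g(1) i] by (elim bexE)
          show ?thesis unfolding Ps_eq[OF g(2) j(2)] by (rule j(1))
        qed
        show "\<sigma> i \<in> {4, 5}" if i: "i \<in> {4, 5}" for i
        proof -
          obtain j where j: "j \<in> {4, 5}" "g (vec.span {v' i}) = vec.span {v' j}" using orb2[OF g(1) i] by (elim bexE)
          show ?thesis unfolding Ps_eq[OF g(2) j(2)] by (rule j(1))
        qed
        fix \<rho> assume "\<rho> \<in> Ps"
        then obtain h where h: "h \<in> G" "\<forall>i. h (vec.span {v' i}) = vec.span {v' (\<rho> i)}" unfolding Ps_def by blast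
        obtain k where k: "k \<in> G" "\<forall>p\<in>?X. k p = g (h p)" using comp[OF g(1) h(1)] by (elim bexE)
        have "k (vec.span {v' i}) = vec.span {v' (\<sigma> (\<rho> i))}" for i
          using bspec[OF k(2) v'X[of i]] unfolding spec[OF h(2)] spec[OF g(2)] .
        then show "(\<lambda>i. \<sigma> (\<rho> i)) \<in> Ps" unfolding Ps_def using k(1) by blast
      qed
    qed
    then obtain \<sigma> where \<sigma>: "\<sigma> \<in> Ps" "\<sigma> 1 = 2" "\<sigma> 2 = 3" "\<sigma> 3 = 1" "\<sigma> 4 = 4" "\<sigma> 5 = 5" by (elim bexE conjE)
    then obtain c where c: "c \<in> G" "\<forall>i. c (vec.span {v' i}) = vec.span {v' (\<sigma> i)}" unfolding Ps_def by blast
    note cs = spec[OF c(2), of 1] spec[OF c(2), of 2] spec[OF c(2), of 3] spec[OF c(2), of 4] spec[OF c(2), of 5]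
    show ?thesis by (rule linearizable_of_3_2[OF G v' _ _ c(1) cs[unfolded \<sigma>(2-6)]]) (erule (1) orb3, erule (1) orb2)
  qed
qed

end

theorem lemma6p1:
  fixes F :: "(5, 'k::{alg_closed_field, field_char_0}) mpoly"
    and X :: "('k ^ 5) set set"
    and G :: "(('k ^ 5) set \<Rightarrow> ('k ^ 5) set) set"
  assumes "F \<noteq> 0" and "homogeneous 3 F" and "X = hypersurface F"
    and "card (Sing F) = 5" and "\<forall>p\<in>Sing F. node F p"
    and "general_linear_position (Sing F)"
    and "subgroup G (BijGroup X)" and "G \<subseteq> Aut X"
    and "\<not> acts_transitively_on G (Sing F)"
  shows "linearizable G X"
proof -
  have form_F: "form 3 (peval F)" using form_peval[OF assms(2)] by simp
  from cubic_polarization[OF this] obtain S where S: "sym_trilinear S" "\<forall>x. peval F x = S x x x" by (elim exE conjE)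
  interpret sym_trilinear S by (rule S(1))
  interpret five_nodal_cubic S F
    by unfold_locales (use S(2) assms(4-6) form_F in auto)
  show ?thesis using linearizable_of_intransitive assms(3,7-9) by blast
qed

end
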